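(* Let $M$ be a closed manifold of dimension $n$ and let $(M,g(t))$, $t\in[0,T]$, be a solution to the Ricci flow $\frac{\partial}{\partial t}g(t)=-2\,Rc(g(t))$. Let $f$ be a positive solution of the conjugate heat equation $$\frac{\partial f}{\partial t}=-\Delta f+Rf,$$ and let $v=-\log f-\frac{n}{2}\log(4\pi\tau)$, where $\tau=T-t$. Then $$\max_M\left(2\Delta v-|\nabla v|^2+R\right)$$ increases (i.e. is nondecreasing) in $t$ along the Ricci flow.
   Context: $Rc$ denotes the Ricci curvature and $R$ the scalar curvature of the evolving metric $g(t)$. The Laplacian $\Delta$ (the trace of the Hessian), the gradient $\nabla$ and the norm $|\cdot|$ are all taken with respect to the evolving metric $g(t)$. Solutions are smooth. For each $t$ the maximum is taken over the points of $M$ at time $t$; $v$ is defined for $t<T$. No curvature assumption is made. *)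

theory Defs
  imports "HOL-Analysis.Analysis"
begin

section \<open>Smooth functions\<close>

text \<open>Derivatives are taken within \<open>S\<close>, so the notion applies to open sets and also to
  space-time sets \<open>U \<times> {0..T}\<close> and \<open>U \<times> {0..<T}\<close> with \<open>U\<close> open and \<open>0 < T\<close>; at an end point of
  the time interval the time derivative is one-sided. On such sets the derivative within
  \<open>S\<close> is unique.\<close>

primrec Ck_on :: "nat \<Rightarrow> 'a::real_normed_vector set \<Rightarrow> ('a \<Rightarrow> 'b::real_normed_vector) \<Rightarrow> bool" where
  "Ck_on 0 S F \<longleftrightarrow> continuous_on S F"
| "Ck_on (Suc k) S F \<longleftrightarrow> F differentiable_on S \<and>
     (\<forall>w. Ck_on k S (\<lambda>x. frechet_derivative F (at x within S) w))"

definition smooth_on :: "'a::real_normed_vector set \<Rightarrow> ('a \<Rightarrow> 'b::real_normed_vector) \<Rightarrow> bool" where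
  "smooth_on S F \<longleftrightarrow> (\<forall>k. Ck_on k S F)"


section \<open>Riemannian geometry on an open subset of Euclidean space\<close>

text \<open>\<open>G x $ i $ j\<close> is the metric component \<open>g(\<partial>\<^sub>i, \<partial>\<^sub>j)\<close> at \<open>x\<close>, and
  \<open>matrix_inv (G x) $ i $ j\<close> is \<open>g\<close> with upper indices \<open>i j\<close>.\<close>

definition coord_deriv :: "'n::finite \<Rightarrow> (real^'n \<Rightarrow> real) \<Rightarrow> real^'n \<Rightarrow> real" where
  "coord_deriv i F x = frechet_derivative F (at x) (axis i 1)"

text \<open>\<open>christoffel G k i j\<close> has upper index \<open>k\<close>: it is the \<open>\<partial>\<^sub>k\<close>-component of
  \<open>\<nabla>\<^bsub>\<partial>i\<^esub> \<partial>\<^sub>j\<close> for the Levi-Civita connection.\<close>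

definition christoffel ::
  "(real^'n \<Rightarrow> real^'n^'n) \<Rightarrow> 'n::finite \<Rightarrow> 'n \<Rightarrow> 'n \<Rightarrow> real^'n \<Rightarrow> real" where
  "christoffel G k i j x =
     (1/2) * (\<Sum>l\<in>UNIV. matrix_inv (G x) $ k $ l *
       (coord_deriv i (\<lambda>y. G y $ j $ l) x + coord_deriv j (\<lambda>y. G y $ i $ l) x
        - coord_deriv l (\<lambda>y. G y $ i $ j) x))"

text \<open>\<open>riemann G l i j k\<close> is the \<open>\<partial>\<^sub>l\<close>-component of \<open>Rm(\<partial>\<^sub>i, \<partial>\<^sub>j) \<partial>\<^sub>k\<close>, where
  \<open>Rm(X, Y) Z = \<nabla>\<^sub>X \<nabla>\<^sub>Y Z - \<nabla>\<^sub>Y \<nabla>\<^sub>X Z - \<nabla>\<^bsub>[X,Y]\<^esub> Z\<close>.\<close>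

definition riemann ::
  "(real^'n \<Rightarrow> real^'n^'n) \<Rightarrow> 'n::finite \<Rightarrow> 'n \<Rightarrow> 'n \<Rightarrow> 'n \<Rightarrow> real^'n \<Rightarrow> real" where
  "riemann G l i j k x =
     coord_deriv i (christoffel G l j k) x - coord_deriv j (christoffel G l i k) x
     + (\<Sum>m\<in>UNIV. christoffel G l i m x * christoffel G m j k x
                 - christoffel G l j m x * christoffel G m i k x)"

text \<open>\<open>Rc(Y, Z)\<close> is the trace of \<open>X \<mapsto> Rm(X, Y) Z\<close>; round spheres have positive \<open>Rc\<close>.\<close>

definition coord_ricci :: "(real^'n \<Rightarrow> real^'n^'n) \<Rightarrow> real^'n \<Rightarrow> real^'n^'n::finite" where
  "coord_ricci G x = (\<chi> j k. \<Sum>i\<in>UNIV. riemann G i i j k x)"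

definition metric_trace :: "real^'n^'n \<Rightarrow> real^'n^'n \<Rightarrow> real" where
  "metric_trace B S = (\<Sum>i\<in>UNIV. \<Sum>j\<in>UNIV. matrix_inv B $ i $ j * S $ i $ j)"

definition coord_scalar :: "(real^'n \<Rightarrow> real^'n^'n::finite) \<Rightarrow> real^'n \<Rightarrow> real" where
  "coord_scalar G x = metric_trace (G x) (coord_ricci G x)"

definition coord_hessian ::
  "(real^'n \<Rightarrow> real^'n^'n::finite) \<Rightarrow> (real^'n \<Rightarrow> real) \<Rightarrow> real^'n \<Rightarrow> real^'n^'n" where
  "coord_hessian G F x =
     (\<chi> i j. coord_deriv i (coord_deriv j F) x
            - (\<Sum>k\<in>UNIV. christoffel G k i j x * coord_deriv k F x))"

definition coord_laplacian ::
  "(real^'n \<Rightarrow> real^'n^'n::finite) \<Rightarrow> (real^'n \<Rightarrow> real) \<Rightarrow> real^'n \<Rightarrow> real" where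
  "coord_laplacian G F x = metric_trace (G x) (coord_hessian G F x)"

definition coord_gradient ::
  "(real^'n \<Rightarrow> real^'n^'n::finite) \<Rightarrow> (real^'n \<Rightarrow> real) \<Rightarrow> real^'n \<Rightarrow> real^'n" where
  "coord_gradient G F x = matrix_inv (G x) *v (\<chi> i. coord_deriv i F x)"

definition metric_norm :: "real^'n^'n \<Rightarrow> real^'n \<Rightarrow> real" where
  "metric_norm B w = sqrt (w \<bullet> (B *v w))"


section \<open>Closed smooth manifolds\<close>

text \<open>A chart is a domain together with a coordinate map; only the values of the map on the
  domain matter. The dimension of the manifold is \<open>CARD('n)\<close>.\<close>

type_synonym ('m, 'n) chart = "'m set \<times> ('m \<Rightarrow> real^'n)"

definition chart_image :: "('m, 'n::finite) chart \<Rightarrow> (real^'n) set" where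
  "chart_image c = snd c ` fst c"

definition chart_inv :: "('m, 'n::finite) chart \<Rightarrow> real^'n \<Rightarrow> 'm" where
  "chart_inv c = inv_into (fst c) (snd c)"

definition transition :: "('m, 'n::finite) chart \<Rightarrow> ('m, 'n) chart \<Rightarrow> real^'n \<Rightarrow> real^'n" where
  "transition c d = snd d \<circ> chart_inv c"

definition is_chart :: "'m topology \<Rightarrow> ('m, 'n::finite) chart \<Rightarrow> bool" where
  "is_chart X c \<longleftrightarrow> openin X (fst c) \<and> open (chart_image c) \<and>
     homeomorphic_map (subtopology X (fst c)) (top_of_set (chart_image c)) (snd c)"

text \<open>The smooth structure is the one generated by \<open>A\<close>, which need not be maximal.\<close>

definition smooth_atlas :: "'m topology \<Rightarrow> ('m, 'n::finite) chart set \<Rightarrow> bool" where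
  "smooth_atlas X A \<longleftrightarrow> (\<forall>c\<in>A. is_chart X c) \<and> (\<Union>c\<in>A. fst c) = topspace X \<and>
     (\<forall>c\<in>A. \<forall>d\<in>A. smooth_on (snd c ` (fst c \<inter> fst d)) (transition c d))"

text \<open>Second countability follows from compactness. Connectedness is not required.\<close>

definition closed_manifold :: "'m topology \<Rightarrow> ('m, 'n::finite) chart set \<Rightarrow> bool" where
  "closed_manifold X A \<longleftrightarrow> topspace X \<noteq> {} \<and> Hausdorff_space X \<and> compact_space X \<and>
     smooth_atlas X A"


section \<open>Riemannian metrics on a manifold\<close>

text \<open>A covariant 2-tensor field is given by its components: \<open>h c p $ i $ j\<close> is the value at \<open>p\<close>
  on the coordinate vectors \<open>\<partial>\<^sub>i, \<partial>\<^sub>j\<close> of the chart \<open>c\<close>. Components in different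
  charts are related by the tensor transformation law.\<close>

type_synonym ('m, 'n) tensor2 = "('m, 'n) chart \<Rightarrow> 'm \<Rightarrow> real^'n^'n"

definition is_tensor2 :: "('m, 'n::finite) chart set \<Rightarrow> ('m, 'n) tensor2 \<Rightarrow> bool" where
  "is_tensor2 A h \<longleftrightarrow> (\<forall>c\<in>A. \<forall>d\<in>A. \<forall>p\<in>fst c \<inter> fst d.
     let J = jacobian (transition c d) (at (snd c p))
     in h c p = transpose J ** h d p ** J)"

definition riemannian_metric :: "('m, 'n::finite) chart set \<Rightarrow> ('m, 'n) tensor2 \<Rightarrow> bool" where
  "riemannian_metric A h \<longleftrightarrow> is_tensor2 A h \<and>
     (\<forall>c\<in>A. smooth_on (chart_image c) (\<lambda>x. h c (chart_inv c x))) \<and>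
     (\<forall>c\<in>A. \<forall>p\<in>fst c. transpose (h c p) = h c p \<and> (\<forall>w. w \<noteq> 0 \<longrightarrow> w \<bullet> (h c p *v w) > 0))"

definition local_metric :: "('m, 'n::finite) chart \<Rightarrow> ('m, 'n) tensor2 \<Rightarrow> real^'n \<Rightarrow> real^'n^'n" where
  "local_metric c h x = h c (chart_inv c x)"

definition ricci :: "('m, 'n::finite) tensor2 \<Rightarrow> ('m, 'n) tensor2" where
  "ricci h c p = coord_ricci (local_metric c h) (snd c p)"

text \<open>The scalar quantities below do not depend on the chart in which they are computed, so they
  are evaluated at \<open>p\<close> in an arbitrary chart around \<open>p\<close>.\<close>

definition chart_at :: "('m, 'n::finite) chart set \<Rightarrow> 'm \<Rightarrow> ('m, 'n) chart" where
  "chart_at A p = (SOME c. c \<in> A \<and> p \<in> fst c)"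

definition scalar_curvature ::
  "('m, 'n::finite) chart set \<Rightarrow> ('m, 'n) tensor2 \<Rightarrow> 'm \<Rightarrow> real" where
  "scalar_curvature A h p =
     (let c = chart_at A p in coord_scalar (local_metric c h) (snd c p))"

definition laplacian ::
  "('m, 'n::finite) chart set \<Rightarrow> ('m, 'n) tensor2 \<Rightarrow> ('m \<Rightarrow> real) \<Rightarrow> 'm \<Rightarrow> real" where
  "laplacian A h u p =
     (let c = chart_at A p in coord_laplacian (local_metric c h) (u \<circ> chart_inv c) (snd c p))"

definition gradient_norm ::
  "('m, 'n::finite) chart set \<Rightarrow> ('m, 'n) tensor2 \<Rightarrow> ('m \<Rightarrow> real) \<Rightarrow> 'm \<Rightarrow> real" where
  "gradient_norm A h u p =
     (let c = chart_at A p
      in metric_norm (h c p) (coord_gradient (local_metric c h) (u \<circ> chart_inv c) (snd c p)))"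


section \<open>Ricci flow and the conjugate heat equation\<close>

definition ricci_flow ::
  "('m, 'n::finite) chart set \<Rightarrow> real \<Rightarrow> (real \<Rightarrow> ('m, 'n) tensor2) \<Rightarrow> bool" where
  "ricci_flow A T g \<longleftrightarrow> 0 < T \<and>
     (\<forall>t\<in>{0..T}. riemannian_metric A (g t)) \<and>
     (\<forall>c\<in>A. smooth_on (chart_image c \<times> {0..T}) (\<lambda>(x, t). g t c (chart_inv c x))) \<and>
     (\<forall>c\<in>A. \<forall>p\<in>fst c. \<forall>t\<in>{0..T}.
        ((\<lambda>s. g s c p) has_vector_derivative (- 2) *\<^sub>R ricci (g t) c p) (at t within {0..T}))"

text \<open>The solution is only required on \<open>{0..<T}\<close>, where \<open>\<tau> > 0\<close>; it may become singular at
  \<open>T\<close>, as the conjugate heat kernel does.\<close>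

definition positive_conjugate_heat_solution ::
  "'m topology \<Rightarrow> ('m, 'n::finite) chart set \<Rightarrow> real \<Rightarrow> (real \<Rightarrow> ('m, 'n) tensor2) \<Rightarrow>
   (real \<Rightarrow> 'm \<Rightarrow> real) \<Rightarrow> bool" where
  "positive_conjugate_heat_solution X A T g f \<longleftrightarrow>
     (\<forall>c\<in>A. smooth_on (chart_image c \<times> {0..<T}) (\<lambda>(x, t). f t (chart_inv c x))) \<and>
     (\<forall>p\<in>topspace X. \<forall>t\<in>{0..<T}. f t p > 0 \<and>
        ((\<lambda>s. f s p) has_real_derivative
           - laplacian A (g t) (f t) p + scalar_curvature A (g t) p * f t p)
          (at t within {0..<T}))"

end

theory Submission
  imports Defs
begin

text \<open>\<open>P = 2 \<Delta>v - |\<nabla>v|\<^sup>2 + R\<close> satisfies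
  \<open>\<partial>\<^sub>t P + \<Delta>P - 2 \<langle>\<nabla>v, \<nabla>P\<rangle> = 2 |Rc + \<nabla>\<^sup>2v|\<^sup>2\<close>, so \<open>\<partial>\<^sub>t P \<ge> 0\<close> at every spatial maximum of \<open>P\<close>. Hence
  the maximum has nonnegative lower right Dini derivative; being upper semicontinuous by
  compactness, it is nondecreasing.

  The evolution equation is a polynomial identity in the partial derivatives of \<open>v\<close>, of the metric
  and of its inverse. It is proved in an arbitrary commutative ring with commuting derivations and
  applied to the ring of jets at a point of space-time, so that no differentiability conditions
  intervene in the tensor calculus.

  The definition of \<open>P\<close> uses at each point an uncontrolled chart. The Ricci tensor is independent
  of the chart because it is, up to a factor, the time derivative of the metric in every chart.
  For the Laplacian one uses
  \<open>2 \<nabla>\<^sup>2u(\<nabla>a, \<nabla>b) = \<langle>\<nabla>a, \<nabla>\<langle>\<nabla>u, \<nabla>b\<rangle>\<rangle> + \<langle>\<nabla>b, \<nabla>\<langle>\<nabla>u, \<nabla>a\<rangle>\<rangle> - \<langle>\<nabla>u, \<nabla>\<langle>\<nabla>a, \<nabla>b\<rangle>\<rangle>\<close>,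
  where only pairings of gradients occur, whose invariance needs no more than the chain rule.\<close>

section \<open>Riemannian geometry over a commutative ring with commuting derivations\<close>

text \<open>The equation for \<open>P\<close> is a backward heat equation, like the one for
  \<open>f\<close>: the term -\<Delta>P is nonnegative at a spatial maximum, so the maximum moves up
  with t. The normalisation (n/2) log(4 pi \<tau>) is constant in space. It leaves \<open>P\<close>
  unchanged and adds n/(2\<tau>) to the time derivative of \<open>v\<close>, a term that every space
  derivative kills. The derivations are the partial derivatives of one chart, time included, so the
  flow enters the algebra only as the value of the time derivation on the metric components. Jets
  admit commuting derivations only if mixed partial derivatives agree at every point, including t =
  0, where time derivatives are one-sided; there the agreement is a limit from the interior. The
  point where the maximum is attained may jump, and the maximum need not be differentiable in time.
  Hence the comparison with the value at a frozen maximiser, with an arbitrarily small loss of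
  slope, instead of an equation for the maximum itself.\<close>

locale derivation =
  fixes \<delta> :: "'r::comm_ring_1 \<Rightarrow> 'r"
  assumes add: "\<delta> (a + b) = \<delta> a + \<delta> b"
    and mult: "\<delta> (a * b) = \<delta> a * b + a * \<delta> b"
begin

lemma zero [simp]: "\<delta> 0 = 0"
  using add[of 0 0] by simp

lemma minus: "\<delta> (- a) = - \<delta> a"
  using add[of a "- a"] by (simp add: eq_neg_iff_add_eq_0 add.commute)

lemma diff: "\<delta> (a - b) = \<delta> a - \<delta> b"
  using add[of a "- b"] by (simp add: minus)

lemma one [simp]: "\<delta> 1 = 0"
  using mult[of 1 1] by simp

lemma sum: "\<delta> (sum f A) = (\<Sum>x\<in>A. \<delta> (f x))"
  by (induction A rule: infinite_finite_induct) (auto simp: add)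

lemma numeral [simp]: "\<delta> (numeral n) = 0"
proof -
  have "\<delta> (of_nat k) = 0" for k by (induction k) (auto simp: add)
  from this[of "numeral n"] show ?thesis by simp
qed

end

section \<open>Finite sums and matrix products over a commutative ring\<close>

abbreviation total :: "('i::finite \<Rightarrow> 'r::comm_monoid_add) \<Rightarrow> 'r" (binder "\<Uplus>" 10)
  where "total f \<equiv> sum f UNIV"

lemma sum_delta_left: "(\<Uplus>k. (if i = k then 1 else 0) * f k) = (f i :: 'r::comm_ring_1)"
  by (simp add: if_distrib[of "\<lambda>x. x * _"] cong: if_cong)

lemma sum_delta_right: "(\<Uplus>k. f k * (if k = i then 1 else 0)) = (f i :: 'r::comm_ring_1)"
  by (simp add: if_distrib[of "\<lambda>x. _ * x"] cong: if_cong)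

lemma sum_swap3: "(\<Uplus>i j k. f i j k) = (\<Uplus>k j i. f i j k)"
  by (subst sum.swap, subst (2) sum.swap, subst sum.swap) simp

lemma sum_rot: "(\<Uplus>i j k. f i j k) = (\<Uplus>k i j. f i j k)"
  by (subst (2) sum.swap, subst sum.swap) simp

definition mm :: "('i::finite \<Rightarrow> 'i \<Rightarrow> 'r::comm_ring_1) \<Rightarrow> ('i \<Rightarrow> 'i \<Rightarrow> 'r) \<Rightarrow> 'i \<Rightarrow> 'i \<Rightarrow> 'r" where
  "mm A B a b = (\<Uplus>k. A a k * B k b)"

lemma mm_assoc: "mm (mm A B) C = mm A (mm B C)"
proof (intro ext)
  fix a b
  have "mm (mm A B) C a b = (\<Uplus>k l. A a l * B l k * C k b)"
    by (simp add: mm_def sum_distrib_right)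
  also have "\<dots> = (\<Uplus>l k. A a l * B l k * C k b)" by (rule sum.swap)
  also have "\<dots> = mm A (mm B C) a b"
    by (simp add: mm_def sum_distrib_left mult.assoc)
  finally show "mm (mm A B) C a b = mm A (mm B C) a b" .
qed

lemma mm_linear:
  "mm (\<lambda>a b. A a b + B a b) C = (\<lambda>a b. mm A C a b + mm B C a b)"
  "mm C (\<lambda>a b. A a b + B a b) = (\<lambda>a b. mm C A a b + mm C B a b)"
  "mm (\<lambda>a b. A a b - B a b) C = (\<lambda>a b. mm A C a b - mm B C a b)"
  "mm C (\<lambda>a b. A a b - B a b) = (\<lambda>a b. mm C A a b - mm C B a b)"
  "mm (\<lambda>a b. - A a b) C = (\<lambda>a b. - mm A C a b)"
  "mm C (\<lambda>a b. - A a b) = (\<lambda>a b. - mm C A a b)"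
  by (simp_all add: fun_eq_iff mm_def algebra_simps sum.distrib sum_subtractf sum_negf)

lemma (in derivation) mm:
  "\<delta> (mm A B a b) = mm (\<lambda>a b. \<delta> (A a b)) B a b + mm A (\<lambda>a b. \<delta> (B a b)) a b"
  by (simp add: mm_def sum mult sum.distrib)

text \<open>Differentiate g h = 1 and multiply by \<open>h\<close> from the left. The lemma serves
  both the space derivations (\<open>d_h\<close>) and the time derivation
  (\<open>dt_h\<close>).\<close>

lemma deriv_inverse:
  fixes g h :: "'n::finite \<Rightarrow> 'n \<Rightarrow> 'r::comm_ring_1"
  assumes "derivation \<delta>"
    and gh: "\<And>i j. (\<Uplus>k. g i k * h k j) = (if i = j then 1 else 0)"
    and hg: "\<And>i j. (\<Uplus>k. h i k * g k j) = (if i = j then 1 else 0)"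
  shows "\<delta> (h a b) = - mm h (mm (\<lambda>a b. \<delta> (g a b)) h) a b"
proof -
  interpret derivation \<delta> by fact
  have *: "mm (\<lambda>a b. \<delta> (g a b)) h c b + mm g (\<lambda>a b. \<delta> (h a b)) c b = 0" for c
  proof -
    have "\<delta> (mm g h c b) = 0" by (simp add: mm_def gh)
    then show ?thesis by (simp only: mm)
  qed
  have "mm h (mm g (\<lambda>a b. \<delta> (h a b))) a b = \<delta> (h a b)"
    by (simp only: mm_assoc[symmetric]) (simp add: mm_def hg sum_delta_left)
  moreover have "mm h (mm (\<lambda>a b. \<delta> (g a b)) h) a b + mm h (mm g (\<lambda>a b. \<delta> (h a b))) a b = 0"
    using * by (simp add: mm_def[of h] flip: sum.distrib distrib_left)
  ultimately show ?thesis by (simp add: eq_neg_iff_add_eq_0 add.commute)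
qed

text \<open>The inverse metric \<open>h\<close> is separate data tied to \<open>g\<close> by
  \<open>gh\<close>, because the entries of an inverse are not polynomials in those of
  \<open>g\<close>. The element \<open>hf\<close> is the factor 1/2 of the Christoffel symbols; it
  also allows division by 2.\<close>

locale metric_ring =
  fixes d :: "'n::finite \<Rightarrow> 'r::comm_ring_1 \<Rightarrow> 'r"
    and hf :: 'r
    and g h :: "'n \<Rightarrow> 'n \<Rightarrow> 'r"
  assumes der: "derivation (d i)"
    and d_comm: "d i (d j a) = d j (d i a)"
    and hf: "2 * hf = 1"
    and g_sym: "g i j = g j i"
    and h_sym: "h i j = h j i"
    and gh: "(\<Uplus>k. g i k * h k j) = (if i = j then 1 else 0)"
begin

sublocale d: derivation "d i" for i by (rule der)

lemma hf_twice: "hf * (2 * a) = a" "hf * (a * 2) = a" "2 * (hf * a) = a" "hf * a + hf * a = a"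
proof -
  show *: "hf * (2 * a) = a" for a
    by (metis hf mult.assoc mult.commute mult_1)
  show "hf * (a * 2) = a" "2 * (hf * a) = a"
    using *[of a] by (simp_all only: mult.commute[of a 2] mult.left_commute[of 2 hf])
  then show "hf * a + hf * a = a" by (simp flip: mult_2)
qed

lemma eq_hf_iff: "a = hf * b \<longleftrightarrow> 2 * a = b"
  by (metis hf_twice(1,3))

lemma twice_cancel: "2 * a = 2 * b \<longleftrightarrow> a = (b :: 'r)"
  by (metis hf_twice(1))

lemma d_hf [simp]: "d i hf = 0"
proof -
  have "2 * d i hf = 0" using hf d.mult[of i 2 hf] by simp
  then show ?thesis using twice_cancel[of "d i hf" 0] by simp
qed

text \<open>Both matrices are symmetric, so this is the transpose of \<open>gh\<close>.\<close>

lemma hg: "(\<Uplus>k. h i k * g k j) = (if i = j then 1 else 0)"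
proof -
  have "(\<Uplus>k. h i k * g k j) = (\<Uplus>k. g j k * h k i)"
    by (intro sum.cong refl) (metis g_sym h_sym mult.commute)
  then show ?thesis by (simp add: gh)
qed

lemma lower_raise: "(\<Uplus>k. g a k * (\<Uplus>l. h k l * X l)) = X a"
proof -
  have "(\<Uplus>k. g a k * (\<Uplus>l. h k l * X l)) = (\<Uplus>k l. g a k * h k l * X l)"
    by (simp add: sum_distrib_left mult.assoc)
  also have "\<dots> = (\<Uplus>l. (\<Uplus>k. g a k * h k l) * X l)"
    by (subst sum.swap) (simp add: sum_distrib_right)
  finally show ?thesis by (simp add: gh sum_delta_left)
qed

lemma raise_lower: "(\<Uplus>k. h a k * (\<Uplus>l. g k l * X l)) = X a"
proof -
  have "(\<Uplus>k. h a k * (\<Uplus>l. g k l * X l)) = (\<Uplus>k l. h a k * g k l * X l)"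
    by (simp add: sum_distrib_left mult.assoc)
  also have "\<dots> = (\<Uplus>l. (\<Uplus>k. h a k * g k l) * X l)"
    by (subst sum.swap) (simp add: sum_distrib_right)
  finally show ?thesis by (simp add: hg sum_delta_left)
qed

definition chris :: "'n \<Rightarrow> 'n \<Rightarrow> 'n \<Rightarrow> 'r" where
  "chris k i j = hf * (\<Uplus>l. h k l * (d i (g j l) + d j (g i l) - d l (g i j)))"

lemma chris_sym: "chris k i j = chris k j i"
  by (simp add: chris_def algebra_simps g_sym[of i j])

lemma lower_chris:
  "(\<Uplus>k. g a k * chris k i j) = hf * (d i (g j a) + d j (g i a) - d a (g i j))"
proof -
  have "(\<Uplus>k. g a k * chris k i j)
      = hf * (\<Uplus>k. g a k * (\<Uplus>l. h k l * (d i (g j l) + d j (g i l) - d l (g i j))))"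
    unfolding chris_def by (simp add: mult.left_commute[of _ hf] flip: sum_distrib_left)
  then show ?thesis by (simp only: lower_raise)
qed

text \<open>Compatibility of the connection with the metric, \<nabla>g = 0. In the sum of the two
  lowered Christoffel symbols only the derivative in direction \<open>i\<close> survives,
  twice.\<close>

lemma d_g: "d i (g a b) = (\<Uplus>k. g a k * chris k i b) + (\<Uplus>k. g b k * chris k i a)"
proof -
  have "2 * d i (g a b) = d i (g b a) + d b (g i a) - d a (g i b) + (d i (g a b) + d a (g i b) - d b (g i a))"
    by (simp add: g_sym[of b a])
  then show ?thesis
    unfolding lower_chris distrib_left[of hf, symmetric] eq_hf_iff by simp
qed

text \<open>\<open>conn i\<close>, \<open>Riem i j\<close> are the connection and curvature forms as matrices; in this form the second
  Bianchi identity is the Jacobi identity for the operators \<open>\<partial>\<^sub>i + conn i\<close>. \<open>U i j\<close> is \<open>Riem i j\<close> with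
  the second matrix index raised.\<close>

definition conn :: "'n \<Rightarrow> 'n \<Rightarrow> 'n \<Rightarrow> 'r" where
  "conn i a b = chris a i b"

text \<open>The inverse metric is parallel as well: insert \<open>d_g\<close> into the derivative of
  an inverse; each of its two terms absorbs one product of \<open>h\<close> and
  \<open>g\<close>.\<close>

lemma d_h: "d i (h a b) = - mm (conn i) h a b - mm (conn i) h b a"
proof -
  have e1: "d i (g a b) = mm g (conn i) a b + mm g (conn i) b a" for a b
    by (simp add: d_g mm_def conn_def)
  have e2: "mm h (mm (\<lambda>a b. mm g (conn i) a b) h) a b = mm (conn i) h a b" for a b
  proof -
    have "mm (mm h g) (conn i) = conn i"
      by (intro ext) (simp add: mm_def hg sum_delta_left)
    then show ?thesis by (simp only: mm_assoc[symmetric])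
  qed
  have e3: "mm h (mm (\<lambda>a b. mm g (conn i) b a) h) a b = mm h (mm (mm g (conn i)) h) b a" for a b
  proof -
    have "mm h (mm (\<lambda>a b. mm g (conn i) b a) h) a b
        = (\<Uplus>k l. h a k * (mm g (conn i) l k * h l b))"
      by (simp add: mm_def[of h] mm_def[of _ h] sum_distrib_left)
    also have "\<dots> = (\<Uplus>l k. h a k * (mm g (conn i) l k * h l b))" by (rule sum.swap)
    also have "\<dots> = (\<Uplus>l k. h b l * (mm g (conn i) l k * h k a))"
      by (intro sum.cong refl) (simp add: h_sym mult_ac)
    also have "\<dots> = mm h (mm (mm g (conn i)) h) b a"
      by (simp add: mm_def[of h] mm_def[of _ h] sum_distrib_left)
    finally show ?thesis .
  qed
  show ?thesis
    using deriv_inverse[OF der gh hg, of i a b] e2[of a b] e2[of b a] e3[of a b]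
    by (simp add: e1 mm_linear)
qed

definition Riem :: "'n \<Rightarrow> 'n \<Rightarrow> 'n \<Rightarrow> 'n \<Rightarrow> 'r" where
  "Riem i j a b = d i (conn j a b) - d j (conn i a b) + mm (conn i) (conn j) a b - mm (conn j) (conn i) a b"

lemma Riem_antisym: "Riem i j a b = - Riem j i a b"
  by (simp add: Riem_def)

definition U :: "'n \<Rightarrow> 'n \<Rightarrow> 'n \<Rightarrow> 'n \<Rightarrow> 'r" where
  "U i j a b = mm (Riem i j) h a b"

lemma U_antisym1: "U i j a b = - U j i a b"
  by (simp add: U_def mm_def Riem_antisym[of i j] sum_negf)

text \<open>Since \<open>h\<close> is parallel, the commutator of two covariant derivatives
  annihilates it. Concretely, \<open>d_comm\<close> is applied to \<open>h a b\<close> and both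
  sides are expanded by \<open>d_h\<close>.\<close>

lemma U_antisym2: "U i j a b = - U i j b a"
proof -
  have q: "mm (conn i) (\<lambda>a b. mm (conn j) h b a) a b = mm (conn j) (\<lambda>a b. mm (conn i) h b a) b a" for i j a b
  proof -
    have "mm (conn i) (\<lambda>a b. mm (conn j) h b a) a b = (\<Uplus>k l. conn i a k * (conn j b l * h l k))"
      by (simp add: mm_def sum_distrib_left)
    also have "\<dots> = (\<Uplus>l k. conn i a k * (conn j b l * h l k))" by (rule sum.swap)
    also have "\<dots> = mm (conn j) (\<lambda>a b. mm (conn i) h b a) b a"
      by (simp add: mm_def sum_distrib_left h_sym mult_ac)
    finally show ?thesis .
  qed
  have "d j (d i (h a b)) = d i (d j (h a b))" by (rule d_comm)
  then show ?thesis
    unfolding U_def Riem_def[abs_def] d_h d.diff d.minus d.mm mm_linear mm_assoc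
    using q[of i j a b] q[of i j b a]
    by (simp add: algebra_simps)
qed

lemma Bianchi_matrix:
  fixes T
  defines "T \<equiv> \<lambda>m i j a b. d m (Riem i j a b) + mm (conn m) (Riem i j) a b - mm (Riem i j) (conn m) a b"
  shows "T m i j a b + T i j m a b + T j m i a b = 0"
  unfolding T_def Riem_def[abs_def] d.diff d.add d.mm mm_linear mm_assoc
  by (simp add: algebra_simps d_comm[of i j] d_comm[of i m] d_comm[of j m])

end

section \<open>Contracted second Bianchi identity\<close>

context metric_ring begin

text \<open>Exchanging the indices shows that the sum equals its negative; division by 2 then makes
  it vanish.\<close>

lemma sum_sym_antisym:
  assumes "\<And>i j. s i j = s j i" "\<And>i j. u i j = - u j i"
  shows "(\<Uplus>i j. s i j * u i j) = (0::'r)"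
proof -
  have "(\<Uplus>i j. s i j * u i j) = (\<Uplus>j i. s i j * u i j)" by (rule sum.swap)
  also have "\<dots> = (\<Uplus>j i. - (s j i * u j i))"
    by (intro sum.cong refl) (metis assms mult_minus_right)
  also have "\<dots> = - (\<Uplus>i j. s i j * u i j)" by (simp add: sum_negf)
  finally have "2 * (\<Uplus>i j. s i j * u i j) = 2 * 0"
    unfolding eq_neg_iff_add_eq_0 mult_2 by simp
  then show ?thesis by (simp only: twice_cancel)
qed

definition Rc :: "'n \<Rightarrow> 'n \<Rightarrow> 'r" where
  "Rc j k = (\<Uplus>i. Riem i j i k)"

definition tr :: "('n \<Rightarrow> 'n \<Rightarrow> 'r) \<Rightarrow> 'r" where
  "tr X = (\<Uplus>i j. h i j * X i j)"

text \<open>The Ricci tensor with its second index raised, so that \<open>rho j\<close> can be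
  treated as a vector field. Symmetry of \<open>Rc\<close> is established only in
  \<open>flow_ring\<close>, so the order of the indices matters here.\<close>

definition rho :: "'n \<Rightarrow> 'n \<Rightarrow> 'r" where
  "rho j b = (\<Uplus>k. h b k * Rc j k)"

definition dvg :: "('n \<Rightarrow> 'r) \<Rightarrow> 'r" where
  "dvg X = (\<Uplus>i. d i (X i)) + (\<Uplus>i p. conn i i p * X p)"

text \<open>The contracted Christoffel symbol; in coordinates \<open>Lam k\<close> is minus the
  Laplacian of the coordinate function number k. With it \<open>codiv\<close> is the covariant
  divergence of a covector field, as \<open>dvg\<close> is that of a vector field.\<close>

definition Lam :: "'n \<Rightarrow> 'r" where
  "Lam k = (\<Uplus>i j. h i j * chris k i j)"

definition codiv :: "('n \<Rightarrow> 'r) \<Rightarrow> 'r" where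
  "codiv X = (\<Uplus>i k. h i k * d i (X k)) - (\<Uplus>k. Lam k * X k)"

text \<open>The antisymmetries in each of the two index pairs reduce every contraction across the
  pairs to the one that defines \<open>Rc\<close>, up to sign.\<close>

lemma U_contract:
  "(\<Uplus>i. U i j i b) = rho j b"
  "(\<Uplus>i. U j i b i) = rho j b"
  "(\<Uplus>i. U i j b i) = - rho j b"
  "(\<Uplus>i. U j i i b) = - rho j b"
proof -
  have "(\<Uplus>i. U i j i b) = (\<Uplus>k i. Riem i j i k * h k b)"
    unfolding U_def mm_def by (rule sum.swap)
  also have "\<dots> = rho j b"
    by (simp add: rho_def Rc_def mult.commute h_sym[of b] sum_distrib_left)
  finally show *: "(\<Uplus>i. U i j i b) = rho j b" .
  have "(\<Uplus>i. U j i b i) = (\<Uplus>i. U i j i b)"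
    by (intro sum.cong refl) (metis U_antisym1 U_antisym2 minus_minus)
  with * show "(\<Uplus>i. U j i b i) = rho j b" by simp
  have "(\<Uplus>i. U i j b i) = (\<Uplus>i. - U i j i b)" by (intro sum.cong refl) (rule U_antisym2)
  with * show "(\<Uplus>i. U i j b i) = - rho j b" by (simp add: sum_negf)
  have "(\<Uplus>i. U j i i b) = (\<Uplus>i. - U i j i b)" by (intro sum.cong refl) (rule U_antisym1)
  with * show "(\<Uplus>i. U j i i b) = - rho j b" by (simp add: sum_negf)
qed

lemma tr_Rc: "tr Rc = (\<Uplus>i j. U i j i j)"
proof -
  have "tr Rc = (\<Uplus>j. rho j j)"
    by (simp add: tr_def rho_def)
  also have "\<dots> = (\<Uplus>j i. U i j i j)" by (simp add: U_contract)
  also have "\<dots> = (\<Uplus>i j. U i j i j)" by (rule sum.swap)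
  finally show ?thesis .
qed

text \<open>The connection acts on the indices \<open>a\<close> and \<open>b\<close> only. Its terms
  for \<open>i\<close> and \<open>j\<close> would cancel in the cyclic sum by symmetry of the
  Christoffel symbols; this is a covariant exterior derivative.\<close>

definition DU :: "'n \<Rightarrow> 'n \<Rightarrow> 'n \<Rightarrow> 'n \<Rightarrow> 'n \<Rightarrow> 'r" where
  "DU m i j a b = d m (U i j a b) + (\<Uplus>p. conn m a p * U i j p b) + (\<Uplus>p. conn m b p * U i j a p)"

text \<open>Raising an index commutes with covariant differentiation because \<open>h\<close> is
  parallel, so each \<open>DU\<close> is the expression of \<open>Bianchi_matrix\<close> multiplied
  by \<open>h\<close>.\<close>

lemma Bianchi_U: "DU m i j a b + DU i j m a b + DU j m i a b = 0"
proof -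
  let ?T = "\<lambda>m i j a b. d m (Riem i j a b) + mm (conn m) (Riem i j) a b - mm (Riem i j) (conn m) a b"
  have *: "DU m i j a b = mm (?T m i j) h a b" for m i j
  proof -
    have "mm (Riem i j) (\<lambda>a b. mm (conn m) h b a) a b = (\<Uplus>k p. Riem i j a k * (conn m b p * h p k))"
      by (simp add: mm_def sum_distrib_left)
    also have "\<dots> = (\<Uplus>p k. Riem i j a k * (conn m b p * h p k))" by (rule sum.swap)
    also have "\<dots> = (\<Uplus>p. conn m b p * U i j a p)"
      by (simp add: mm_def U_def sum_distrib_left h_sym mult_ac)
    finally have 1: "mm (Riem i j) (\<lambda>a b. mm (conn m) h b a) a b = (\<Uplus>p. conn m b p * U i j a p)" .
    have 2: "(\<Uplus>p. conn m a p * U i j p b) = mm (conn m) (mm (Riem i j) h) a b"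
      by (simp add: mm_def U_def)
    show ?thesis
      unfolding DU_def 2 1[symmetric] unfolding U_def d.mm d_h mm_linear mm_assoc by (simp add: algebra_simps)
  qed
  show ?thesis
    unfolding * mm_def[of _ h] sum.distrib[symmetric] distrib_right[symmetric] Bianchi_matrix by simp
qed

text \<open>Trace \<open>Bianchi_U\<close> over i = a and j = b. The first summand yields the
  derivative of the scalar curvature and twice the connection term; the other two yield minus the
  divergence of \<open>rho m\<close> each.\<close>

lemma contracted_Bianchi: "2 * (dvg (rho m) - (\<Uplus>a p. conn m a p * rho a p)) = d m (tr Rc)"
proof -
  let ?Q = "\<Uplus>a p. conn m a p * rho a p"
  have "(\<Uplus>i j p. conn m i p * U i j p j) = (\<Uplus>i p j. conn m i p * U i j p j)"
    by (intro sum.cong refl sum.swap)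
  also have "\<dots> = ?Q"
    by (simp add: U_contract flip: sum_distrib_left)
  finally have 1: "(\<Uplus>i j p. conn m i p * U i j p j) = ?Q" .
  have "(\<Uplus>i j p. conn m j p * U i j i p) = (\<Uplus>j p i. conn m j p * U i j i p)"
    by (subst sum.swap) (intro sum.cong refl sum.swap)
  also have "\<dots> = ?Q"
    by (simp add: U_contract flip: sum_distrib_left)
  finally have 2: "(\<Uplus>i j p. conn m j p * U i j i p) = ?Q" .
  have A: "(\<Uplus>i j. DU m i j i j) = d m (tr Rc) + ?Q + ?Q"
    by (simp add: DU_def sum.distrib 1 2 tr_Rc d.sum)
  have "(\<Uplus>i j p. conn i i p * U j m p j) = (\<Uplus>i p j. conn i i p * U j m p j)"
    by (intro sum.cong refl sum.swap)
  also have "\<dots> = - (\<Uplus>i p. conn i i p * rho m p)"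
    by (simp add: U_contract sum_negf flip: sum_distrib_left)
  finally have 3: "(\<Uplus>i j p. conn i i p * U j m p j) = - (\<Uplus>i p. conn i i p * rho m p)" .
  \<comment> \<open>The lower indices \<open>i\<close>, \<open>p\<close> of a Christoffel symbol
    meet the antisymmetric pair of \<open>U\<close>.\<close>
  have "(\<Uplus>i j p. conn i j p * U j m i p) = (\<Uplus>j i p. conn i j p * U j m i p)"
    by (rule sum.swap)
  also have "\<dots> = 0"
    by (rule sum.neutral, rule ballI, rule sum_sym_antisym[OF _ U_antisym2])
       (simp add: conn_def chris_sym)
  finally have 4: "(\<Uplus>i j p. conn i j p * U j m i p) = 0" .
  have B: "(\<Uplus>i j. DU i j m i j) = - dvg (rho m)"
    by (simp add: DU_def sum.distrib 3 4 dvg_def U_contract sum_negf sum_subtractf d.minus flip: d.sum)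
  have "(\<Uplus>i j p. conn j j p * U m i i p) = (\<Uplus>j p i. conn j j p * U m i i p)"
    by (subst sum.swap) (intro sum.cong refl sum.swap)
  also have "\<dots> = - (\<Uplus>i p. conn i i p * rho m p)"
    by (simp add: U_contract sum_negf flip: sum_distrib_left)
  finally have 5: "(\<Uplus>i j p. conn j j p * U m i i p) = - (\<Uplus>i p. conn i i p * rho m p)" .
  have 6: "(\<Uplus>i j p. conn j i p * U m i p j) = 0"
  proof (rule sum.neutral, rule ballI)
    fix i
    have "(\<Uplus>j p. conn j i p * U m i p j) = (\<Uplus>j p. conn p i j * U m i p j)"
      by (simp add: conn_def chris_sym)
    also have "\<dots> = (\<Uplus>p j. conn p i j * U m i p j)" by (rule sum.swap)
    also have "\<dots> = 0"
      by (rule sum_sym_antisym[OF _ U_antisym2]) (simp add: conn_def chris_sym)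
    finally show "(\<Uplus>j p. conn j i p * U m i p j) = 0" .
  qed
  have "(\<Uplus>i j. d j (U m i i j)) = (\<Uplus>j i. d j (U m i i j))" by (rule sum.swap)
  then have 7: "(\<Uplus>i j. d j (U m i i j)) = - (\<Uplus>j. d j (rho m j))"
    by (simp add: U_contract sum_negf d.minus flip: d.sum)
  have C: "(\<Uplus>i j. DU j m i i j) = - dvg (rho m)"
    by (simp add: DU_def sum.distrib 5 6 7 dvg_def)
  have "(\<Uplus>i j. DU m i j i j) + (\<Uplus>i j. DU i j m i j) + (\<Uplus>i j. DU j m i i j) = 0"
    by (simp add: Bianchi_U flip: sum.distrib)
  then show ?thesis
    unfolding A B C by (simp add: algebra_simps)
qed

text \<open>Of the two terms that \<open>d_h\<close> produces, one cancels the Christoffel term of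
  \<open>dvg\<close> and the other is the \<open>Lam\<close> term of \<open>codiv\<close>.\<close>

lemma dvg_raise: "dvg (\<lambda>i. \<Uplus>k. h i k * X k) = codiv X"
proof -
  have 1: "(\<Uplus>i k. mm (conn i) h k i * X k) = (\<Uplus>k. Lam k * X k)"
  proof -
    have "(\<Uplus>i k. mm (conn i) h k i * X k) = (\<Uplus>k i. mm (conn i) h k i * X k)"
      by (rule sum.swap)
    also have "\<dots> = (\<Uplus>k. Lam k * X k)"
      by (simp add: Lam_def mm_def conn_def h_sym mult.commute sum_distrib_left)
    finally show ?thesis .
  qed
  have 2: "(\<Uplus>i k. mm (conn i) h i k * X k) = (\<Uplus>i p. conn i i p * (\<Uplus>k. h p k * X k))"
    by (rule sum.cong[OF refl])
       (simp add: mm_def sum_distrib_left sum_distrib_right mult.assoc, subst sum.swap, simp)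
  have "dvg (\<lambda>i. \<Uplus>k. h i k * X k)
      = (\<Uplus>i k. h i k * d i (X k)) - (\<Uplus>i k. mm (conn i) h i k * X k)
        - (\<Uplus>i k. mm (conn i) h k i * X k) + (\<Uplus>i p. conn i i p * (\<Uplus>k. h p k * X k))"
    by (simp add: dvg_def d.sum d.mult d_h algebra_simps sum.distrib sum_subtractf sum_negf)
  then show ?thesis unfolding 1 2 codiv_def by simp
qed

section \<open>Hessian, Laplacian and the Bochner formula\<close>

definition Hess :: "'r \<Rightarrow> 'n \<Rightarrow> 'n \<Rightarrow> 'r" where
  "Hess v i j = d i (d j v) - (\<Uplus>k. chris k i j * d k v)"

lemma Hess_sym: "Hess v i j = Hess v j i"
  by (simp add: Hess_def chris_sym d_comm)

definition lap :: "'r \<Rightarrow> 'r" where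
  "lap v = tr (Hess v)"

lemma lap_codiv: "lap v = codiv (\<lambda>k. d k v)"
proof -
  have "(\<Uplus>i j. h i j * (\<Uplus>k. chris k i j * d k v)) = (\<Uplus>i j k. h i j * chris k i j * d k v)"
    by (simp add: sum_distrib_left mult.assoc)
  also have "\<dots> = (\<Uplus>k. Lam k * d k v)"
    by (subst sum_rot) (simp add: Lam_def sum_distrib_right)
  finally show ?thesis
    by (simp add: lap_def tr_def Hess_def codiv_def algebra_simps sum_subtractf)
qed

definition grad :: "'r \<Rightarrow> 'n \<Rightarrow> 'r" where
  "grad v i = (\<Uplus>j. h i j * d j v)"

definition sq :: "'r \<Rightarrow> 'r" where
  "sq v = (\<Uplus>i. grad v i * d i v)"

text \<open>Only the index of the vector field is differentiated covariantly, so that \<open>nb i\<close> and \<open>nb j\<close>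
  commute up to curvature.\<close>

definition nb :: "'n \<Rightarrow> ('n \<Rightarrow> 'r) \<Rightarrow> 'n \<Rightarrow> 'r" where
  "nb i X k = d i (X k) + (\<Uplus>m. conn i k m * X m)"

lemma dvg_grad: "dvg (grad v) = lap v"
  unfolding grad_def[abs_def] dvg_raise lap_codiv ..

lemma nb_commute: "nb l (nb i X) a - nb i (nb l X) a = (\<Uplus>m. Riem l i a m * X m)"
proof -
  have q: "(\<Uplus>m. mm (conn l) (conn i) a m * X m) = (\<Uplus>p. conn l a p * (\<Uplus>m. conn i p m * X m))" for l i
    by (simp add: mm_def sum_distrib_left sum_distrib_right mult.assoc, subst sum.swap, simp)
  show ?thesis
    by (simp add: nb_def Riem_def d.add d.sum d.mult algebra_simps sum.distrib sum_subtractf d_comm[of l i])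
       (use q[of l i] q[of i l] in \<open>simp add: algebra_simps\<close>)
qed

text \<open>The vector field form of the Bochner formula, div(\<nabla>_X X) =
  tr((\<nabla>X)(\<nabla>X)) + X(div X) + Rc(X,X). Exchanging the two derivatives on the second
  factor creates the curvature, whose contraction is \<open>Rc\<close>.\<close>

lemma dvg_nb:
  "dvg (\<lambda>l. \<Uplus>i. X i * nb i X l)
    = (\<Uplus>i l. nb i X l * nb l X i) + (\<Uplus>i. X i * d i (dvg X)) + (\<Uplus>i m. X i * Rc i m * X m)"
proof -
  have 1: "dvg (\<lambda>l. \<Uplus>i. X i * nb i X l) = (\<Uplus>l i. d l (X i) * nb i X l) + (\<Uplus>i. X i * (\<Uplus>l. nb l (nb i X) l))"
  proof -
    have "(\<Uplus>l i. X i * d l (nb i X l)) = (\<Uplus>i. X i * (\<Uplus>l. d l (nb i X l)))"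
      by (subst sum.swap) (simp add: sum_distrib_left)
    moreover have "(\<Uplus>l p. conn l l p * (\<Uplus>i. X i * nb i X p)) = (\<Uplus>i. X i * (\<Uplus>l p. conn l l p * nb i X p))"
    proof -
      have "(\<Uplus>l p. conn l l p * (\<Uplus>i. X i * nb i X p)) = (\<Uplus>l p i. X i * (conn l l p * nb i X p))"
        by (simp add: sum_distrib_left mult.left_commute)
      also have "\<dots> = (\<Uplus>i l p. X i * (conn l l p * nb i X p))" by (rule sum_rot)
      finally show ?thesis by (simp add: sum_distrib_left)
    qed
    moreover have "(\<Uplus>l. nb l (nb i X) l) = (\<Uplus>l. d l (nb i X l)) + (\<Uplus>l p. conn l l p * nb i X p)" for i
      by (simp add: nb_def[of _ "nb i X" _] sum.distrib)
    ultimately show ?thesis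
      by (simp add: dvg_def d.sum d.mult sum.distrib distrib_left)
  qed
  have 2: "(\<Uplus>l. nb l (nb i X) l) = d i (dvg X) + (\<Uplus>l m. conn i l m * nb l X m) + (\<Uplus>m. Rc i m * X m)" for i
  proof -
    have "(\<Uplus>l. nb l (nb i X) l) = (\<Uplus>l. nb i (nb l X) l + (\<Uplus>m. Riem l i l m * X m))"
      by (intro sum.cong refl) (simp flip: nb_commute)
    also have "\<dots> = (\<Uplus>l. nb i (nb l X) l) + (\<Uplus>m. Rc i m * X m)"
    proof -
      have "(\<Uplus>l m. Riem l i l m * X m) = (\<Uplus>m. Rc i m * X m)"
        by (subst sum.swap) (simp add: Rc_def sum_distrib_right)
      then show ?thesis by (simp add: sum.distrib)
    qed
    also have "(\<Uplus>l. nb i (nb l X) l) = d i (\<Uplus>l. nb l X l) + (\<Uplus>l m. conn i l m * nb l X m)"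
      by (simp add: nb_def[of i "nb _ X" _] sum.distrib d.sum)
    also have "(\<Uplus>l. nb l X l) = dvg X"
      by (simp add: nb_def dvg_def sum.distrib)
    finally show ?thesis .
  qed
  \<comment> \<open>The connection term left over by the exchange in \<open>2\<close> is what
    completes \<open>d l (X i)\<close> to \<open>nb l X i\<close>, by symmetry of the lower
    Christoffel indices.\<close>
  have 3: "(\<Uplus>i. X i * (\<Uplus>l m. conn i l m * nb l X m)) = (\<Uplus>l i. (\<Uplus>p. conn l i p * X p) * nb i X l)"
  proof -
    have "(\<Uplus>i. X i * (\<Uplus>l m. conn i l m * nb l X m)) = (\<Uplus>i l m. conn m l i * X i * nb l X m)"
      by (simp add: sum_distrib_left mult_ac conn_def chris_sym)
    also have "\<dots> = (\<Uplus>m l i. conn m l i * X i * nb l X m)" by (rule sum_swap3)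
    finally show ?thesis by (simp add: sum_distrib_right)
  qed
  have 4: "(\<Uplus>i l. nb i X l * nb l X i)
     = (\<Uplus>l i. d l (X i) * nb i X l) + (\<Uplus>l i. (\<Uplus>p. conn l i p * X p) * nb i X l)"
    by (subst sum.swap) (simp add: nb_def[of _ X] algebra_simps sum.distrib)
  show ?thesis
    unfolding 1 2 4 by (simp add: distrib_left sum.distrib 3) (simp add: sum_distrib_left mult.assoc)
qed

text \<open>Because \<open>h\<close> is parallel, the covariant derivative of a gradient is the
  Hessian with one index raised.\<close>

lemma nb_grad: "nb i (grad v) l = (\<Uplus>k. h l k * Hess v i k)"
proof -
  have 1: "(\<Uplus>k. mm (conn i) h l k * d k v) = (\<Uplus>m. conn i l m * grad v m)"
    by (simp add: mm_def grad_def sum_distrib_left sum_distrib_right mult.assoc, subst sum.swap, simp)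
  have "(\<Uplus>k. mm (conn i) h k l * d k v) = (\<Uplus>k m. h l m * (chris k i m * d k v))"
    by (simp add: mm_def sum_distrib_left sum_distrib_right conn_def h_sym mult_ac)
  also have "\<dots> = (\<Uplus>m. h l m * (\<Uplus>k. chris k i m * d k v))"
    by (subst sum.swap) (simp add: sum_distrib_left)
  finally have 2: "(\<Uplus>k. mm (conn i) h k l * d k v) = (\<Uplus>m. h l m * (\<Uplus>k. chris k i m * d k v))" .
  have "d i (grad v l) = (\<Uplus>k. h l k * d i (d k v)) - (\<Uplus>k. mm (conn i) h l k * d k v) - (\<Uplus>k. mm (conn i) h k l * d k v)"
    by (simp add: grad_def d.sum d.mult d_h algebra_simps sum.distrib sum_subtractf sum_negf)
  then show ?thesis
    unfolding 1 2 by (simp add: nb_def Hess_def algebra_simps sum_subtractf)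
qed

definition gip :: "'r \<Rightarrow> 'r \<Rightarrow> 'r" where
  "gip u v = (\<Uplus>i. grad u i * d i v)"

lemma d_gip: "d k (gip u v) = (\<Uplus>i. grad v i * Hess u i k) + (\<Uplus>i. grad u i * Hess v i k)"
proof -
  have 1: "d k (grad u i) = (\<Uplus>j. h i j * Hess u k j) - (\<Uplus>m. conn k i m * grad u m)" for i
    using nb_grad[of k u i] by (simp add: nb_def algebra_simps)
  have 2: "(\<Uplus>i. (\<Uplus>j. h i j * Hess u k j) * d i v) = (\<Uplus>i. grad v i * Hess u i k)"
  proof -
    have "(\<Uplus>i. (\<Uplus>j. h i j * Hess u k j) * d i v) = (\<Uplus>i j. h i j * Hess u k j * d i v)"
      by (simp add: sum_distrib_right)
    also have "\<dots> = (\<Uplus>j i. h i j * Hess u k j * d i v)" by (rule sum.swap)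
    also have "\<dots> = (\<Uplus>i. grad v i * Hess u i k)"
      by (simp add: grad_def sum_distrib_left sum_distrib_right h_sym Hess_sym mult_ac)
    finally show ?thesis .
  qed
  have 3: "(\<Uplus>i. (\<Uplus>m. conn k i m * grad u m) * d i v) = (\<Uplus>m. grad u m * (\<Uplus>i. chris i k m * d i v))"
    by (simp add: sum_distrib_left sum_distrib_right conn_def mult_ac, subst sum.swap, simp)
  have 4: "(\<Uplus>i. grad u i * d k (d i v)) = (\<Uplus>i. grad u i * Hess v i k) + (\<Uplus>m. grad u m * (\<Uplus>i. chris i k m * d i v))"
    by (simp add: Hess_def algebra_simps sum_subtractf chris_sym d_comm flip: sum.distrib)
  show ?thesis
    unfolding gip_def d.sum d.mult sum.distrib 4
    by (simp add: 1 left_diff_distrib sum_subtractf 2 3)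
qed

lemma sq_gip: "sq v = gip v v"
  by (simp add: sq_def gip_def)

lemma d_sq: "d k (sq v) = 2 * (\<Uplus>i. grad v i * Hess v i k)"
  by (simp add: sq_gip d_gip)

text \<open>By \<open>d_gip\<close> each iterated pairing is a sum of two Hessian values. Those of
  \<open>a\<close> and of \<open>b\<close> cancel, that of \<open>u\<close> occurs twice.\<close>

lemma Hess_gip:
  "2 * (\<Uplus>k i. grad a k * grad b i * Hess u k i) = gip a (gip u b) + gip b (gip u a) - gip u (gip a b)"
proof -
  have e: "gip a (gip u b) = (\<Uplus>k i. grad a k * grad b i * Hess u k i) + (\<Uplus>k i. grad a k * grad u i * Hess b k i)"
    for a u b
    by (simp add: gip_def[of a "gip _ _"] d_gip distrib_left sum.distrib sum_distrib_left Hess_sym mult.assoc)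
  have s: "(\<Uplus>k i. grad a k * grad b i * Hess u k i) = (\<Uplus>k i. grad b k * grad a i * Hess u k i)" for a b u
    by (subst sum.swap) (simp add: Hess_sym mult_ac)
  show ?thesis
    unfolding e s[of b a u] s[of u b a] s[of u a b] by simp
qed

definition ip :: "('n \<Rightarrow> 'n \<Rightarrow> 'r) \<Rightarrow> ('n \<Rightarrow> 'n \<Rightarrow> 'r) \<Rightarrow> 'r" where
  "ip X Y = (\<Uplus>i j. mm h (mm X h) i j * Y i j)"

text \<open>This is \<open>dvg_nb\<close> for the gradient field, which differentiated along itself
  is half the gradient of its squared norm.\<close>

lemma Bochner:
  "lap (sq v) = 2 * (ip (Hess v) (Hess v) + (\<Uplus>i. grad v i * d i (lap v)) + (\<Uplus>i m. grad v i * Rc i m * grad v m))"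
proof -
  let ?W = "\<lambda>l. \<Uplus>i. grad v i * nb i (grad v) l"
  have "?W l = (\<Uplus>k. h l k * (hf * d k (sq v)))" for l
  proof -
    have "?W l = (\<Uplus>i k. h l k * (grad v i * Hess v i k))"
      by (simp add: nb_grad sum_distrib_left mult.left_commute)
    also have "\<dots> = (\<Uplus>k. h l k * (\<Uplus>i. grad v i * Hess v i k))"
      by (subst sum.swap) (simp add: sum_distrib_left)
    finally show ?thesis by (simp add: d_sq hf_twice)
  qed
  then have "dvg ?W = codiv (\<lambda>k. hf * d k (sq v))" by (simp only: dvg_raise)
  also have "\<dots> = hf * lap (sq v)"
    by (simp add: lap_codiv codiv_def d.mult right_diff_distrib sum_distrib_left mult.left_commute)
  finally have "lap (sq v) = 2 * dvg ?W" by (simp add: hf_twice)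
  moreover have "(\<Uplus>i l. nb i (grad v) l * nb l (grad v) i) = ip (Hess v) (Hess v)"
  proof -
    have a: "nb i (grad v) l = mm (Hess v) h i l" for i l
      by (simp add: nb_grad mm_def h_sym mult.commute)
    have "ip (Hess v) (Hess v) = (\<Uplus>i j k. mm (Hess v) h k j * (Hess v j i * h i k))"
      by (simp add: ip_def mm_def[of h] sum_distrib_left sum_distrib_right Hess_sym h_sym mult_ac)
    also have "\<dots> = (\<Uplus>k j i. mm (Hess v) h k j * (Hess v j i * h i k))" by (rule sum_swap3)
    also have "\<dots> = (\<Uplus>k j. mm (Hess v) h k j * mm (Hess v) h j k)"
      by (simp add: mm_def[of "Hess v" h j k for j k] sum_distrib_left)
    finally show ?thesis by (simp add: a)
  qed
  ultimately show ?thesis unfolding dvg_nb dvg_grad by simp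
qed

end

section \<open>Variation formulas under the Ricci flow\<close>

lemma sum_swap22: "(\<Uplus>j k. \<Uplus>i m. f j k i m) = (\<Uplus>i m. \<Uplus>j k. f j k i m)"
proof -
  have "(\<Uplus>j k. \<Uplus>i m. f j k i m) = (\<Uplus>i j. \<Uplus>k m. f j k i m)" by (rule sum_rot)
  also have "\<dots> = (\<Uplus>i m. \<Uplus>j k. f j k i m)" by (intro sum.cong[OF refl] sum_rot)
  finally show ?thesis .
qed

locale flow_ring = metric_ring d hf g h
  for d :: "'n::finite \<Rightarrow> 'r::comm_ring_1 \<Rightarrow> 'r" and hf g h +
  fixes dt :: "'r \<Rightarrow> 'r"
  assumes dert: "derivation dt"
    and dt_d: "dt (d i a) = d i (dt a)"
    and dt_g: "dt (g i j) = - (2 * Rc i j)"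
begin

sublocale dt: derivation dt by (rule dert)

lemma dt_hf [simp]: "dt hf = 0"
proof -
  have "2 * dt hf = 2 * 0" using hf dt.mult[of 2 hf] by simp
  then show ?thesis by (simp only: twice_cancel)
qed

text \<open>The symmetry is read off from the flow equation: up to the factor -2, \<open>Rc\<close>
  is the time derivative of the symmetric family \<open>g\<close>.\<close>

lemma Rc_sym: "Rc i j = Rc j i"
  using dt_g[of i j] dt_g[of j i] by (simp add: g_sym[of j i] twice_cancel)

lemma dt_h: "dt (h a b) = 2 * mm h (mm Rc h) a b"
proof -
  have "dt (h a b) = - mm h (mm (\<lambda>a b. - (2 * Rc a b)) h) a b"
    using deriv_inverse[OF dert gh hg, of a b] by (simp add: dt_g)
  also have "\<dots> = 2 * mm h (mm Rc h) a b"
    by (simp add: mm_def sum_negf sum_distrib_left mult_ac)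
  finally show ?thesis .
qed

definition A :: "'n \<Rightarrow> 'n \<Rightarrow> 'n \<Rightarrow> 'r" where
  "A i a b = dt (conn i a b)"

lemma A_sym: "A i a b = A b a i"
  by (simp add: A_def conn_def chris_sym)

text \<open>This is \<nabla>_a R_ij - \<nabla>_i R_ja - \<nabla>_j R_ia, the variation of the
  Christoffel symbol with its upper index lowered. When the covariant derivatives are written out,
  all connection terms cancel except the one kept here.\<close>

definition Y :: "'n \<Rightarrow> 'n \<Rightarrow> 'n \<Rightarrow> 'r" where
  "Y a i j = d a (Rc i j) - d i (Rc j a) - d j (Rc i a) + 2 * (\<Uplus>k. Rc a k * chris k i j)"

text \<open>The identity \<open>lower_chris\<close> contains only \<open>g\<close> and its
  derivatives, so its time derivative follows from the flow equation without differentiating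
  \<open>h\<close>; the index is raised at the end.\<close>

lemma A_eq: "A i k j = (\<Uplus>a. h k a * Y a i j)"
proof -
  have "(\<Uplus>k. g a k * A i k j) = Y a i j" for a
  proof -
    have "dt (\<Uplus>k. g a k * chris k i j) = dt (hf * (d i (g j a) + d j (g i a) - d a (g i j)))"
      by (simp only: lower_chris)
    then have "(\<Uplus>k. g a k * A i k j) - 2 * (\<Uplus>k. Rc a k * chris k i j)
        = hf * (d i (- (2 * Rc j a)) + d j (- (2 * Rc i a)) - d a (- (2 * Rc i j)))"
      by (simp add: dt.sum dt.mult dt.add dt.diff dt_d dt_g A_def conn_def sum.distrib sum_negf sum_subtractf
          sum_distrib_left mult.assoc)
    also have "\<dots> = hf * (2 * (d a (Rc i j) - d i (Rc j a) - d j (Rc i a)))"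
      by (simp add: d.minus d.mult algebra_simps)
    also have "\<dots> = d a (Rc i j) - d i (Rc j a) - d j (Rc i a)" by (rule hf_twice)
    finally show ?thesis by (simp add: Y_def algebra_simps)
  qed
  then show ?thesis using raise_lower[of k "\<lambda>k. A i k j"] by simp
qed

text \<open>The connection term that appears, twice, when the trace of \<open>Rc\<close> is
  differentiated under the sum; it is also the one subtracted in
  \<open>contracted_Bianchi\<close>.\<close>

definition Q :: "'n \<Rightarrow> 'r" where
  "Q m = (\<Uplus>a k. mm (conn m) h a k * Rc a k)"

lemma d_tr_Rc: "d m (tr Rc) = (\<Uplus>j k. h j k * d m (Rc j k)) - 2 * Q m"
proof -
  have "(\<Uplus>j k. mm (conn m) h k j * Rc j k) = (\<Uplus>k j. mm (conn m) h k j * Rc j k)"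
    by (rule sum.swap)
  also have "\<dots> = Q m" by (simp add: Q_def Rc_sym)
  finally have 1: "(\<Uplus>j k. mm (conn m) h k j * Rc j k) = Q m" .
  have 2: "(\<Uplus>j k. mm (conn m) h j k * Rc j k) = Q m" by (simp add: Q_def)
  have "d m (tr Rc) = (\<Uplus>j k. h j k * d m (Rc j k)) - (\<Uplus>j k. mm (conn m) h j k * Rc j k)
        - (\<Uplus>j k. mm (conn m) h k j * Rc j k)"
    by (simp add: tr_def d.sum d.mult d_h left_diff_distrib sum.distrib sum_subtractf sum_negf)
  then show ?thesis unfolding 1 2 by (simp add: algebra_simps)
qed

text \<open>The contracted Bianchi identity in partial derivatives: the terms \<open>Q m\<close> of
  its two sides cancel.\<close>

lemma codiv_Rc: "2 * codiv (Rc m) = (\<Uplus>j k. h j k * d m (Rc j k))"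
proof -
  have "(\<Uplus>a p. conn m a p * rho a p) = (\<Uplus>a p k. conn m a p * h p k * Rc a k)"
    by (simp add: rho_def sum_distrib_left mult.assoc)
  also have "\<dots> = (\<Uplus>a k p. conn m a p * h p k * Rc a k)"
    by (intro sum.cong refl sum.swap)
  also have "\<dots> = Q m" by (simp add: Q_def mm_def sum_distrib_right)
  finally have 1: "(\<Uplus>a p. conn m a p * rho a p) = Q m" .
  have 2: "dvg (rho m) = codiv (Rc m)"
    unfolding rho_def[abs_def] by (rule dvg_raise)
  show ?thesis
    using contracted_Bianchi[of m] unfolding 1 2 d_tr_Rc by (simp add: algebra_simps)
qed

text \<open>This is the contracted Bianchi identity in the form \<open>codiv_Rc\<close>. It is the
  reason why no first-order term in \<open>v\<close> appears in \<open>dt_lap\<close>.\<close>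

lemma tr_A: "(\<Uplus>i j. h i j * A i k j) = 0"
proof -
  have Y0: "(\<Uplus>i j. h i j * Y a i j) = 0" for a
  proof -
    have 1: "(\<Uplus>i j. h i j * d j (Rc i a)) = (\<Uplus>i j. h i j * d i (Rc a j))"
      by (subst sum.swap) (simp add: h_sym Rc_sym)
    have 2: "(\<Uplus>i j. h i j * d i (Rc j a)) = (\<Uplus>i j. h i j * d i (Rc a j))"
      by (simp add: Rc_sym)
    have "(\<Uplus>i j. h i j * (\<Uplus>k. Rc a k * chris k i j)) = (\<Uplus>i j k. h i j * chris k i j * Rc a k)"
      by (simp add: sum_distrib_left mult_ac)
    also have "\<dots> = (\<Uplus>k. Lam k * Rc a k)"
      by (subst sum_rot) (simp add: Lam_def sum_distrib_right)
    finally have 3: "(\<Uplus>i j. h i j * (\<Uplus>k. Rc a k * chris k i j)) = (\<Uplus>k. Lam k * Rc a k)" .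
    have "(\<Uplus>i j. h i j * Y a i j) = (\<Uplus>i j. h i j * d a (Rc i j)) - 2 * (\<Uplus>i j. h i j * d i (Rc a j))
        + 2 * (\<Uplus>k. Lam k * Rc a k)"
      unfolding Y_def distrib_left right_diff_distrib sum.distrib sum_subtractf 1 2 mult.left_commute[of _ 2]
        sum_distrib_left[of 2, symmetric] 3 by simp
    also have "\<dots> = 0"
      unfolding codiv_Rc[symmetric] codiv_def by (simp add: algebra_simps)
    finally show ?thesis .
  qed
  have "(\<Uplus>i j. h i j * A i k j) = (\<Uplus>i j a. h k a * (h i j * Y a i j))"
    by (simp add: A_eq sum_distrib_left mult.left_commute)
  also have "\<dots> = (\<Uplus>a. h k a * (\<Uplus>i j. h i j * Y a i j))"
    by (subst sum_rot) (simp add: sum_distrib_left)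
  finally show ?thesis by (simp add: Y0)
qed

text \<open>In coordinates the left side is the time derivative of \<partial>_j log sqrt(det g), and
  under the flow the logarithm of the volume density changes at rate -R.\<close>

lemma contract_A: "(\<Uplus>i. A i i j) = - d j (tr Rc)"
proof -
  have 1: "(\<Uplus>i a. h i a * d i (Rc j a)) = (\<Uplus>i a. h i a * d a (Rc i j))"
    by (subst sum.swap) (simp add: h_sym Rc_sym)
  have 2: "(\<Uplus>i a. h i a * d j (Rc i a)) = d j (tr Rc) + 2 * Q j"
    by (simp add: d_tr_Rc)
  have "(\<Uplus>i a. h i a * (\<Uplus>k. Rc a k * chris k i j)) = (\<Uplus>i a k. conn j k i * h i a * Rc k a)"
    by (simp add: sum_distrib_left conn_def chris_sym Rc_sym mult_ac)
  also have "\<dots> = (\<Uplus>k a i. conn j k i * h i a * Rc k a)" by (rule sum_swap3)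
  also have "\<dots> = Q j" by (simp add: Q_def mm_def sum_distrib_right)
  finally have 3: "(\<Uplus>i a. h i a * (\<Uplus>k. Rc a k * chris k i j)) = Q j" .
  have "(\<Uplus>i. A i i j) = (\<Uplus>i a. h i a * Y a i j)" by (simp add: A_eq)
  then show ?thesis
    unfolding Y_def distrib_left right_diff_distrib sum.distrib sum_subtractf 1 2 mult.left_commute[of _ 2]
      sum_distrib_left[of 2, symmetric] 3 by simp
qed

lemma ip_commute: "ip X Z = ip Z X"
proof -
  have *: "mm h (mm X h) i j = (\<Uplus>a b. h i a * h j b * X a b)" for X i j
    by (simp add: mm_def sum_distrib_left h_sym mult_ac)
  have "ip X Z = (\<Uplus>i j. \<Uplus>a b. h i a * h j b * X a b * Z i j)"
    by (simp add: ip_def * sum_distrib_right)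
  also have "\<dots> = (\<Uplus>i a. \<Uplus>j b. h i a * h j b * X a b * Z i j)"
    by (intro sum.cong[OF refl] sum.swap)
  also have "\<dots> = (\<Uplus>a i. \<Uplus>j b. h i a * h j b * X a b * Z i j)" by (rule sum.swap)
  also have "\<dots> = (\<Uplus>a b. \<Uplus>i j. h i a * h j b * X a b * Z i j)"
    by (rule sum.cong[OF refl]) (rule sum_rot)
  also have "\<dots> = ip Z X"
    by (simp add: ip_def * sum_distrib_left sum_distrib_right h_sym mult_ac)
  finally show ?thesis .
qed

lemma ip_add: "ip (\<lambda>i j. X i j + X' i j) Z = ip X Z + ip X' Z"
  by (simp add: ip_def mm_linear distrib_right sum.distrib)

text \<open>The trace of the variation formula dt R_jk = \<nabla>_i A^i_jk - \<nabla>_j A^i_ik. By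
  \<open>tr_A\<close> the first divergence has trace zero; by \<open>contract_A\<close> the second
  contributes the Laplacian of the scalar curvature.\<close>

lemma tr_dt_Riem: "(\<Uplus>j k. h j k * dt (Rc j k)) = lap (tr Rc)"
proof -
  let ?S = "\<lambda>F. \<Uplus>j k. h j k * (\<Uplus>i. F i j k)"
  \<comment> \<open>Moving \<open>h\<close> inside the derivative in \<open>S1\<close> costs
    \<open>?Z\<close> twice; \<open>S5\<close> and \<open>S6\<close> compensate it. The Laplacian is
    assembled from \<open>S2\<close> and \<open>S3\<close>.\<close>
  let ?Z = "\<Uplus>i j k. mm (conn i) h j k * A j i k"
  have e: "dt (Rc j k) = (\<Uplus>i. d i (A j i k)) - (\<Uplus>i. d j (A i i k)) + (\<Uplus>i. mm (A i) (conn j) i k)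
      + (\<Uplus>i. mm (conn i) (A j) i k) - (\<Uplus>i. mm (A j) (conn i) i k) - (\<Uplus>i. mm (conn j) (A i) i k)" for j k
    by (simp add: Rc_def Riem_def dt.sum dt.add dt.diff dt.mm dt_d sum.distrib sum_subtractf algebra_simps
        flip: A_def)
  have S1: "?S (\<lambda>i j k. d i (A j i k)) = 2 * ?Z"
  proof -
    have "?S (\<lambda>i j k. d i (A j i k)) = (\<Uplus>j k i. h j k * d i (A j i k))"
      by (simp add: sum_distrib_left)
    also have "\<dots> = (\<Uplus>i j k. h j k * d i (A j i k))" by (rule sum_rot)
    also have "\<dots> = (\<Uplus>i. d i (\<Uplus>j k. h j k * A j i k)) - (\<Uplus>i j k. d i (h j k) * A j i k)"
      by (simp add: d.sum d.mult sum.distrib)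
    also have "\<dots> = ?Z + (\<Uplus>i j k. mm (conn i) h k j * A j i k)"
      by (simp add: tr_A d_h algebra_simps sum.distrib sum_negf sum_subtractf)
    also have "(\<Uplus>i j k. mm (conn i) h k j * A j i k) = ?Z"
      by (rule sum.cong[OF refl], subst sum.swap) (simp add: A_sym)
    finally show ?thesis by simp
  qed
  have S2: "?S (\<lambda>i j k. d j (A i i k)) = - (\<Uplus>j k. h j k * d j (d k (tr Rc)))"
    by (simp add: contract_A d.minus sum_negf flip: d.sum)
  have S3: "?S (\<lambda>i j k. mm (A i) (conn j) i k) = - (\<Uplus>m. Lam m * d m (tr Rc))"
  proof -
    have "(\<Uplus>i. mm (A i) (conn j) i k) = - (\<Uplus>m. conn j m k * d m (tr Rc))" for j k
      unfolding mm_def by (subst sum.swap)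
        (simp add: contract_A sum_negf mult.commute flip: sum_distrib_left)
    then have "?S (\<lambda>i j k. mm (A i) (conn j) i k) = - (\<Uplus>j k m. h j k * chris m j k * d m (tr Rc))"
      by (simp add: sum_negf sum_distrib_left conn_def mult.assoc)
    also have "\<dots> = - (\<Uplus>m. Lam m * d m (tr Rc))"
      by (subst sum_rot) (simp add: Lam_def sum_distrib_right)
    finally show ?thesis .
  qed
  have S4: "?S (\<lambda>i j k. mm (conn i) (A j) i k) = 0"
  proof -
    have "?S (\<lambda>i j k. mm (conn i) (A j) i k) = (\<Uplus>j k. \<Uplus>i m. conn i i m * (h j k * A j m k))"
      by (simp add: mm_def sum_distrib_left mult.left_commute)
    also have "\<dots> = (\<Uplus>i m. \<Uplus>j k. conn i i m * (h j k * A j m k))" by (rule sum_swap22)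
    also have "\<dots> = 0" by (simp add: tr_A flip: sum_distrib_left)
    finally show ?thesis .
  qed
  have S5: "?S (\<lambda>i j k. mm (A j) (conn i) i k) = ?Z"
  proof -
    have "?S (\<lambda>i j k. mm (A j) (conn i) i k) = (\<Uplus>j k. \<Uplus>i m. conn i m k * h k j * A m i j)"
      by (simp add: mm_def sum_distrib_left A_sym h_sym mult_ac)
    also have "\<dots> = (\<Uplus>i m. \<Uplus>j k. conn i m k * h k j * A m i j)" by (rule sum_swap22)
    also have "\<dots> = ?Z" by (simp add: mm_def sum_distrib_right)
    finally show ?thesis .
  qed
  have S6: "?S (\<lambda>i j k. mm (conn j) (A i) i k) = ?Z"
  proof -
    have "?S (\<lambda>i j k. mm (conn j) (A i) i k) = (\<Uplus>j k. \<Uplus>i m. conn m i j * h j k * A i m k)"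
      by (simp add: mm_def sum_distrib_left conn_def chris_sym mult_ac)
    also have "\<dots> = (\<Uplus>i m. \<Uplus>j k. conn m i j * h j k * A i m k)" by (rule sum_swap22)
    also have "\<dots> = (\<Uplus>m i. \<Uplus>j k. conn m i j * h j k * A i m k)" by (rule sum.swap)
    also have "\<dots> = (\<Uplus>m i. \<Uplus>k j. conn m i j * h j k * A i m k)"
      by (intro sum.cong[OF refl] sum.swap)
    also have "\<dots> = ?Z" by (simp add: mm_def sum_distrib_right)
    finally show ?thesis .
  qed
  show ?thesis
    unfolding e distrib_left right_diff_distrib sum.distrib sum_subtractf S1 S2 S3 S4 S5 S6 lap_codiv codiv_def
    by simp
qed

lemma dt_tr_Rc: "dt (tr Rc) = 2 * ip Rc Rc + lap (tr Rc)"
proof -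
  have "dt (tr Rc) = (\<Uplus>i j. dt (h i j) * Rc i j) + (\<Uplus>j k. h j k * dt (Rc j k))"
    by (simp add: tr_def dt.sum dt.mult sum.distrib)
  then show ?thesis
    by (simp add: tr_dt_Riem dt_h ip_def sum_distrib_left mult.assoc)
qed

lemma dt_lap: "dt (lap v) = 2 * ip Rc (Hess v) + lap (dt v)"
proof -
  have "dt (Hess v i j) = Hess (dt v) i j - (\<Uplus>k. A i k j * d k v)" for i j
    by (simp add: Hess_def dt.diff dt.sum dt.mult dt_d sum.distrib A_def conn_def)
  then have "dt (lap v) = (\<Uplus>i j. dt (h i j) * Hess v i j) + lap (dt v)
      - (\<Uplus>i j k. h i j * A i k j * d k v)"
    by (simp add: lap_def tr_def dt.sum dt.mult sum.distrib right_diff_distrib sum_subtractf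
        sum_distrib_left mult.assoc)
  also have "(\<Uplus>i j k. h i j * A i k j * d k v) = 0"
    by (subst sum_rot) (simp add: tr_A flip: sum_distrib_right)
  finally show ?thesis
    by (simp add: dt_h ip_def sum_distrib_left mult.assoc)
qed

lemma dt_sq: "dt (sq v) = 2 * (\<Uplus>i m. grad v i * Rc i m * grad v m) + 2 * (\<Uplus>i. grad v i * d i (dt v))"
proof -
  have 1: "(\<Uplus>i j. mm h (mm Rc h) i j * d j v * d i v) = (\<Uplus>i m. grad v i * Rc i m * grad v m)"
  proof -
    have "(\<Uplus>i j. mm h (mm Rc h) i j * d j v * d i v)
       = (\<Uplus>i j. \<Uplus>a b. h a i * d i v * Rc a b * (h b j * d j v))"
      by (simp add: mm_def sum_distrib_left sum_distrib_right h_sym mult_ac)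
    also have "\<dots> = (\<Uplus>a b. \<Uplus>i j. h a i * d i v * Rc a b * (h b j * d j v))" by (rule sum_swap22)
    also have "\<dots> = (\<Uplus>i m. grad v i * Rc i m * grad v m)"
      by (simp add: grad_def sum_distrib_left[symmetric] sum_distrib_right[symmetric])
    finally show ?thesis .
  qed
  have 2: "(\<Uplus>i j. h i j * d j (dt v) * d i v) = (\<Uplus>i. grad v i * d i (dt v))"
    by (subst sum.swap) (simp add: grad_def sum_distrib_left sum_distrib_right h_sym mult_ac)
  have "dt (sq v) = (\<Uplus>i j. dt (h i j) * d j v * d i v) + (\<Uplus>i j. h i j * d j (dt v) * d i v)
       + (\<Uplus>i. grad v i * d i (dt v))"
    by (simp add: sq_def grad_def dt.sum dt.mult dt_d sum.distrib distrib_left distrib_right sum_distrib_right mult.assoc)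
  also have "(\<Uplus>i j. dt (h i j) * d j v * d i v) = 2 * (\<Uplus>i j. mm h (mm Rc h) i j * d j v * d i v)"
    by (simp add: dt_h sum_distrib_left mult.assoc)
  finally show ?thesis unfolding 1 2 by (simp add: algebra_simps)
qed

lemma lap_linear: "lap (a + b) = lap a + lap b" "lap (a - b) = lap a - lap b" "lap (2 * a) = 2 * lap a"
  by (simp_all add: lap_codiv codiv_def d.add d.diff d.mult algebra_simps sum.distrib sum_subtractf sum_distrib_left)

text \<open>The term Rc(\<nabla>v,\<nabla>v) of \<open>dt_sq\<close> cancels that of
  \<open>Bochner\<close>; the Laplacians of the scalar curvature and the iterated Laplacians of
  \<open>v\<close> cancel among \<open>dt_tr_Rc\<close>, \<open>dt_lap\<close> and
  \<open>lap P\<close>. The remaining first-order terms form the derivative of \<open>P\<close>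
  along the gradient of \<open>v\<close>, and the quadratic ones complete a square.\<close>

theorem evolution:
  fixes v c
  defines "P \<equiv> 2 * lap v - sq v + tr Rc"
  assumes v: "dt v = sq v - lap v - tr Rc + c" and c: "\<And>i. d i c = 0"
  defines "S \<equiv> \<lambda>i j. Rc i j + Hess v i j"
  shows "dt P + lap P - 2 * (\<Uplus>i. grad v i * d i P) = 2 * ip S S"
proof -
  have lc: "lap c = 0" by (simp add: lap_codiv codiv_def c)
  have S: "ip S S = ip Rc Rc + 2 * ip Rc (Hess v) + ip (Hess v) (Hess v)"
    unfolding S_def ip_add ip_commute[of _ "\<lambda>i j. Rc i j + Hess v i j"]
    by (simp add: ip_commute[of "Hess v" Rc])
  show ?thesis
    unfolding P_def S dt.add dt.diff dt.mult dt_tr_Rc dt_lap dt_sq v lap_linear lc Bochner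
      d.add d.diff d.mult c distrib_left right_diff_distrib sum.distrib sum_subtractf
    by (simp add: algebra_simps sum_distrib_left)
qed

end

section \<open>Jets\<close>

text \<open>The head of the list is the derivative taken first; \<open>ipd\<close> follows the same
  convention.\<close>

definition shift :: "'d \<Rightarrow> ('d list \<Rightarrow> real) \<Rightarrow> 'd list \<Rightarrow> real" where
  "shift i a l = a (i # l)"

primrec leibniz :: "'d list \<Rightarrow> ('d list \<Rightarrow> real) \<Rightarrow> ('d list \<Rightarrow> real) \<Rightarrow> real" where
  "leibniz [] a b = a [] * b []"
| "leibniz (i # l) a b = leibniz l (shift i a) b + leibniz l a (shift i b)"

text \<open>Equality of mixed partial derivatives, stated for adjacent entries at any depth of the
  list. It makes the shifts commute.\<close>

definition symmetric :: "('d list \<Rightarrow> real) \<Rightarrow> bool" where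
  "symmetric a \<longleftrightarrow> (\<forall>xs ys i j. a (xs @ i # j # ys) = a (xs @ j # i # ys))"

lemma symmetric_shift: "symmetric a \<Longrightarrow> symmetric (shift i a)"
  unfolding symmetric_def shift_def by (metis append_Cons)

lemma shift_commute: "symmetric a \<Longrightarrow> shift i (shift j a) = shift j (shift i a)"
  unfolding symmetric_def shift_def by (metis append_Nil)

lemma symmetric_leibniz:
  assumes "symmetric a" "symmetric b"
  shows "symmetric (\<lambda>l. leibniz l a b)"
proof -
  have "leibniz (xs @ i # j # ys) a b = leibniz (xs @ j # i # ys) a b" for xs ys i j
    using assms
  proof (induction xs arbitrary: a b)
    case Nil
    then show ?case by (simp add: shift_commute[of a i j] shift_commute[of b i j])
  next
    case (Cons x xs)
    then show ?case by (simp add: symmetric_shift)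
  qed
  then show ?thesis by (simp add: symmetric_def)
qed

text \<open>A jet stands for the family of all iterated partial derivatives of a function at a point;
  \<open>'d\<close> is the type of directions. The product is given by the Leibniz rule.\<close>

typedef 'd jet = "{a :: 'd list \<Rightarrow> real. symmetric a}"
  morphisms jcoeff Jet
  by (rule exI[of _ "\<lambda>_. 0"]) (simp add: symmetric_def)

lemma jcoeff_Jet: "symmetric a \<Longrightarrow> jcoeff (Jet a) = a"
  by (simp add: Jet_inverse)

lemma symmetric_jcoeff: "symmetric (jcoeff a)"
  using jcoeff[of a] by simp

lemma jet_eqI: "(\<And>l. jcoeff a l = jcoeff b l) \<Longrightarrow> a = b"
  by (metis jcoeff_inject ext)

instantiation jet :: (type) comm_ring_1
begin

definition "0 = Jet (\<lambda>_. 0)"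
definition "1 = Jet (\<lambda>l. if l = [] then 1 else 0)"
definition "a + b = Jet (\<lambda>l. jcoeff a l + jcoeff b l)"
definition "a - b = Jet (\<lambda>l. jcoeff a l - jcoeff b l)"
definition "- a = Jet (\<lambda>l. - jcoeff a l)"
definition "a * b = Jet (\<lambda>l. leibniz l (jcoeff a) (jcoeff b))"

lemma jcoeff_simps [simp]:
  "jcoeff 0 l = 0"
  "jcoeff 1 l = (if l = [] then 1 else 0)"
  "jcoeff (a + b) l = jcoeff a l + jcoeff b l"
  "jcoeff (a - b) l = jcoeff a l - jcoeff b l"
  "jcoeff (- a) l = - jcoeff a l"
  using symmetric_jcoeff[of a] symmetric_jcoeff[of b]
  by (simp_all add: zero_jet_def one_jet_def plus_jet_def minus_jet_def uminus_jet_def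
      jcoeff_Jet symmetric_def)

lemma jcoeff_mult: "jcoeff (a * b) l = leibniz l (jcoeff a) (jcoeff b)"
  unfolding times_jet_def by (subst jcoeff_Jet) (simp_all add: symmetric_leibniz symmetric_jcoeff)

lemma leibniz_commute: "leibniz l a b = leibniz l b a"
  by (induction l arbitrary: a b) simp_all

lemma leibniz_add: "leibniz l (\<lambda>l. a l + b l) c = leibniz l a c + leibniz l b c"
proof (induction l arbitrary: a b c)
  case (Cons i l)
  have "shift i (\<lambda>l. a l + b l) = (\<lambda>l. shift i a l + shift i b l)" by (simp add: shift_def fun_eq_iff)
  with Cons show ?case by simp
qed (simp add: algebra_simps)

lemma shift_leibniz: "shift i (\<lambda>l. leibniz l a b) = (\<lambda>l. leibniz l (shift i a) b + leibniz l a (shift i b))"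
  by (simp add: shift_def[of i "\<lambda>l. leibniz l a b"] fun_eq_iff)

lemma leibniz_assoc:
  "leibniz l (\<lambda>l. leibniz l a b) c = leibniz l a (\<lambda>l. leibniz l b c)"
proof (induction l arbitrary: a b c)
  case (Cons i l)
  have r: "leibniz l a (\<lambda>l. b l + c l) = leibniz l a b + leibniz l a c" for a b c :: "'b list \<Rightarrow> real"
    by (metis leibniz_add leibniz_commute)
  show ?case by (simp add: shift_leibniz leibniz_add r Cons)
qed simp

lemma leibniz_one: "leibniz l (\<lambda>l. if l = [] then 1 else 0) a = a l"
proof (induction l arbitrary: a)
  case (Cons i l)
  have z: "leibniz l (\<lambda>l. 0) a = 0" for l and a :: "'b list \<Rightarrow> real"
  proof (induction l arbitrary: a)
    case (Cons i l)
    have "shift i (\<lambda>l. 0) = (\<lambda>l. 0)" by (simp add: shift_def fun_eq_iff)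
    with Cons show ?case by simp
  qed simp
  have "shift i (\<lambda>l. if l = [] then 1 else 0) = (\<lambda>l. 0)" by (simp add: shift_def fun_eq_iff)
  with Cons show ?case by (simp add: z) (simp add: shift_def)
qed simp

instance
proof
  fix a b c :: "'a jet"
  show "a * b * c = a * (b * c)"
    by (rule jet_eqI) (simp add: jcoeff_mult[abs_def] leibniz_assoc)
  show "a * b = b * a"
    by (rule jet_eqI) (simp add: jcoeff_mult leibniz_commute)
  show "1 * a = a"
    by (rule jet_eqI) (simp add: jcoeff_mult leibniz_one jcoeff_simps(2)[abs_def])
  show "(a + b) * c = a * c + b * c"
    by (rule jet_eqI) (simp add: jcoeff_mult leibniz_add jcoeff_simps(3)[abs_def])
  show "a + b + c = a + (b + c)" "a + b = b + a" "0 + a = a" "- a + a = 0" "a - b = a + - b"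
    by (rule jet_eqI; simp)+
  show "(0 :: 'a jet) \<noteq> 1"
    by (metis jcoeff_simps(1,2) zero_neq_one)
qed

end

definition jd :: "'d \<Rightarrow> 'd jet \<Rightarrow> 'd jet" where
  "jd i a = Jet (shift i (jcoeff a))"

lemma jcoeff_jd: "jcoeff (jd i a) = shift i (jcoeff a)"
  by (simp add: jd_def jcoeff_Jet symmetric_shift symmetric_jcoeff)

lemma jd_add: "jd i (a + b) = jd i a + jd i b"
  by (rule jet_eqI) (simp add: jcoeff_jd shift_def)

lemma jd_mult: "jd i (a * b) = jd i a * b + a * jd i b"
  by (rule jet_eqI) (simp add: jcoeff_jd shift_def[of i "jcoeff (a * b)"] jcoeff_mult)

lemma jd_commute: "jd i (jd j a) = jd j (jd i a)"
  by (rule jet_eqI) (simp add: jcoeff_jd shift_commute[OF symmetric_jcoeff])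

text \<open>The value of the function at the base point. As a ring homomorphism, \<open>ev\<close>
  turns identities between jets into identities between real numbers.\<close>

definition ev :: "'d jet \<Rightarrow> real" where
  "ev a = jcoeff a []"

lemma ev_simps [simp]:
  "ev 0 = 0" "ev 1 = 1" "ev (a + b) = ev a + ev b" "ev (a - b) = ev a - ev b" "ev (- a) = - ev a"
  "ev (a * b) = ev a * ev b"
  by (simp_all add: ev_def jcoeff_mult)

lemma ev_sum [simp]: "ev (sum f A) = (\<Sum>x\<in>A. ev (f x))"
  by (induction A rule: infinite_finite_induct) auto

lemma ev_numeral [simp]: "ev (numeral n) = numeral n"
proof -
  have "ev (of_nat k) = of_nat k" for k by (induction k) auto
  from this[of "numeral n"] show ?thesis by simp
qed

definition const_jet :: "real \<Rightarrow> 'd jet" where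
  "const_jet c = Jet (\<lambda>l. if l = [] then c else 0)"

lemma jcoeff_const_jet: "jcoeff (const_jet c) l = (if l = [] then c else 0)"
  unfolding const_jet_def by (subst jcoeff_Jet) (simp_all add: symmetric_def)

lemma twice_half_jet: "2 * const_jet (1/2) = 1"
  by (rule jet_eqI) (unfold mult_2 jcoeff_simps jcoeff_const_jet, simp)

section \<open>Calculus of smooth functions\<close>

text \<open>On such sets derivatives within \<open>S\<close> are unique.\<close>

definition thick :: "'a::euclidean_space set \<Rightarrow> bool" where
  "thick S \<longleftrightarrow> (\<forall>x\<in>S. \<forall>i\<in>Basis. \<forall>e>0. \<exists>d. 0 < \<bar>d\<bar> \<and> \<bar>d\<bar> < e \<and> x + d *\<^sub>R i \<in> S)"

definition pd :: "'a::euclidean_space set \<Rightarrow> 'a \<Rightarrow> ('a \<Rightarrow> 'b::real_normed_vector) \<Rightarrow> 'a \<Rightarrow> 'b" where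
  "pd S w F x = frechet_derivative F (at x within S) w"

lemma frechet_derivative_eqI:
  assumes "thick S" "x \<in> S" "(F has_derivative F') (at x within S)"
  shows "frechet_derivative F (at x within S) = F'"
proof (rule frechet_derivative_unique_within[of F _ x S])
  show "(F has_derivative frechet_derivative F (at x within S)) (at x within S)"
    using assms(3) frechet_derivative_works differentiableI by blast
qed (use assms in \<open>auto simp: thick_def\<close>)

lemma pd_eqI:
  assumes "thick S" "x \<in> S" "(F has_derivative F') (at x within S)"
  shows "pd S w F x = F' w"
  using frechet_derivative_eqI[OF assms] by (simp add: pd_def)

lemma pd_works:
  assumes "F differentiable_on S" "x \<in> S"
  shows "(F has_derivative (\<lambda>w. pd S w F x)) (at x within S)"
  using assms unfolding pd_def differentiable_on_def frechet_derivative_works by simp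

text \<open>This holds even for functions that are not differentiable:
  \<open>frechet_derivative\<close> is chosen among all derivatives within \<open>S\<close>, and the
  two functions have the same ones.\<close>

lemma pd_cong:
  assumes "\<And>x. x \<in> S \<Longrightarrow> F x = G x" "x \<in> S"
  shows "pd S w F x = pd S w G x"
proof -
  have "(F has_derivative F') (at x within S) \<longleftrightarrow> (G has_derivative F') (at x within S)" for F'
    using assms has_derivative_transform[of x S F G] has_derivative_transform[of x S G F] by metis
  then show ?thesis by (simp add: pd_def frechet_derivative_def)
qed

section \<open>Closure properties of k times continuously differentiable functions\<close>

lemma Ck_on_Suc: "Ck_on (Suc k) S F \<longleftrightarrow> F differentiable_on S \<and> (\<forall>w. Ck_on k S (pd S w F))"
  by (simp add: pd_def[abs_def])

declare Ck_on.simps(2) [simp del]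

lemma Ck_on_cong:
  fixes F G :: "'a::euclidean_space \<Rightarrow> 'b::real_normed_vector"
  assumes "\<And>x. x \<in> S \<Longrightarrow> F x = G x" "Ck_on k S F"
  shows "Ck_on k S G"
  using assms
proof (induction k arbitrary: F G)
  case 0
  then show ?case using continuous_on_eq[of S F G] by simp
next
  case (Suc k)
  have "G differentiable_on S"
    unfolding differentiable_on_def
  proof
    fix x assume "x \<in> S"
    then show "G differentiable at x within S"
      using Suc.prems differentiable_transform_within[of F x S 1 G]
      unfolding Ck_on_Suc differentiable_on_def by auto
  qed
  moreover have "Ck_on k S (pd S w G)" for w
    using Suc.IH[of "pd S w F" "pd S w G"] pd_cong[of S F G] Suc.prems by (auto simp: Ck_on_Suc)
  ultimately show ?case by (simp add: Ck_on_Suc)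
qed

lemma Ck_on_SucD: "Ck_on (Suc k) S F \<Longrightarrow> Ck_on k S F"
  for F :: "'a::euclidean_space \<Rightarrow> 'b::real_normed_vector"
proof (induction k arbitrary: F)
  case 0
  then show ?case unfolding Ck_on_Suc by (auto intro: differentiable_imp_continuous_on)
next
  case (Suc k)
  then show ?case unfolding Ck_on_Suc[of "Suc k"] by (subst Ck_on_Suc) blast
qed

text \<open>On a thick set derivatives are unique, so any explicit formula for the derivative may
  stand in for the chosen one.\<close>

lemma Ck_on_SucI:
  assumes "thick S" "\<And>x. x \<in> S \<Longrightarrow> (F has_derivative F' x) (at x within S)"
    and "\<And>w. Ck_on k S (\<lambda>x. F' x w)"
  shows "Ck_on (Suc k) S F"
proof -
  have "F differentiable_on S" using assms(2) by (auto simp: differentiable_on_def differentiable_def)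
  moreover have "Ck_on k S (pd S w F)" for w
    by (rule Ck_on_cong[OF _ assms(3)[of w]]) (use pd_eqI[OF assms(1) _ assms(2)] in simp)
  ultimately show ?thesis by (simp add: Ck_on_Suc)
qed

lemma Ck_on_SucE:
  assumes "Ck_on (Suc k) S F" "x \<in> S"
  shows "(F has_derivative (\<lambda>w. pd S w F x)) (at x within S)"
  using assms(1) pd_works[OF _ assms(2)] unfolding Ck_on_Suc by blast

lemma Ck_on_const: "thick S \<Longrightarrow> Ck_on k S (\<lambda>x. c)"
proof (induction k arbitrary: c)
  case (Suc k)
  then show ?case by (intro Ck_on_SucI[where F' = "\<lambda>x w. 0"]) auto
qed simp

lemma Ck_on_add:
  assumes "thick S" "Ck_on k S F" "Ck_on k S G"
  shows "Ck_on k S (\<lambda>x. F x + G x)"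
  using assms(2,3)
proof (induction k arbitrary: F G)
  case (Suc k)
  then show ?case
    by (intro Ck_on_SucI[where F' = "\<lambda>x w. pd S w F x + pd S w G x"] assms(1) has_derivative_add Suc.IH)
       (auto simp: Ck_on_Suc intro: pd_works)
qed (simp add: continuous_on_add)

lemma Ck_on_linear:
  assumes "thick S" "bounded_linear L" "Ck_on k S F"
  shows "Ck_on k S (\<lambda>x. L (F x))"
  using assms(3)
proof (induction k arbitrary: F)
  case 0
  then show ?case by (simp add: bounded_linear.continuous_on[OF assms(2)])
next
  case (Suc k)
  then show ?case
    by (intro Ck_on_SucI[where F' = "\<lambda>x w. L (pd S w F x)"] assms(1) bounded_linear.has_derivative[OF assms(2)]
        Suc.IH)
       (auto simp: Ck_on_Suc intro: pd_works)
qed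

lemma Ck_on_mult:
  fixes F G :: "'a::euclidean_space \<Rightarrow> real"
  assumes "thick S" "Ck_on k S F" "Ck_on k S G"
  shows "Ck_on k S (\<lambda>x. F x * G x)"
  using assms(2,3)
proof (induction k arbitrary: F G)
  case (Suc k)
  show ?case
  proof (rule Ck_on_SucI[OF assms(1)])
    show "((\<lambda>x. F x * G x) has_derivative (\<lambda>w. F x * pd S w G x + pd S w F x * G x)) (at x within S)"
      if "x \<in> S" for x
      using that Suc.prems by (intro has_derivative_mult Ck_on_SucE)
    show "Ck_on k S (\<lambda>x. F x * pd S w G x + pd S w F x * G x)" for w
      using Suc.prems Ck_on_SucD[OF Suc.prems(1)] Ck_on_SucD[OF Suc.prems(2)]
      by (intro Ck_on_add[OF assms(1)] Suc.IH) (auto simp: Ck_on_Suc)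
  qed
qed (simp add: continuous_on_mult)

lemma Ck_on_inverse:
  fixes F :: "'a::euclidean_space \<Rightarrow> real"
  assumes "thick S" "Ck_on k S F" "\<And>x. x \<in> S \<Longrightarrow> F x \<noteq> 0"
  shows "Ck_on k S (\<lambda>x. inverse (F x))"
  using assms(2,3)
proof (induction k arbitrary: F)
  case (Suc k)
  show ?case
  proof (rule Ck_on_SucI[OF assms(1)])
    show "((\<lambda>x. inverse (F x)) has_derivative (\<lambda>w. (- 1) * ((inverse (F x) * pd S w F x) * inverse (F x)))) (at x within S)"
      if "x \<in> S" for x
      using Deriv.has_derivative_inverse[OF _ Ck_on_SucE[OF Suc.prems(1) that]] Suc.prems(2)[OF that] by simp
    show "Ck_on k S (\<lambda>x. (- 1) * ((inverse (F x) * pd S w F x) * inverse (F x)))" for w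
      using Suc.prems Ck_on_SucD[OF Suc.prems(1)]
      by (intro Ck_on_mult[OF assms(1)] Ck_on_const[OF assms(1)] Suc.IH) (auto simp: Ck_on_Suc)
  qed
qed (simp add: continuous_on_inverse)

lemma Ck_on_ln:
  fixes F :: "'a::euclidean_space \<Rightarrow> real"
  assumes "thick S" "Ck_on k S F" "\<And>x. x \<in> S \<Longrightarrow> F x > 0"
  shows "Ck_on k S (\<lambda>x. ln (F x))"
proof (cases k)
  case 0
  then show ?thesis using assms by (auto intro!: continuous_on_ln dest: less_imp_neq[THEN not_sym])
next
  case (Suc m)
  show ?thesis unfolding Suc
  proof (rule Ck_on_SucI[OF assms(1)])
    show "((\<lambda>x. ln (F x)) has_derivative (\<lambda>w. pd S w F x * inverse (F x))) (at x within S)"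
      if "x \<in> S" for x
      using that assms Suc
      by (auto intro!: derivative_eq_intros Ck_on_SucE[of m S F x] simp: divide_inverse)
    show "Ck_on m S (\<lambda>x. pd S w F x * inverse (F x))" for w
      using assms Suc Ck_on_SucD[of m S F]
      by (intro Ck_on_mult Ck_on_inverse) (auto simp: Ck_on_Suc less_imp_neq[THEN not_sym])
  qed
qed

lemma Ck_on_subset:
  assumes "thick S'" "S' \<subseteq> S" "Ck_on k S F"
  shows "Ck_on k S' F"
  using assms(3)
proof (induction k arbitrary: F)
  case 0
  then show ?case using assms(2) by (auto intro: continuous_on_subset)
next
  case (Suc k)
  show ?case
    by (rule Ck_on_SucI[OF assms(1), where F' = "\<lambda>x w. pd S w F x"])
       (use Suc assms(2) in \<open>auto simp: Ck_on_Suc intro!: has_derivative_subset[OF pd_works]\<close>)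
qed

text \<open>An affine inner map has constant derivative, so the directional derivatives of the
  composite are again composites with the same map and the induction closes. Time slices and
  time-independent extensions are instances.\<close>

lemma Ck_on_affine_map:
  fixes F :: "'b::euclidean_space \<Rightarrow> 'c::real_normed_vector" and L :: "'a::euclidean_space \<Rightarrow> 'b"
  assumes "thick S" "bounded_linear L" "\<And>x. x \<in> S \<Longrightarrow> L x + a \<in> S'" "Ck_on k S' F"
  shows "Ck_on k S (\<lambda>x. F (L x + a))"
  using assms(4)
proof (induction k arbitrary: F)
  case 0
  then show ?case
    using assms(3) continuous_on_compose2[of S' F S "\<lambda>x. L x + a"]
      continuous_on_add[OF linear_continuous_on[OF assms(2)] continuous_on_const] by auto
next
  case (Suc k)
  show ?case
  proof (rule Ck_on_SucI[OF assms(1)])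
    fix x assume x: "x \<in> S"
    show "((\<lambda>x. F (L x + a)) has_derivative (\<lambda>w. pd S' (L w) F (L x + a))) (at x within S)"
    proof (rule has_derivative_in_compose2[of S' F "\<lambda>y w. pd S' w F y" "\<lambda>x. L x + a" S x L])
      show "((\<lambda>x. L x + a) has_derivative L) (at x within S)"
        using has_derivative_add_const[OF bounded_linear_imp_has_derivative[OF assms(2)]] .
    qed (use assms x Suc.prems in \<open>auto intro: Ck_on_SucE\<close>)
  next
    show "Ck_on k S (\<lambda>x. pd S' (L w) F (L x + a))" for w
      using Suc by (auto simp: Ck_on_Suc)
  qed
qed

lemma thick_open: "open S \<Longrightarrow> thick S"
  unfolding thick_def
proof (intro ballI allI impI)
  fix x i :: 'a and e :: real
  assume "open S" "x \<in> S" "i \<in> Basis" "0 < e"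
  then obtain r where r: "r > 0" "ball x r \<subseteq> S" by (meson openE)
  let ?d = "min r e / 2"
  have "x + ?d *\<^sub>R i \<in> ball x r"
    using r \<open>i \<in> Basis\<close> \<open>0 < e\<close> by (simp add: dist_norm min_def)
  then show "\<exists>d. 0 < \<bar>d\<bar> \<and> \<bar>d\<bar> < e \<and> x + d *\<^sub>R i \<in> S"
    using r \<open>0 < e\<close> by (intro exI[of _ ?d]) (auto simp: min_def)
qed

lemma thick_Times: "thick S \<Longrightarrow> thick S' \<Longrightarrow> thick (S \<times> S')"
  for S :: "'a::euclidean_space set" and S' :: "'b::euclidean_space set"
  unfolding thick_def Basis_prod_def
proof (intro ballI allI impI)
  fix p i :: "'a \<times> 'b" and e :: real
  assume S: "\<forall>x\<in>S. \<forall>i\<in>Basis. \<forall>e>0. \<exists>d. 0 < \<bar>d\<bar> \<and> \<bar>d\<bar> < e \<and> x + d *\<^sub>R i \<in> S"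
    and S': "\<forall>x\<in>S'. \<forall>i\<in>Basis. \<forall>e>0. \<exists>d. 0 < \<bar>d\<bar> \<and> \<bar>d\<bar> < e \<and> x + d *\<^sub>R i \<in> S'"
    and p: "p \<in> S \<times> S'" and e: "(0::real) < e"
    and "i \<in> (\<lambda>u. (u, 0)) ` Basis \<union> (\<lambda>v. (0, v)) ` Basis"
  then consider u where "u \<in> Basis" "i = (u, 0)" | u where "u \<in> Basis" "i = (0, u)" by blast
  then show "\<exists>d. 0 < \<bar>d\<bar> \<and> \<bar>d\<bar> < e \<and> p + d *\<^sub>R i \<in> S \<times> S'"
  proof cases
    case 1
    then obtain d where "0 < \<bar>d\<bar>" "\<bar>d\<bar> < e" "fst p + d *\<^sub>R u \<in> S"
      using S p e unfolding mem_Times_iff by blast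
    then show ?thesis using 1 p by (intro exI[of _ d]) (auto simp: mem_Times_iff)
  next
    case 2
    then obtain d where "0 < \<bar>d\<bar>" "\<bar>d\<bar> < e" "snd p + d *\<^sub>R u \<in> S'"
      using S' p e unfolding mem_Times_iff by blast
    then show ?thesis using 2 p by (intro exI[of _ d]) (auto simp: mem_Times_iff)
  qed
qed

lemma thick_interval: "thick {0..<T}" if "0 < T" for T :: real
  unfolding thick_def Basis_real_def
proof (intro ballI allI impI)
  fix x i e :: real
  assume x: "x \<in> {0..<T}" and "i \<in> {1}" and "0 < e"
  let ?d = "min e (T - x) / 2"
  have "0 < ?d" "?d < e" "x + ?d < T" "0 \<le> x" using x \<open>0 < e\<close> by (auto simp: min_def field_simps)
  then show "\<exists>d. 0 < \<bar>d\<bar> \<and> \<bar>d\<bar> < e \<and> x + d *\<^sub>R i \<in> {0..<T}"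
    using \<open>i \<in> {1}\<close> by (intro exI[of _ ?d]) auto
qed

section \<open>Equality of mixed partial derivatives\<close>

lemma mixed_increment:
  fixes F :: "'a::euclidean_space \<Rightarrow> real"
  assumes "Ck_on 2 S F" "open S" "h > 0"
    and sub: "\<And>s t. s \<in> {0..h} \<Longrightarrow> t \<in> {0..h} \<Longrightarrow> x + s *\<^sub>R v + t *\<^sub>R w \<in> S"
  shows "\<exists>s\<in>{0..h}. \<exists>t\<in>{0..h}.
    F (x + h *\<^sub>R v + h *\<^sub>R w) - F (x + h *\<^sub>R v) - F (x + h *\<^sub>R w) + F x
     = h * h * pd S w (pd S v F) (x + s *\<^sub>R v + t *\<^sub>R w)"
proof -
  have C: "Ck_on (Suc 0) S (pd S v F)" "Ck_on (Suc (Suc 0)) S F"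
    using assms(1) by (auto simp: numeral_2_eq_2 Ck_on_Suc)
  have der: "(G has_derivative (\<lambda>w. pd S w G y)) (at y)" if "Ck_on (Suc k) S G" "y \<in> S" for G :: "'a \<Rightarrow> real" and y k
    using Ck_on_SucE[OF that] unfolding at_within_open[OF that(2) \<open>open S\<close>] .
  have dline: "((\<lambda>s. G (y + s *\<^sub>R u)) has_real_derivative pd S u G (y + s *\<^sub>R u)) (at s)"
    if "Ck_on (Suc k) S G" "y + s *\<^sub>R u \<in> S" for G :: "'a \<Rightarrow> real" and y u s k
  proof -
    have "((\<lambda>s. G (y + s *\<^sub>R u)) has_derivative (\<lambda>r. pd S (r *\<^sub>R u) G (y + s *\<^sub>R u))) (at s)"
      by (rule has_derivative_compose[where f = "\<lambda>s. y + s *\<^sub>R u" and g = G and f' = "\<lambda>r. r *\<^sub>R u",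
            OF _ der[OF that]])
         (auto intro!: derivative_eq_intros)
    moreover have "pd S (r *\<^sub>R u) G (y + s *\<^sub>R u) = pd S u G (y + s *\<^sub>R u) * r" for r
      using linear_scale[OF has_derivative_linear[OF der[OF that]], of r u] by (simp add: mult.commute)
    ultimately show ?thesis by (simp add: has_field_derivative_def)
  qed
  \<comment> \<open>The second difference is the increment, in direction \<open>v\<close>, of the
    first difference in direction \<open>w\<close>. The mean value theorem is applied to it along
    \<open>v\<close>, and afterwards to \<open>pd S v F\<close> along \<open>w\<close>.\<close>
  have "\<exists>s. 0 < s \<and> s < h \<and> (F (x + h *\<^sub>R w + h *\<^sub>R v) - F (x + h *\<^sub>R v)) - (F (x + h *\<^sub>R w + 0 *\<^sub>R v) - F (x + 0 *\<^sub>R v))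
     = (h - 0) * (pd S v F (x + h *\<^sub>R w + s *\<^sub>R v) - pd S v F (x + s *\<^sub>R v))"
    by (intro MVT2 \<open>h > 0\<close> DERIV_diff dline[OF C(2)])
       (use sub[of _ h] sub[of _ 0] \<open>h > 0\<close> in \<open>auto simp: algebra_simps\<close>)
  then obtain s where s: "0 < s" "s < h" "(F (x + h *\<^sub>R w + h *\<^sub>R v) - F (x + h *\<^sub>R v)) - (F (x + h *\<^sub>R w) - F x)
     = h * (pd S v F (x + h *\<^sub>R w + s *\<^sub>R v) - pd S v F (x + s *\<^sub>R v))" by auto
  have "\<exists>t. 0 < t \<and> t < h \<and> pd S v F (x + s *\<^sub>R v + h *\<^sub>R w) - pd S v F (x + s *\<^sub>R v + 0 *\<^sub>R w)
     = (h - 0) * pd S w (pd S v F) (x + s *\<^sub>R v + t *\<^sub>R w)"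
    by (intro MVT2 \<open>h > 0\<close> dline[OF C(1)]) (use sub[of s] s in auto)
  then obtain t where t: "0 < t" "t < h" "pd S v F (x + s *\<^sub>R v + h *\<^sub>R w) - pd S v F (x + s *\<^sub>R v)
     = h * pd S w (pd S v F) (x + s *\<^sub>R v + t *\<^sub>R w)" by auto
  show ?thesis
    using s t by (intro bexI[of _ s] bexI[of _ t]) (auto simp: algebra_simps)
qed

text \<open>The second difference over a parallelogram is symmetric in \<open>v\<close> and
  \<open>w\<close>. By \<open>mixed_increment\<close> it equals h*h times either mixed derivative at
  some point of the parallelogram, and both are continuous at \<open>x\<close>.\<close>

lemma pd_commute_open:
  fixes F :: "'a::euclidean_space \<Rightarrow> real"
  assumes C: "Ck_on 2 S F" and S: "open S" "x \<in> S"
  shows "pd S w (pd S v F) x = pd S v (pd S w F) x"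
proof (rule ccontr)
  let ?A = "pd S w (pd S v F)" and ?B = "pd S v (pd S w F)"
  assume ne: "?A x \<noteq> ?B x"
  define e where "e = \<bar>?A x - ?B x\<bar> / 2"
  have e: "e > 0" using ne by (simp add: e_def)
  have cont: "continuous_on S ?A" "continuous_on S ?B"
    using C by (auto simp: numeral_2_eq_2 Ck_on_Suc)
  then obtain r1 r2 where r: "r1 > 0" "\<And>y. y \<in> S \<Longrightarrow> dist y x < r1 \<Longrightarrow> dist (?A y) (?A x) < e"
     "r2 > 0" "\<And>y. y \<in> S \<Longrightarrow> dist y x < r2 \<Longrightarrow> dist (?B y) (?B x) < e"
    using S(2) e unfolding continuous_on_iff by metis
  obtain r0 where r0: "r0 > 0" "ball x r0 \<subseteq> S" using S by (meson openE)
  define R where "R = min r0 (min r1 r2)"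
  \<comment> \<open>Small enough for the parallelogram to lie within distance \<open>R\<close> of
    \<open>x\<close>, where both mixed derivatives stay within \<open>e\<close>, half their supposed
    gap, of their values at \<open>x\<close>.\<close>
  define h where "h = R / (2 * (norm v + norm w + 1))"
  have R: "R > 0" using r r0 by (simp add: R_def)
  have nn: "norm v + norm w + 1 > 0" by (simp add: add_nonneg_pos)
  have h: "h > 0" using R nn by (simp add: h_def)
  have near: "dist (x + s *\<^sub>R v + t *\<^sub>R w) x < R" if "s \<in> {0..h}" "t \<in> {0..h}" for s t
  proof -
    have "dist (x + s *\<^sub>R v + t *\<^sub>R w) x \<le> s * norm v + t * norm w"
      using that norm_triangle_ineq[of "s *\<^sub>R v" "t *\<^sub>R w"] by (simp add: dist_norm algebra_simps)
    also have "\<dots> \<le> h * norm v + h * norm w"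
      using that by (intro add_mono mult_right_mono) auto
    also have "\<dots> < h * (norm v + norm w + 1) * 2"
      using h nn by (simp add: algebra_simps add_nonneg_pos pos_add_strict)
    also have "\<dots> = R" using nn by (simp add: h_def field_simps)
    finally show ?thesis .
  qed
  have sub: "x + s *\<^sub>R v + t *\<^sub>R w \<in> S" if "s \<in> {0..h}" "t \<in> {0..h}" for s t
    using near[OF that] r0(2) by (auto simp: R_def subset_iff dist_commute)
  have sub': "x + s *\<^sub>R w + t *\<^sub>R v \<in> S" if "s \<in> {0..h}" "t \<in> {0..h}" for s t
    using sub[OF that(2,1)] by (simp add: add_ac)
  obtain s t where st: "s \<in> {0..h}" "t \<in> {0..h}"
    "F (x + h *\<^sub>R v + h *\<^sub>R w) - F (x + h *\<^sub>R v) - F (x + h *\<^sub>R w) + F x = h * h * ?A (x + s *\<^sub>R v + t *\<^sub>R w)"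
    using mixed_increment[OF C S(1) h sub] by blast
  obtain s' t' where st': "s' \<in> {0..h}" "t' \<in> {0..h}"
    "F (x + h *\<^sub>R w + h *\<^sub>R v) - F (x + h *\<^sub>R w) - F (x + h *\<^sub>R v) + F x = h * h * ?B (x + s' *\<^sub>R w + t' *\<^sub>R v)"
    using mixed_increment[OF C S(1) h sub'] by blast
  have "h * h * ?A (x + s *\<^sub>R v + t *\<^sub>R w) = h * h * ?B (x + s' *\<^sub>R w + t' *\<^sub>R v)"
    using st(3) st'(3) by (simp add: add_ac algebra_simps)
  then have eq: "?A (x + s *\<^sub>R v + t *\<^sub>R w) = ?B (x + t' *\<^sub>R v + s' *\<^sub>R w)"
    using h by (simp add: add_ac)
  have "dist (?A (x + s *\<^sub>R v + t *\<^sub>R w)) (?A x) < e"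
    using r(2)[OF sub[OF st(1,2)]] near[OF st(1,2)] by (simp add: R_def)
  moreover have "dist (?B (x + t' *\<^sub>R v + s' *\<^sub>R w)) (?B x) < e"
    using r(4)[OF sub[OF st'(2,1)]] near[OF st'(2,1)] by (simp add: R_def)
  ultimately show False unfolding eq e_def dist_real_def by (simp add: abs_if split: if_splits)
qed

text \<open>Every point of \<open>S\<close>, in particular one at the initial time, is a limit of
  interior points, and both mixed derivatives are continuous on \<open>S\<close>.\<close>

lemma pd_commute:
  fixes F :: "'a::euclidean_space \<Rightarrow> real"
  assumes S: "thick S" "S \<subseteq> closure (interior S)" and C: "Ck_on 2 S F" and x: "x \<in> S"
  shows "pd S w (pd S v F) x = pd S v (pd S w F) x"
proof -
  let ?I = "interior S"
  have I: "?I \<subseteq> S" "open ?I" by (auto simp: interior_subset)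
  have CI: "Ck_on 2 ?I F" using C I Ck_on_subset thick_open by blast
  have pdI: "pd S v G y = pd ?I v G y" if "y \<in> ?I" for G :: "'a \<Rightarrow> real" and v y
    by (simp add: pd_def at_within_interior[OF that] at_within_open[OF that I(2)])
  have "pd S w (pd S v F) y = pd ?I w (pd ?I v F) y" if "y \<in> ?I" for v w y
    using pdI[OF that] pd_cong[of ?I "pd S v F" "pd ?I v F"] pdI that by auto
  then have eqI: "pd S w (pd S v F) y - pd S v (pd S w F) y = 0" if "y \<in> ?I" for y
    using pd_commute_open[OF CI I(2)] that by simp
  have cont: "continuous_on S (\<lambda>y. pd S w (pd S v F) y - pd S v (pd S w F) y)"
    using C by (auto simp: numeral_2_eq_2 Ck_on_Suc intro!: continuous_on_diff)
  obtain y where y: "\<And>n. y n \<in> ?I" "y \<longlonglongrightarrow> x" using S(2) x closure_sequential by (metis subsetD)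
  have "(\<lambda>n. pd S w (pd S v F) (y n) - pd S v (pd S w F) (y n)) \<longlonglongrightarrow> pd S w (pd S v F) x - pd S v (pd S w F) x"
    using continuous_on_tendsto_compose[OF cont y(2) x] y(1) I(1) by (auto simp: eventually_sequentially)
  then show ?thesis using eqI[OF y(1)] LIMSEQ_unique tendsto_const by fastforce
qed

section \<open>Smoothness of the inverse matrix\<close>

lemma Ck_on_sum:
  fixes F :: "'i \<Rightarrow> 'a::euclidean_space \<Rightarrow> real"
  assumes "thick S" "\<And>i. i \<in> I \<Longrightarrow> Ck_on k S (F i)"
  shows "Ck_on k S (\<lambda>x. \<Sum>i\<in>I. F i x)"
  using assms(2)
  by (induction I rule: infinite_finite_induct) (simp_all add: Ck_on_add Ck_on_const assms(1))

lemma Ck_on_prod: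
  fixes F :: "'i \<Rightarrow> 'a::euclidean_space \<Rightarrow> real"
  assumes "thick S" "\<And>i. i \<in> I \<Longrightarrow> Ck_on k S (F i)"
  shows "Ck_on k S (\<lambda>x. \<Prod>i\<in>I. F i x)"
  using assms(2)
  by (induction I rule: infinite_finite_induct) (simp_all add: Ck_on_mult Ck_on_const assms(1))

lemma Ck_on_det:
  fixes G :: "'a::euclidean_space \<Rightarrow> real^'n^'n"
  assumes "thick S" "\<And>i j. Ck_on k S (\<lambda>x. G x $ i $ j)"
  shows "Ck_on k S (\<lambda>x. det (G x))"
  unfolding det_def by (intro Ck_on_sum Ck_on_mult Ck_on_prod Ck_on_const assms)

lemma matrix_inv_works:
  fixes A :: "'a::semiring_1^'n^'m"
  assumes "invertible A"
  shows "A ** matrix_inv A = mat 1" "matrix_inv A ** A = mat 1"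
  using assms someI_ex[of "\<lambda>B. A ** B = mat 1 \<and> B ** A = mat 1"]
  by (auto simp: invertible_def matrix_inv_def)

text \<open>Cramer's rule displays the entries of the inverse as quotients of determinants, from
  which their smoothness is inherited.\<close>

lemma matrix_inv_cramer:
  fixes A :: "real^'n^'n"
  assumes "invertible A"
  shows "matrix_inv A $ k $ l = det (\<chi> i j. if j = k then axis l 1 $ i else A $ i $ j) / det A"
proof -
  have "A *v (matrix_inv A *v axis l 1) = axis l 1"
    using matrix_inv_works[OF assms] by (simp add: matrix_vector_mul_assoc)
  moreover have "det A \<noteq> 0" using assms by (simp add: invertible_det_nz)
  ultimately have "matrix_inv A *v axis l 1 = (\<chi> k. det (\<chi> i j. if j = k then axis l 1 $ i else A $ i $ j) / det A)"
    using cramer by blast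
  then have "(matrix_inv A *v axis l 1) $ k = det (\<chi> i j. if j = k then axis l 1 $ i else A $ i $ j) / det A"
    by simp
  moreover have "(matrix_inv A *v axis l 1) $ k = matrix_inv A $ k $ l"
    by (simp add: matrix_vector_mult_basis column_def)
  ultimately show ?thesis by simp
qed

lemma Ck_on_matrix_inv:
  fixes G :: "'a::euclidean_space \<Rightarrow> real^'n^'n"
  assumes "thick S" "\<And>i j. Ck_on k S (\<lambda>x. G x $ i $ j)" "\<And>x. x \<in> S \<Longrightarrow> invertible (G x)"
  shows "Ck_on k S (\<lambda>x. matrix_inv (G x) $ i $ j)"
proof (rule Ck_on_cong)
  show "det (\<chi> a b. if b = i then axis j 1 $ a else G x $ a $ b) * inverse (det (G x)) = matrix_inv (G x) $ i $ j"
    if "x \<in> S" for x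
    using matrix_inv_cramer[OF assms(3)[OF that], of i j] by (simp add: divide_inverse)
  have "Ck_on k S (\<lambda>x. (\<chi> a b. if b = i then axis j 1 $ a else G x $ a $ b) $ a' $ b')" for a' b'
    using assms(1,2) by (cases "b' = i") (simp_all add: Ck_on_const)
  then show "Ck_on k S (\<lambda>x. det (\<chi> a b. if b = i then axis j 1 $ a else G x $ a $ b) * inverse (det (G x)))"
    using assms by (intro Ck_on_mult Ck_on_det Ck_on_inverse) (auto simp: invertible_det_nz)
qed

definition pos_def :: "real^'n^'n \<Rightarrow> bool" where
  "pos_def B \<longleftrightarrow> transpose B = B \<and> (\<forall>w. w \<noteq> 0 \<longrightarrow> w \<bullet> (B *v w) > 0)"

lemma pos_def_invertible: "pos_def B \<Longrightarrow> invertible B"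
proof -
  assume "pos_def B"
  then have "\<forall>w. B *v w = 0 \<longrightarrow> w = 0" unfolding pos_def_def by (metis inner_zero_right less_irrefl)
  then show ?thesis using matrix_left_invertible_ker invertible_left_inverse by blast
qed

lemma matrix_inv_unique:
  fixes A :: "real^'n^'n"
  assumes "B ** A = mat 1"
  shows "matrix_inv A = B"
proof -
  have "invertible A" using assms invertible_left_inverse by blast
  then have "B = B ** (A ** matrix_inv A)" by (simp add: matrix_inv_works)
  also have "\<dots> = matrix_inv A" by (simp only: matrix_mul_assoc assms matrix_mul_lid)
  finally show ?thesis ..
qed

lemma pos_def_inv_sym: "pos_def B \<Longrightarrow> transpose (matrix_inv B) = matrix_inv B"
proof -
  assume B: "pos_def B"
  then have "transpose (B ** matrix_inv B) = mat 1"
    using matrix_inv_works(1)[OF pos_def_invertible[OF B]] by simp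
  then have "transpose (matrix_inv B) ** B = mat 1"
    using B by (simp add: matrix_transpose_mul pos_def_def)
  then show ?thesis by (rule matrix_inv_unique[symmetric])
qed

text \<open>\<open>None\<close> is the direction of time.\<close>

primrec dir :: "'n::finite option \<Rightarrow> (real^'n) \<times> real" where
  "dir (Some i) = (axis i 1, 0)"
| "dir None = (0, 1)"

section \<open>Jets of smooth functions on a space-time domain\<close>

locale domain =
  fixes U :: "(real^'n::finite) set" and T :: real
  assumes U: "open U" and T: "0 < T"
begin

definition S :: "((real^'n) \<times> real) set" where
  "S = U \<times> {0..<T}"

lemma thick_S: "thick S"
  unfolding S_def by (intro thick_Times thick_open thick_interval U T)

lemma closure_interior_S: "S \<subseteq> closure (interior S)"
proof -
  have "U \<times> {0<..<T} \<subseteq> interior S"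
    by (rule interior_maximal) (auto simp: S_def open_Times U)
  then have "closure (U \<times> {0<..<T}) \<subseteq> closure (interior S)" by (rule closure_mono)
  moreover have "S \<subseteq> closure (U \<times> {0<..<T})"
    using closure_subset[of U] T by (auto simp: S_def closure_Times)
  ultimately show ?thesis by blast
qed

abbreviation sm :: "(real^'n \<Rightarrow> real \<Rightarrow> real) \<Rightarrow> bool" where
  "sm F \<equiv> smooth_on S (case_prod F)"

lemma smooth_Ck: "smooth_on S F \<Longrightarrow> Ck_on k S F" by (simp add: smooth_on_def)

lemma smooth_pd: "smooth_on S F \<Longrightarrow> smooth_on S (pd S w F)"
  unfolding smooth_on_def using Ck_on_Suc by blast

lemma smooth_differentiable: "smooth_on S F \<Longrightarrow> F differentiable_on S"
  unfolding smooth_on_def using Ck_on_Suc by blast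

lemma smooth_cong: "smooth_on S F \<Longrightarrow> (\<And>z. z \<in> S \<Longrightarrow> F z = G z) \<Longrightarrow> smooth_on S G"
  unfolding smooth_on_def using Ck_on_cong[of S F G] by blast

lemma smooth_add: "smooth_on S F \<Longrightarrow> smooth_on S G \<Longrightarrow> smooth_on S (\<lambda>z. F z + G z)"
  unfolding smooth_on_def using Ck_on_add[OF thick_S] by blast

lemma smooth_mult: "smooth_on S F \<Longrightarrow> smooth_on S G \<Longrightarrow> smooth_on S (\<lambda>z. F z * G z :: real)"
  unfolding smooth_on_def using Ck_on_mult[OF thick_S] by blast

lemma smooth_const: "smooth_on S (\<lambda>z. c)"
  unfolding smooth_on_def using Ck_on_const[OF thick_S] by blast

lemma pd_add:
  assumes "smooth_on S F" "smooth_on S G" "z \<in> S"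
  shows "pd S w (\<lambda>z. F z + G z) z = pd S w F z + pd S w G z"
  by (rule pd_eqI[OF thick_S assms(3)])
     (intro has_derivative_add pd_works smooth_differentiable assms)

lemma pd_mult:
  fixes F G :: "_ \<Rightarrow> real"
  assumes "smooth_on S F" "smooth_on S G" "z \<in> S"
  shows "pd S w (\<lambda>z. F z * G z) z = pd S w F z * G z + F z * pd S w G z"
  using pd_eqI[OF thick_S assms(3) has_derivative_mult[OF
      pd_works[OF smooth_differentiable[OF assms(1)] assms(3)]
      pd_works[OF smooth_differentiable[OF assms(2)] assms(3)]], of w]
  by simp

lemma pd_const: "z \<in> S \<Longrightarrow> pd S w (\<lambda>z. c) z = 0"
  by (rule pd_eqI[OF thick_S _ has_derivative_const])

primrec ipd :: "'n option list \<Rightarrow> ((real^'n) \<times> real \<Rightarrow> real) \<Rightarrow> (real^'n) \<times> real \<Rightarrow> real" where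
  "ipd [] F = F"
| "ipd (i # l) F = ipd l (pd S (dir i) F)"

lemma ipd_cong: "(\<And>z. z \<in> S \<Longrightarrow> F z = G z) \<Longrightarrow> z \<in> S \<Longrightarrow> ipd l F z = ipd l G z"
proof (induction l arbitrary: F G)
  case (Cons i l)
  show ?case
    unfolding ipd.simps by (rule Cons.IH) (use Cons.prems in \<open>auto intro: pd_cong\<close>)
qed simp

lemma ipd_append: "ipd (k @ l) F = ipd l (ipd k F)"
  by (induction k arbitrary: F) auto

lemma smooth_ipd: "smooth_on S F \<Longrightarrow> smooth_on S (ipd l F)"
  by (induction l arbitrary: F) (auto intro: smooth_pd)

definition jet :: "(real^'n) \<times> real \<Rightarrow> ((real^'n) \<times> real \<Rightarrow> real) \<Rightarrow> 'n option jet" where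
  "jet z F = Jet (\<lambda>l. ipd l F z)"

lemma jcoeff_jet:
  assumes "smooth_on S F" "z \<in> S"
  shows "jcoeff (jet z F) = (\<lambda>l. ipd l F z)"
proof -
  have "symmetric (\<lambda>l. ipd l F z)"
    unfolding symmetric_def
  proof (intro allI)
    fix xs ys i j
    have "ipd ys (pd S (dir j) (pd S (dir i) (ipd xs F))) z = ipd ys (pd S (dir i) (pd S (dir j) (ipd xs F))) z"
      by (intro ipd_cong pd_commute thick_S closure_interior_S smooth_Ck smooth_ipd assms)
    then show "ipd (xs @ i # j # ys) F z = ipd (xs @ j # i # ys) F z" by (simp add: ipd_append)
  qed
  then show ?thesis unfolding jet_def by (rule jcoeff_Jet)
qed

lemma ipd_add:
  "smooth_on S F \<Longrightarrow> smooth_on S G \<Longrightarrow> z \<in> S \<Longrightarrow> ipd l (\<lambda>z. F z + G z) z = ipd l F z + ipd l G z"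
proof (induction l arbitrary: F G)
  case (Cons i l)
  then show ?case
    using ipd_cong[of "pd S (dir i) (\<lambda>z. F z + G z)" "\<lambda>z. pd S (dir i) F z + pd S (dir i) G z" z l]
    by (simp add: pd_add smooth_pd)
qed simp

lemma ipd_mult:
  "smooth_on S F \<Longrightarrow> smooth_on S G \<Longrightarrow> z \<in> S \<Longrightarrow>
    ipd l (\<lambda>z. F z * G z) z = leibniz l (\<lambda>l. ipd l F z) (\<lambda>l. ipd l G z)"
proof (induction l arbitrary: F G)
  case (Cons i l)
  have sh: "shift i (\<lambda>l. ipd l H z) = (\<lambda>l. ipd l (pd S (dir i) H) z)" for H
    by (simp add: shift_def fun_eq_iff)
  have "ipd (i # l) (\<lambda>z. F z * G z) z = ipd l (\<lambda>z. pd S (dir i) F z * G z + F z * pd S (dir i) G z) z"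
    using Cons.prems by (auto intro!: ipd_cong pd_mult)
  also have "\<dots> = ipd l (\<lambda>z. pd S (dir i) F z * G z) z + ipd l (\<lambda>z. F z * pd S (dir i) G z) z"
    using Cons.prems by (intro ipd_add smooth_mult smooth_pd) auto
  finally show ?case using Cons by (simp add: sh smooth_pd)
qed simp

lemma ipd_const: "z \<in> S \<Longrightarrow> ipd l (\<lambda>z. c) z = (if l = [] then c else 0)"
proof (induction l arbitrary: c)
  case (Cons i l)
  then show ?case using ipd_cong[of "pd S (dir i) (\<lambda>z. c)" "\<lambda>z. 0" z l] by (simp add: pd_const)
qed simp

text \<open>Smoothness is bundled with the jet, so that one rule per operation turns a coordinate
  expression into the corresponding ring expression and settles the differentiability conditions
  along the way.\<close>

definition has_jet :: "(real^'n) \<times> real \<Rightarrow> (real^'n \<Rightarrow> real \<Rightarrow> real) \<Rightarrow> 'n option jet \<Rightarrow> bool" where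
  "has_jet z F a \<longleftrightarrow> z \<in> S \<and> sm F \<and> a = jet z (case_prod F)"

lemma has_jet_iff: "has_jet z F a \<longleftrightarrow> z \<in> S \<and> sm F \<and> (\<forall>l. jcoeff a l = ipd l (case_prod F) z)"
  unfolding has_jet_def by (metis jcoeff_jet jet_eqI)

lemma has_jetI: "sm F \<Longrightarrow> z \<in> S \<Longrightarrow> has_jet z F (jet z (case_prod F))"
  by (simp add: has_jet_def)

lemma has_jet_unique: "has_jet z F a \<Longrightarrow> has_jet z F b \<Longrightarrow> a = b"
  by (simp add: has_jet_def)

lemma has_jet_ev: "has_jet (x, t) F a \<Longrightarrow> ev a = F x t"
  by (simp add: has_jet_iff ev_def)

lemma has_jet_cong:
  assumes "has_jet z F a" "\<And>x t. (x, t) \<in> S \<Longrightarrow> F x t = G x t"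
  shows "has_jet z G a"
  unfolding has_jet_iff
proof (intro conjI allI)
  have e: "case_prod F y = case_prod G y" if "y \<in> S" for y
    using assms(2) that by (cases y) simp
  show "z \<in> S" using assms(1) by (simp add: has_jet_iff)
  show "sm G" using assms(1) e by (auto simp: has_jet_iff intro: smooth_cong)
  show "jcoeff a l = ipd l (case_prod G) z" for l
    using assms(1) ipd_cong[of "case_prod F" "case_prod G" z l, OF e] by (simp add: has_jet_iff)
qed

lemma has_jet_const: "z \<in> S \<Longrightarrow> has_jet z (\<lambda>x t. c) (const_jet c)"
  using smooth_const[of c] ipd_const[of z _ c]
  by (simp add: has_jet_iff jcoeff_const_jet case_prod_unfold)

lemma has_jet_add: "has_jet z F a \<Longrightarrow> has_jet z G b \<Longrightarrow> has_jet z (\<lambda>x t. F x t + G x t) (a + b)"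
  using smooth_add[of "case_prod F" "case_prod G"] ipd_add[of "case_prod F" "case_prod G" z]
  by (simp add: has_jet_iff case_prod_unfold)

lemma has_jet_mult: "has_jet z F a \<Longrightarrow> has_jet z G b \<Longrightarrow> has_jet z (\<lambda>x t. F x t * G x t) (a * b)"
proof -
  assume F: "has_jet z F a" and G: "has_jet z G b"
  then have "jcoeff a = (\<lambda>l. ipd l (case_prod F) z)" "jcoeff b = (\<lambda>l. ipd l (case_prod G) z)"
    by (auto simp: has_jet_iff)
  then show ?thesis
    using F G smooth_mult[of "case_prod F" "case_prod G"] ipd_mult[of "case_prod F" "case_prod G" z]
    by (simp add: has_jet_iff case_prod_unfold jcoeff_mult)
qed

lemma has_jet_one: "z \<in> S \<Longrightarrow> has_jet z (\<lambda>x t. 1) 1"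
  using has_jet_const[of z 1] by (simp add: const_jet_def one_jet_def)

lemma has_jet_zero: "z \<in> S \<Longrightarrow> has_jet z (\<lambda>x t. 0) 0"
  using has_jet_const[of z 0] by (simp add: const_jet_def zero_jet_def if_distrib cong: if_cong)

lemma has_jet_minus: "has_jet z F a \<Longrightarrow> has_jet z (\<lambda>x t. - F x t) (- a)"
proof -
  assume F: "has_jet z F a"
  then have z: "z \<in> S" by (simp add: has_jet_def)
  have H: "has_jet z (\<lambda>x t. - F x t) (const_jet (- 1) * a)"
    using has_jet_mult[OF has_jet_const[OF z, of "- 1"] F] by simp
  \<comment> \<open>The left side is a jet of the zero function, so uniqueness of jets identifies
    multiplication by \<open>const_jet (- 1)\<close> with the negative in the ring.\<close>
  have "const_jet (- 1) * a + a = 0"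
    using has_jet_add[OF H F] has_jet_zero[OF z] by (auto intro: has_jet_unique)
  then have "const_jet (- 1) * a = - a" by (simp add: eq_neg_iff_add_eq_0)
  with H show ?thesis by simp
qed

lemma has_jet_diff: "has_jet z F a \<Longrightarrow> has_jet z G b \<Longrightarrow> has_jet z (\<lambda>x t. F x t - G x t) (a - b)"
  by (drule has_jet_minus[of z G b], drule (1) has_jet_add) simp

lemma has_jet_sum:
  assumes "z \<in> S" "\<And>i. i \<in> I \<Longrightarrow> has_jet z (F i) (a i)"
  shows "has_jet z (\<lambda>x t. \<Sum>i\<in>I. F i x t) (\<Sum>i\<in>I. a i)"
  using assms(2)
  by (induction I rule: infinite_finite_induct) (simp_all add: has_jet_add has_jet_zero assms(1))

lemma has_jet_numeral: "z \<in> S \<Longrightarrow> has_jet z (\<lambda>x t. numeral n) (numeral n)"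
proof -
  assume z: "z \<in> S"
  have "has_jet z (\<lambda>x t. of_nat k) (of_nat k)" for k
    by (induction k) (simp_all add: has_jet_zero z has_jet_add[OF has_jet_one[OF z]])
  from this[of "numeral n"] show ?thesis by simp
qed

lemma has_jet_pd: "has_jet z F a \<Longrightarrow> has_jet z (\<lambda>x t. pd S (dir i) (case_prod F) (x, t)) (jd i a)"
  using smooth_pd[of "case_prod F" "dir i"] by (simp add: has_jet_iff jcoeff_jd shift_def)

text \<open>Composition with the inclusion of a time slice links the space derivative at fixed time
  with the space-time derivative within \<open>S\<close>, also at the initial time.\<close>

lemma coord_deriv_pd:
  assumes "sm F" "x \<in> U" "t \<in> {0..<T}"
  shows "coord_deriv i (\<lambda>y. F y t) x = pd S (axis i 1, 0) (case_prod F) (x, t)"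
proof -
  have "((\<lambda>y. case_prod F (y, t)) has_derivative (\<lambda>w. pd S (w, 0) (case_prod F) (x, t))) (at x within U)"
  proof (rule has_derivative_in_compose[where g = "case_prod F" and f = "\<lambda>y. (y, t)"
        and g' = "\<lambda>w. pd S w (case_prod F) (x, t)"])
    show "((\<lambda>y. (y, t)) has_derivative (\<lambda>w. (w, 0))) (at x within U)"
      by (auto intro!: derivative_eq_intros)
    show "(case_prod F has_derivative (\<lambda>w. pd S w (case_prod F) (x, t))) (at (x, t) within (\<lambda>y. (y, t)) ` U)"
      using assms by (intro has_derivative_subset[OF pd_works[OF smooth_differentiable]]) (auto simp: S_def)
  qed
  then have "((\<lambda>y. F y t) has_derivative (\<lambda>w. pd S (w, 0) (case_prod F) (x, t))) (at x)"
    using at_within_open[OF assms(2) U] by simp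
  then show ?thesis by (simp add: coord_deriv_def frechet_derivative_at[symmetric])
qed

lemma has_jet_coord_deriv:
  assumes "has_jet z F a"
  shows "has_jet z (\<lambda>x t. coord_deriv i (\<lambda>y. F y t) x) (jd (Some i) a)"
  by (rule has_jet_cong[OF has_jet_pd[OF assms]])
     (use assms in \<open>auto simp: has_jet_def S_def coord_deriv_pd\<close>)

lemma time_derivative_pd:
  assumes "sm F" "x \<in> U" "t \<in> {0..<T}"
  shows "((\<lambda>s. F x s) has_real_derivative pd S (0, 1) (case_prod F) (x, t)) (at t within {0..<T})"
proof -
  have xt: "(x, t) \<in> S" using assms by (simp add: S_def)
  note F' = pd_works[OF smooth_differentiable[OF assms(1)] xt]
  have "((\<lambda>s. case_prod F (x, s)) has_derivative (\<lambda>r. pd S (0, r) (case_prod F) (x, t))) (at t within {0..<T})"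
  proof (rule has_derivative_in_compose[where g = "case_prod F" and f = "\<lambda>s. (x, s)"
        and g' = "\<lambda>w. pd S w (case_prod F) (x, t)"])
    show "((\<lambda>s. (x, s)) has_derivative (\<lambda>r. (0, r))) (at t within {0..<T})"
      by (auto intro!: derivative_eq_intros)
    show "(case_prod F has_derivative (\<lambda>w. pd S w (case_prod F) (x, t))) (at (x, t) within (\<lambda>s. (x, s)) ` {0..<T})"
      by (rule has_derivative_subset[OF F']) (use assms in \<open>auto simp: S_def\<close>)
  qed
  moreover have "(\<lambda>r. pd S (0, r) (case_prod F) (x, t)) = (\<lambda>r. pd S (0, 1) (case_prod F) (x, t) * r)"
  proof
    show "pd S (0, r) (case_prod F) (x, t) = pd S (0, 1) (case_prod F) (x, t) * r" for r
      using linear_scale[OF has_derivative_linear[OF F'], of r "(0, 1)"] by (simp add: mult.commute)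
  qed
  ultimately show ?thesis by (simp only: has_field_derivative_def prod.case)
qed

text \<open>This turns an evolution equation into an equation of jets: if it holds on all of
  \<open>S\<close>, its right side has \<open>jd None a\<close> as its entire jet and can be
  differentiated further.\<close>

lemma has_jet_time:
  assumes "has_jet z F a"
    and "\<And>x t. x \<in> U \<Longrightarrow> t \<in> {0..<T} \<Longrightarrow> ((\<lambda>s. F x s) has_real_derivative F' x t) (at t within {0..<T})"
  shows "has_jet z F' (jd None a)"
proof (rule has_jet_cong[OF has_jet_pd[OF assms(1)]])
  fix x t assume "(x, t) \<in> S"
  then have xt: "x \<in> U" "t \<in> {0..<T}" by (auto simp: S_def)
  have "(\<lambda>r. pd S (0, 1) (case_prod F) (x, t) * r) = (\<lambda>r. F' x t * r)"
  proof (rule frechet_derivative_unique_within)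
    show "((\<lambda>s. F x s) has_derivative (\<lambda>r. pd S (0, 1) (case_prod F) (x, t) * r)) (at t within {0..<T})"
      using time_derivative_pd[of F x t] assms(1) xt by (simp add: has_jet_def has_field_derivative_def)
    show "((\<lambda>s. F x s) has_derivative (\<lambda>r. F' x t * r)) (at t within {0..<T})"
      using assms(2)[OF xt] by (simp add: has_field_derivative_def)
  qed (use thick_interval[OF T] xt in \<open>auto simp: thick_def\<close>)
  then show "pd S (dir None) (case_prod F) (x, t) = F' x t"
    by (metis dir.simps(2) mult_1_right)
qed

end

section \<open>Geometry of a metric in coordinates\<close>

lemma metric_norm_raise:
  assumes "pos_def B"
  shows "(metric_norm B (matrix_inv B *v p))\<^sup>2 = (\<Sum>i\<in>UNIV. (\<Sum>j\<in>UNIV. matrix_inv B $ i $ j * p $ j) * p $ i)"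
proof -
  let ?w = "matrix_inv B *v p"
  have Bw: "B *v ?w = p"
    using matrix_inv_works[OF pos_def_invertible[OF assms]] by (simp add: matrix_vector_mul_assoc)
  have "?w \<bullet> (B *v ?w) \<ge> 0"
    using assms unfolding pos_def_def by (cases "?w = 0") (auto simp: less_imp_le)
  then have "(metric_norm B ?w)\<^sup>2 = ?w \<bullet> p"
    unfolding metric_norm_def by (simp add: Bw)
  then show ?thesis by (simp add: inner_vec_def matrix_vector_mult_def)
qed

locale metric_domain = domain U T for U :: "(real^'n::finite) set" and T +
  fixes G :: "real^'n \<Rightarrow> real \<Rightarrow> real^'n^'n"
  assumes sm_G: "sm (\<lambda>x t. G x t $ i $ j)"
    and pos_def_G: "x \<in> U \<Longrightarrow> t \<in> {0..<T} \<Longrightarrow> pos_def (G x t)"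

locale metric_point = metric_domain U T G for U :: "(real^'n::finite) set" and T G +
  fixes z :: "(real^'n) \<times> real"
  assumes z: "z \<in> S"
begin

definition "gj i j = jet z (\<lambda>(x, t). G x t $ i $ j)"
definition "hj i j = jet z (\<lambda>(x, t). matrix_inv (G x t) $ i $ j)"

lemma has_jet_g: "has_jet z (\<lambda>x t. G x t $ i $ j) (gj i j)"
  unfolding gj_def by (rule has_jetI[OF sm_G z])

lemma has_jet_h: "has_jet z (\<lambda>x t. matrix_inv (G x t) $ i $ j) (hj i j)"
  unfolding hj_def
proof (rule has_jetI[OF _ z])
  show "sm (\<lambda>x t. matrix_inv (G x t) $ i $ j)"
    unfolding smooth_on_def case_prod_unfold
  proof
    show "Ck_on k S (\<lambda>p. matrix_inv (G (fst p) (snd p)) $ i $ j)" for k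
      using sm_G pos_def_G
      by (intro Ck_on_matrix_inv thick_S) (auto simp: smooth_on_def case_prod_unfold S_def intro!: pos_def_invertible)
  qed
qed

text \<open>The relations between the metric and its inverse hold on all of \<open>S\<close> and not
  just at \<open>z\<close>; hence \<open>has_jet_unique\<close> carries them over to the
  jets.\<close>

sublocale ring: metric_ring "\<lambda>i. jd (Some i)" "const_jet (1/2)" gj hj
proof
  fix i j :: 'n
  have S: "pos_def (G x t)" if "(x, t) \<in> S" for x t using that pos_def_G by (simp add: S_def)
  show "jd (Some i) (a + b) = jd (Some i) a + jd (Some i) b" for a b by (rule jd_add)
  show "jd (Some i) (a * b) = jd (Some i) a * b + a * jd (Some i) b" for a b by (rule jd_mult)
  show "jd (Some i) (jd (Some j) a) = jd (Some j) (jd (Some i) a)" for a by (rule jd_commute)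
  show "2 * const_jet (1/2) = 1" by (rule twice_half_jet)
  have "transpose (G x t) $ j $ i = G x t $ j $ i" if "(x, t) \<in> S" for x t
    using S[OF that] by (simp add: pos_def_def)
  then show "gj i j = gj j i"
    by (intro has_jet_unique[OF has_jet_cong[OF has_jet_g] has_jet_g]) (simp add: transpose_def)
  have "transpose (matrix_inv (G x t)) $ j $ i = matrix_inv (G x t) $ j $ i" if "(x, t) \<in> S" for x t
    using pos_def_inv_sym[OF S[OF that]] by simp
  then show "hj i j = hj j i"
    by (intro has_jet_unique[OF has_jet_cong[OF has_jet_h] has_jet_h]) (simp add: transpose_def)
  have "has_jet z (\<lambda>x t. if i = j then 1 else 0) (if i = j then 1 else 0)"
    by (simp add: has_jet_one has_jet_zero z)
  moreover have "has_jet z (\<lambda>x t. if i = j then 1 else 0) (\<Uplus>k. gj i k * hj k j)"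
  proof (rule has_jet_cong)
    show "has_jet z (\<lambda>x t. \<Uplus>k. G x t $ i $ k * matrix_inv (G x t) $ k $ j) (\<Uplus>k. gj i k * hj k j)"
      by (intro has_jet_sum has_jet_mult has_jet_g has_jet_h z)
    show "(\<Uplus>k. G x t $ i $ k * matrix_inv (G x t) $ k $ j) = (if i = j then 1 else 0)" if "(x, t) \<in> S" for x t
    proof -
      have "(G x t ** matrix_inv (G x t)) $ i $ j = mat 1 $ i $ j"
        using matrix_inv_works[OF pos_def_invertible[OF S[OF that]]] by simp
      then show ?thesis by (simp add: matrix_matrix_mult_def mat_def)
    qed
  qed
  ultimately show "(\<Uplus>k. gj i k * hj k j) = (if i = j then 1 else 0)" by (rule has_jet_unique[symmetric])
qed

lemma has_jet_christoffel:
  "has_jet z (\<lambda>x t. christoffel (\<lambda>y. G y t) k i j x) (ring.chris k i j)"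
  unfolding christoffel_def ring.chris_def
  by (intro has_jet_mult has_jet_const has_jet_sum has_jet_add has_jet_diff has_jet_coord_deriv has_jet_g
      has_jet_h z)

text \<open>The upper index stands first in \<open>riemann\<close> and third in
  \<open>ring.Riem\<close>, where it is the row of the curvature matrix.\<close>

lemma has_jet_riemann:
  "has_jet z (\<lambda>x t. riemann (\<lambda>y. G y t) l i j k x) (ring.Riem i j l k)"
  unfolding riemann_def ring.Riem_def mm_def ring.conn_def sum_subtractf
  unfolding add_diff_eq
  by (intro has_jet_mult has_jet_sum has_jet_add has_jet_diff has_jet_coord_deriv has_jet_christoffel z)

lemma has_jet_ricci:
  "has_jet z (\<lambda>x t. coord_ricci (\<lambda>y. G y t) x $ j $ k) (ring.Rc j k)"
  unfolding coord_ricci_def ring.Rc_def vec_lambda_beta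
  by (intro has_jet_sum has_jet_riemann z)

lemma has_jet_scalar:
  "has_jet z (\<lambda>x t. coord_scalar (\<lambda>y. G y t) x) (ring.tr ring.Rc)"
  unfolding coord_scalar_def metric_trace_def ring.tr_def
  by (intro has_jet_sum has_jet_mult has_jet_h has_jet_ricci z)

lemma has_jet_hessian:
  assumes "has_jet z u a"
  shows "has_jet z (\<lambda>x t. coord_hessian (\<lambda>y. G y t) (\<lambda>y. u y t) x $ i $ j) (ring.Hess a i j)"
  unfolding coord_hessian_def ring.Hess_def vec_lambda_beta
  by (intro has_jet_diff has_jet_sum has_jet_mult has_jet_coord_deriv has_jet_christoffel assms z)

lemma has_jet_laplacian:
  assumes "has_jet z u a"
  shows "has_jet z (\<lambda>x t. coord_laplacian (\<lambda>y. G y t) (\<lambda>y. u y t) x) (ring.lap a)"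
  unfolding coord_laplacian_def metric_trace_def ring.lap_def ring.tr_def
  by (intro has_jet_sum has_jet_mult has_jet_h has_jet_hessian assms z)

lemma has_jet_gip:
  assumes "has_jet z u a" "has_jet z w b"
  shows "has_jet z (\<lambda>x t. \<Uplus>i. (\<Uplus>j. matrix_inv (G x t) $ i $ j * coord_deriv j (\<lambda>y. u y t) x)
           * coord_deriv i (\<lambda>y. w y t) x) (ring.gip a b)"
  unfolding ring.gip_def ring.grad_def
  by (intro has_jet_sum has_jet_mult has_jet_h has_jet_coord_deriv assms z)

lemma has_jet_gradient_norm:
  assumes "has_jet z u a"
  shows "has_jet z (\<lambda>x t. (metric_norm (G x t) (coord_gradient (\<lambda>y. G y t) (\<lambda>y. u y t) x))\<^sup>2) (ring.sq a)"
  unfolding ring.sq_gip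
  by (rule has_jet_cong[OF has_jet_gip[OF assms assms]])
     (simp add: coord_gradient_def metric_norm_raise pos_def_G S_def)

end

locale flow_domain = metric_domain U T G for U :: "(real^'n::finite) set" and T G +
  assumes flow: "x \<in> U \<Longrightarrow> t \<in> {0..<T} \<Longrightarrow>
    ((\<lambda>s. G x s $ i $ j) has_real_derivative - (2 * coord_ricci (\<lambda>y. G y t) x $ i $ j)) (at t within {0..<T})"

locale flow_point = flow_domain U T G + metric_point U T G z for U :: "(real^'n::finite) set" and T G z
begin

sublocale ring: flow_ring "\<lambda>i. jd (Some i)" "const_jet (1/2)" gj hj "jd None"
proof
  show "jd None (a + b) = jd None a + jd None b" for a b by (rule jd_add)
  show "jd None (a * b) = jd None a * b + a * jd None b" for a b by (rule jd_mult)
  show "jd None (jd (Some i) a) = jd (Some i) (jd None a)" for a i by (rule jd_commute)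
  show "jd None (gj i j) = - (2 * ring.Rc i j)" for i j
    by (rule has_jet_unique[OF has_jet_time[OF has_jet_g flow]])
       (auto intro!: has_jet_minus has_jet_mult has_jet_numeral has_jet_ricci z)
qed

end

section \<open>Positive semidefinite forms and spatial maxima\<close>

text \<open>The quadratic form at \<open>w\<close> plus \<open>c\<close> times the unit vector of
  index \<open>a\<close>, ordered by powers of \<open>c\<close>.\<close>

lemma quadratic_shift:
  fixes K :: "'i::finite \<Rightarrow> 'i \<Rightarrow> real" and w :: "'i \<Rightarrow> real" and a c
  assumes "\<And>i j. K i j = K j i"
  defines "u \<equiv> \<lambda>i. w i + (if i = a then c else 0)"
  shows "(\<Uplus>i j. u i * u j * K i j) = (\<Uplus>i j. w i * w j * K i j) + 2 * c * (\<Uplus>j. w j * K a j) + c * c * K a a"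
proof -
  have pick: "(\<Uplus>j. f j * (if j = a then c else 0) * k j) = f a * c * k a" for f k :: "'i \<Rightarrow> real"
  proof -
    have "(\<Uplus>j. f j * (if j = a then c else 0) * k j) = (\<Uplus>j. if j = a then f a * c * k a else 0)"
      by (intro sum.cong) auto
    then show ?thesis by simp
  qed
  have "(\<Uplus>i j. u i * u j * K i j) = (\<Uplus>i j. w i * w j * K i j) + (\<Uplus>i j. w i * (if j = a then c else 0) * K i j)
      + (\<Uplus>j i. w j * (if i = a then c else 0) * K i j) + (\<Uplus>i j. (if i = a then c else 0) * (if j = a then c else 0) * K i j)"
    by (subst (3) sum.swap) (simp add: u_def algebra_simps sum.distrib)
  also have "(\<Uplus>i j. w i * (if j = a then c else 0) * K i j) = c * (\<Uplus>j. w j * K a j)"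
    unfolding pick by (simp add: sum_distrib_left assms(1)[of _ a] mult_ac)
  also have "(\<Uplus>j i. w j * (if i = a then c else 0) * K i j) = c * (\<Uplus>j. w j * K a j)"
    unfolding pick by (simp add: sum_distrib_left mult_ac)
  also have "(\<Uplus>i j. (if i = a then c else 0) * (if j = a then c else 0) * K i j) = c * c * K a a"
    unfolding pick using pick[of "\<lambda>_. 1" "\<lambda>i. c * K i a"] by (simp add: mult.assoc)
  finally show ?thesis by simp
qed

lemma sum_out: "(\<Sum>i\<in>(UNIV :: 'i::finite set). \<Sum>r<(m::nat). f i r) = (\<Sum>r<m. \<Sum>i\<in>UNIV. f i r)"
  by (rule sum.swap)

text \<open>Completes the square in one variable after the other.\<close>

lemma psd_rank_one_sum:
  fixes K :: "'i::finite \<Rightarrow> 'i \<Rightarrow> real"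
  assumes "finite I" "\<And>i j. K i j = K j i" "\<And>w. (\<Uplus>i j. w i * w j * K i j) \<ge> 0"
    and "\<And>i j. i \<notin> I \<Longrightarrow> K i j = 0"
  shows "\<exists>m y. \<forall>i j. K i j = (\<Sum>r<(m::nat). y r i * y r j)"
  using assms
proof (induction I arbitrary: K rule: finite_induct)
  case empty
  then show ?case by (intro exI[of _ 0]) simp
next
  case (insert a I)
  note sym = insert.prems(1) and psd = insert.prems(2)
  have shift: "(\<Uplus>i j. w i * w j * K i j) + 2 * c * (\<Uplus>j. w j * K a j) + c * c * K a a \<ge> 0" for w c
    using psd[of "\<lambda>i. w i + (if i = a then c else 0)"] unfolding quadratic_shift[of K, OF sym] .
  have aa: "K a a \<ge> 0" using shift[of "\<lambda>_. 0" 1] by simp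
  define w where "w = (\<lambda>j. - K a j)"
  show ?case
  proof (cases "K a a = 0")
    case True
    \<comment> \<open>With K a a = 0 the shifted form is affine in \<open>c\<close> and bounded
      below, so its slope must vanish. The value of \<open>c\<close> used below would lower it to
      -1.\<close>
    have "K a j = 0" for j
    proof (rule ccontr)
      assume "K a j \<noteq> 0"
      let ?w = "\<lambda>i. if i = j then 1 else 0 :: real"
      define q where "q = (\<Uplus>i k. ?w i * ?w k * K i k)"
      have "(\<Uplus>i. ?w i * K a i) = (\<Uplus>i. if i = j then K a j else 0)" by (intro sum.cong) auto
      then have "(\<Uplus>i. ?w i * K a i) = K a j" by simp
      then have "0 \<le> q + 2 * c * K a j" for c
        using shift[of ?w c] True by (simp add: q_def)
      moreover have "2 * (- (q + 1) / (2 * K a j)) * K a j = - (q + 1)" using \<open>K a j \<noteq> 0\<close> by simp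
      ultimately have "0 \<le> q + - (q + 1)" by metis
      then show False by simp
    qed
    then have "K i j = 0" if "i \<notin> I" for i j
      using insert.prems(3)[of i j] that by (cases "i = a") auto
    then show ?thesis using insert.IH[of K] sym psd by blast
  next
    case False
    with aa have pos: "K a a > 0" by simp
    \<comment> \<open>The Schur complement of the entry at \<open>a\<close>: its row
      \<open>a\<close> vanishes, and its value at \<open>w\<close> is the minimum over
      \<open>c\<close> of the shifted form.\<close>
    define L where "L = (\<lambda>i j. K i j - K a i * K a j / K a a)"
    have "\<exists>m y. \<forall>i j. L i j = (\<Sum>r<(m::nat). y r i * y r j)"
    proof (rule insert.IH)
      show "L i j = L j i" for i j by (simp add: L_def sym[of i j] mult.commute)
      show "L i j = 0" if "i \<notin> I" for i j
        using that pos insert.prems(3)[of i] sym[of a i] by (cases "i = a") (auto simp: L_def)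
      fix w :: "'i \<Rightarrow> real"
      let ?s = "\<Uplus>j. w j * K a j"
      have "(\<Uplus>i j. w i * w j * (K a i * K a j / K a a)) = ?s * ?s / K a a"
        by (simp add: sum_product sum_divide_distrib mult_ac)
      then have "(\<Uplus>i j. w i * w j * L i j) = (\<Uplus>i j. w i * w j * K i j) - ?s * ?s / K a a"
        by (simp add: L_def right_diff_distrib sum_subtractf)
      also have "\<dots> = (\<Uplus>i j. w i * w j * K i j) + 2 * (- ?s / K a a) * ?s + (- ?s / K a a) * (- ?s / K a a) * K a a"
        using pos by (simp add: field_simps)
      also have "\<dots> \<ge> 0" by (rule shift)
      finally show "(\<Uplus>i j. w i * w j * L i j) \<ge> 0" .
    qed
    then obtain m y where y: "\<And>i j. L i j = (\<Sum>r<(m::nat). y r i * y r j)" by blast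
    have "K i j = (\<Sum>r<Suc m. (y(m := \<lambda>i. K a i / sqrt (K a a))) r i * (y(m := \<lambda>i. K a i / sqrt (K a a))) r j)" for i j
      using y[of i j] pos by (simp add: L_def)
    then show ?thesis by blast
  qed
qed

text \<open>The vectors \<open>y r\<close> play the part of an orthonormal frame for the metric
  \<open>B\<close>.\<close>

lemma pos_def_inverse_sum:
  fixes B :: "real^'n^'n"
  assumes "pos_def B"
  obtains m y where "\<And>i j. matrix_inv B $ i $ j = (\<Sum>r<(m::nat). y r i * y r j)"
proof -
  let ?K = "\<lambda>i j. matrix_inv B $ i $ j"
  have "(\<Uplus>i j. w i * w j * ?K i j) \<ge> 0" for w
  proof -
    let ?w = "matrix_inv B *v (\<chi> i. w i)"
    have Bw: "B *v ?w = (\<chi> i. w i)"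
      using matrix_inv_works[OF pos_def_invertible[OF assms]] by (simp add: matrix_vector_mul_assoc)
    have "0 \<le> ?w \<bullet> (B *v ?w)"
      using assms unfolding pos_def_def by (cases "?w = 0") (auto simp: less_imp_le)
    also have "\<dots> = (\<Uplus>i j. w i * w j * ?K i j)"
      unfolding Bw by (simp add: inner_vec_def matrix_vector_mult_def sum_distrib_left sum_distrib_right mult_ac)
    finally show ?thesis .
  qed
  moreover have "?K i j = ?K j i" for i j
    using arg_cong[OF pos_def_inv_sym[OF assms], of "\<lambda>M. M $ j $ i"] by (simp add: transpose_def)
  ultimately have "\<exists>m y. \<forall>i j. ?K i j = (\<Sum>r<(m::nat). y r i * y r j)"
    by (intro psd_rank_one_sum[of UNIV]) auto
  then show ?thesis using that by blast
qed

text \<open>Against a sum of rank-one forms the trace becomes a sum of values of the quadratic form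
  \<open>M\<close>.\<close>

lemma trace_nonpos:
  fixes B :: "real^'n^'n"
  assumes "pos_def B" "\<And>w. (\<Uplus>i j. w i * w j * M i j) \<le> 0"
  shows "(\<Uplus>i j. matrix_inv B $ i $ j * M i j) \<le> 0"
proof -
  obtain m y where y: "\<And>i j. matrix_inv B $ i $ j = (\<Sum>r<(m::nat). y r i * y r j)"
    using pos_def_inverse_sum[OF assms(1)] by metis
  have "(\<Uplus>i j. matrix_inv B $ i $ j * M i j) = (\<Uplus>i j. \<Sum>r<m. y r i * y r j * M i j)"
    by (simp add: y sum_distrib_right)
  also have "\<dots> = (\<Sum>r<m. \<Uplus>i j. y r i * y r j * M i j)"
    by (simp add: sum_out)
  also have "\<dots> \<le> 0" by (intro sum_nonpos assms(2))
  finally show ?thesis .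
qed

text \<open>In terms of the vectors \<open>y r\<close> the expression is the sum of the squares of
  the components of \<open>X\<close>.\<close>

lemma norm_square_nonneg:
  fixes B :: "real^'n^'n" and X :: "'n \<Rightarrow> 'n \<Rightarrow> real"
  assumes "pos_def B"
  defines "h \<equiv> \<lambda>i j. matrix_inv B $ i $ j"
  shows "0 \<le> (\<Uplus>i j. mm h (mm X h) i j * X i j)"
proof -
  obtain m y where y: "\<And>i j. h i j = (\<Sum>r<(m::nat). y r i * y r j)"
    unfolding h_def using pos_def_inverse_sum[OF assms(1)] by metis
  have "(\<Uplus>i j. mm h (mm X h) i j * X i j) = (\<Uplus>i j. \<Uplus>k l. \<Sum>q<m. \<Sum>r<m. (y r k * X k l * y q l) * (y r i * X i j * y q j))"
    by (simp add: mm_def y sum_distrib_left sum_distrib_right mult_ac)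
  also have "\<dots> = (\<Sum>q<m. \<Sum>r<m. \<Uplus>i j. \<Uplus>k l. (y r k * X k l * y q l) * (y r i * X i j * y q j))"
    by (simp add: sum_out)
  also have "\<dots> = (\<Sum>q<m. \<Sum>r<m. (\<Uplus>k l. y r k * X k l * y q l) * (\<Uplus>k l. y r k * X k l * y q l))"
    by (intro sum.cong refl) (simp add: sum_distrib_left sum_distrib_right)
  also have "\<dots> \<ge> 0" by (intro sum_nonneg) simp
  finally show ?thesis .
qed

section \<open>First and second derivatives at a spatial maximum\<close>

context domain begin

lemma line_derivative:
  assumes F: "sm F" and t: "t \<in> {0..<T}" and x: "x + s *\<^sub>R w \<in> U"
  shows "((\<lambda>s. F (x + s *\<^sub>R w) t) has_real_derivative
     (\<Sum>j\<in>UNIV. w $ j * coord_deriv j (\<lambda>y. F y t) (x + s *\<^sub>R w))) (at s)"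
proof -
  let ?y = "x + s *\<^sub>R w"
  let ?D = "\<lambda>v. pd S v (case_prod F) (?y, t)"
  have D: "((\<lambda>s. case_prod F (x + s *\<^sub>R w, t)) has_derivative (\<lambda>r. ?D (r *\<^sub>R w, 0))) (at s within {s. x + s *\<^sub>R w \<in> U})"
  proof (rule has_derivative_in_compose[where g = "case_prod F" and f = "\<lambda>s. (x + s *\<^sub>R w, t)" and g' = ?D])
    show "((\<lambda>s. (x + s *\<^sub>R w, t)) has_derivative (\<lambda>r. (r *\<^sub>R w, 0))) (at s within {s. x + s *\<^sub>R w \<in> U})"
      by (auto intro!: derivative_eq_intros)
    show "(case_prod F has_derivative ?D) (at (?y, t) within (\<lambda>s. (x + s *\<^sub>R w, t)) ` {s. x + s *\<^sub>R w \<in> U})"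
      using assms by (intro has_derivative_subset[OF pd_works[OF smooth_differentiable]]) (auto simp: S_def)
  qed
  have "open {s. x + s *\<^sub>R w \<in> U}"
    using open_vimage[OF U, of "\<lambda>s. x + s *\<^sub>R w"] by (simp add: vimage_def continuous_intros)
  then have D': "((\<lambda>s. F (x + s *\<^sub>R w) t) has_derivative (\<lambda>r. ?D (r *\<^sub>R w, 0))) (at s)"
    using D x at_within_open[of s "{s. x + s *\<^sub>R w \<in> U}"] by simp
  have lin: "linear ?D"
    using assms by (intro has_derivative_linear[OF pd_works[OF smooth_differentiable]]) (auto simp: S_def)
  have "?D (r *\<^sub>R w, 0) = (\<Sum>j\<in>UNIV. w $ j * coord_deriv j (\<lambda>y. F y t) ?y) * r" for r
  proof -
    have "(r *\<^sub>R w, 0) = (\<Sum>j\<in>UNIV. (r * w $ j) *\<^sub>R (axis j 1, 0::real))"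
    proof -
      have "r *\<^sub>R w = (\<Sum>j\<in>UNIV. (r * w $ j) *\<^sub>R axis j 1)"
        using basis_expansion[of "r *\<^sub>R w"] by (simp add: scalar_mult_eq_scaleR)
      then show ?thesis by (simp add: prod_eq_iff fst_sum snd_sum)
    qed
    then have "?D (r *\<^sub>R w, 0) = (\<Sum>j\<in>UNIV. (r * w $ j) *\<^sub>R ?D (axis j 1, 0))"
      by (simp only: linear_sum[OF lin] linear_scale[OF lin])
    then show ?thesis
      using coord_deriv_pd[OF F x t] by (simp add: sum_distrib_left sum_distrib_right mult_ac)
  qed
  then show ?thesis using D' by (simp add: has_field_derivative_def)
qed

text \<open>Both claims reduce to one variable by restriction to lines through \<open>x\<close>. A
  positive second derivative would make the derivative \<open>\<psi>\<close> positive just after 0,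
  and the mean value theorem would give a value above the maximum.\<close>

lemma local_max_derivatives:
  assumes F: "sm F" and t: "t \<in> {0..<T}" and x: "x \<in> U"
    and max: "\<And>y. y \<in> U \<Longrightarrow> F y t \<le> F x t"
  shows "coord_deriv i (\<lambda>y. F y t) x = 0"
    and "(\<Uplus>i j. w i * w j * coord_deriv i (coord_deriv j (\<lambda>y. F y t)) x) \<le> 0"
proof -
  obtain e where e: "e > 0" "ball x e \<subseteq> U" using U x by (meson openE)
  have near: "\<exists>\<delta>>0. \<forall>s. \<bar>s\<bar> < \<delta> \<longrightarrow> x + s *\<^sub>R v \<in> U" for v
  proof (intro exI[of _ "e / (norm v + 1)"] conjI allI impI)
    show "0 < e / (norm v + 1)" using e by (simp add: add_nonneg_pos)
    fix s assume "\<bar>s\<bar> < e / (norm v + 1)"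
    then have "\<bar>s\<bar> * (norm v + 1) < e" by (subst (asm) pos_less_divide_eq) (auto simp: add_nonneg_pos)
    moreover have "\<bar>s\<bar> * norm v \<le> \<bar>s\<bar> * (norm v + 1)" by (simp add: mult_left_mono)
    ultimately have "x + s *\<^sub>R v \<in> ball x e" by (simp add: dist_norm)
    then show "x + s *\<^sub>R v \<in> U" using e by blast
  qed
  have first: "(\<Sum>j\<in>UNIV. v $ j * coord_deriv j (\<lambda>y. F y t) x) = 0" for v
  proof -
    obtain \<delta> where \<delta>: "\<delta> > 0" "\<And>s. \<bar>s\<bar> < \<delta> \<Longrightarrow> x + s *\<^sub>R v \<in> U" using near[of v] by blast
    have "((\<lambda>s. F (x + s *\<^sub>R v) t) has_real_derivative (\<Sum>j\<in>UNIV. v $ j * coord_deriv j (\<lambda>y. F y t) x)) (at 0)"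
      using line_derivative[OF F t, of x 0 v] x by simp
    then show ?thesis
      by (rule DERIV_local_max[OF _ \<delta>(1)]) (use max \<delta>(2) in auto)
  qed
  show "coord_deriv i (\<lambda>y. F y t) x = 0"
    using first[of "axis i 1"] by (simp add: axis_def if_distrib[of "\<lambda>x. x * _"] cong: if_cong)
  define v :: "real^'n" where "v = (\<chi> i. w i)"
  obtain \<delta> where \<delta>: "\<delta> > 0" "\<And>s. \<bar>s\<bar> < \<delta> \<Longrightarrow> x + s *\<^sub>R v \<in> U" using near[of v] by blast
  define \<psi> where "\<psi> = (\<lambda>s. \<Sum>j\<in>UNIV. v $ j * coord_deriv j (\<lambda>y. F y t) (x + s *\<^sub>R v))"
  have d1: "((\<lambda>s. F (x + s *\<^sub>R v) t) has_real_derivative \<psi> s) (at s)" if "\<bar>s\<bar> < \<delta>" for s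
    unfolding \<psi>_def by (rule line_derivative[OF F t \<delta>(2)[OF that]])
  have sm': "sm (\<lambda>x t. coord_deriv j (\<lambda>y. F y t) x)" for j
    using has_jet_coord_deriv[OF has_jetI[OF F, of "(x, t)"]] x t by (simp add: has_jet_def S_def)
  let ?Q = "\<Uplus>i j. w i * w j * coord_deriv i (coord_deriv j (\<lambda>y. F y t)) x"
  have "((\<lambda>s. coord_deriv j (\<lambda>y. F y t) (x + s *\<^sub>R v)) has_real_derivative
      (\<Sum>i\<in>UNIV. v $ i * coord_deriv i (coord_deriv j (\<lambda>y. F y t)) x)) (at 0)" for j
    using line_derivative[OF sm'[of j] t, of x 0 v] x by simp
  then have "(\<psi> has_real_derivative (\<Sum>j\<in>UNIV. v $ j * (\<Sum>i\<in>UNIV. v $ i * coord_deriv i (coord_deriv j (\<lambda>y. F y t)) x))) (at 0)"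
    unfolding \<psi>_def by (intro DERIV_sum DERIV_cmult)
  moreover have "(\<Sum>j\<in>UNIV. v $ j * (\<Sum>i\<in>UNIV. v $ i * coord_deriv i (coord_deriv j (\<lambda>y. F y t)) x)) = ?Q"
    by (subst sum.swap) (simp add: v_def sum_distrib_left mult_ac)
  ultimately have d2: "(\<psi> has_real_derivative ?Q) (at 0)" by simp
  show "?Q \<le> 0"
  proof (rule ccontr)
    assume "\<not> ?Q \<le> 0"
    then obtain d where d: "d > 0" "\<And>s. 0 < s \<Longrightarrow> s < d \<Longrightarrow> \<psi> 0 < \<psi> (0 + s)"
      using DERIV_pos_inc_right[OF d2] by auto
    have \<psi>0: "\<psi> 0 = 0" using first[of v] by (simp add: \<psi>_def)
    define b where "b = min d \<delta> / 2"
    have b: "0 < b" "b < d" "b < \<delta>" using d \<delta> by (auto simp: b_def min_def)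
    have "\<exists>s. 0 < s \<and> s < b \<and> F (x + b *\<^sub>R v) t - F (x + 0 *\<^sub>R v) t = (b - 0) * \<psi> s"
      using b by (intro MVT2 d1) auto
    then obtain s where s: "0 < s" "s < b" "F (x + b *\<^sub>R v) t - F x t = b * \<psi> s" by auto
    have "b * \<psi> s > 0" using d(2)[of s] s b \<psi>0 by simp
    moreover have "F (x + b *\<^sub>R v) t \<le> F x t" using max \<delta>(2)[of b] b by simp
    ultimately show False using s(3) by simp
  qed
qed

end

section \<open>The evolution equation in a chart\<close>

lemma Ck_on_bounded_linear:
  assumes "thick S" "bounded_linear L"
  shows "Ck_on k S L"
proof (cases k)
  case 0
  then show ?thesis using linear_continuous_on[OF assms(2)] by simp
next
  case (Suc m)
  show ?thesis
    unfolding Suc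
    by (rule Ck_on_SucI[OF assms(1) bounded_linear_imp_has_derivative[OF assms(2)] Ck_on_const[OF assms(1)]])
qed

text \<open>The hypothesis is the chain rule for a = exp(-b), stated as a relation between
  derivatives because the ring has no exponential function.\<close>

lemma (in metric_ring) lap_log:
  assumes "\<And>i. d i a = - (a * d i b)"
  shows "lap a = a * (sq b - lap b)"
proof -
  have "Hess a i j = a * (d i b * d j b) - a * Hess b i j" for i j
    by (simp add: Hess_def assms d.minus d.mult algebra_simps sum_negf sum_distrib_left)
  then have "lap a = a * (\<Uplus>i j. h i j * (d i b * d j b)) - a * lap b"
    by (simp add: lap_def tr_def right_diff_distrib sum_subtractf sum_distrib_left mult.left_commute)
  also have "(\<Uplus>i j. h i j * (d i b * d j b)) = sq b"
    by (simp add: sq_def grad_def sum_distrib_left sum_distrib_right mult_ac)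
  finally show ?thesis by (simp add: right_diff_distrib)
qed

locale heat_domain = flow_domain U T G for U :: "(real^'n::finite) set" and T G +
  fixes f :: "real^'n \<Rightarrow> real \<Rightarrow> real"
  assumes sm_f: "sm f"
    and f_pos: "x \<in> U \<Longrightarrow> t \<in> {0..<T} \<Longrightarrow> f x t > 0"
    and heat: "x \<in> U \<Longrightarrow> t \<in> {0..<T} \<Longrightarrow>
      ((\<lambda>s. f x s) has_real_derivative
         - coord_laplacian (\<lambda>y. G y t) (\<lambda>y. f y t) x + coord_scalar (\<lambda>y. G y t) x * f x t) (at t within {0..<T})"
begin

definition v :: "real^'n \<Rightarrow> real \<Rightarrow> real" where
  "v x t = - ln (f x t) - real CARD('n) / 2 * ln (4 * pi * (T - t))"

definition P :: "real^'n \<Rightarrow> real \<Rightarrow> real" where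
  "P x t = 2 * coord_laplacian (\<lambda>y. G y t) (\<lambda>y. v y t) x
     - (metric_norm (G x t) (coord_gradient (\<lambda>y. G y t) (\<lambda>y. v y t) x))\<^sup>2 + coord_scalar (\<lambda>y. G y t) x"

lemma smooth_time: "smooth_on S (\<lambda>z. T - snd z)"
proof -
  have "smooth_on S (\<lambda>z :: (real^'n) \<times> real. - snd z)"
    unfolding smooth_on_def by (intro allI Ck_on_bounded_linear thick_S bounded_linear_minus bounded_linear_snd)
  from smooth_add[OF smooth_const[of T] this] show ?thesis by simp
qed

lemma smooth_ln: "smooth_on S F \<Longrightarrow> (\<And>z. z \<in> S \<Longrightarrow> F z > 0) \<Longrightarrow> smooth_on S (\<lambda>z. ln (F z :: real))"
  unfolding smooth_on_def using Ck_on_ln[OF thick_S] by blast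

lemma smooth_inverse: "smooth_on S F \<Longrightarrow> (\<And>z. z \<in> S \<Longrightarrow> F z \<noteq> 0) \<Longrightarrow> smooth_on S (\<lambda>z. inverse (F z) :: real)"
  unfolding smooth_on_def using Ck_on_inverse[OF thick_S] by blast

lemma sm_v: "sm v"
proof -
  have "smooth_on S (\<lambda>z. (- 1) * ln (case_prod f z) + (- (real CARD('n) / 2)) * ln (4 * pi * (T - snd z)))"
    by (intro smooth_add smooth_mult smooth_const smooth_ln smooth_time sm_f) (auto simp: S_def f_pos)
  then show ?thesis by (simp add: v_def[abs_def] case_prod_unfold)
qed

lemma pd_v:
  assumes "(x, t) \<in> S"
  shows "pd S w (case_prod v) (x, t) = - (pd S w (case_prod f) (x, t) / f x t) + real CARD('n) / (2 * (T - t)) * snd w"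
proof (rule pd_eqI[OF thick_S assms, of _ "\<lambda>w. - (pd S w (case_prod f) (x, t) / f x t) + real CARD('n) / (2 * (T - t)) * snd w"])
  note f' = pd_works[OF smooth_differentiable[OF sm_f] assms]
  have pos: "f x t > 0" "T - t > 0" using assms f_pos by (auto simp: S_def)
  have "((\<lambda>z. - ln (case_prod f z) - real CARD('n) / 2 * ln (4 * pi * (T - snd z))) has_derivative
     (\<lambda>w. - (pd S w (case_prod f) (x, t) * inverse (case_prod f (x, t)))
        - real CARD('n) / 2 * ((4 * pi * (0 - snd w)) * inverse (4 * pi * (T - snd (x, t)))))) (at (x, t) within S)"
    by (intro has_derivative_diff has_derivative_minus has_derivative_mult_right
        DERIV_compose_FDERIV[OF DERIV_ln] f' has_derivative_const has_derivative_snd has_derivative_ident)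
       (use pos in auto)
  moreover have "(\<lambda>w. - (pd S w (case_prod f) (x, t) * inverse (case_prod f (x, t)))
        - real CARD('n) / 2 * ((4 * pi * (0 - snd w)) * inverse (4 * pi * (T - snd (x, t)))))
     = (\<lambda>w. - (pd S w (case_prod f) (x, t) / f x t) + real CARD('n) / (2 * (T - t)) * snd w)"
    using pos by (simp add: fun_eq_iff divide_simps)
  ultimately have "((\<lambda>z. - ln (case_prod f z) - real CARD('n) / 2 * ln (4 * pi * (T - snd z))) has_derivative
     (\<lambda>w. - (pd S w (case_prod f) (x, t) / f x t) + real CARD('n) / (2 * (T - t)) * snd w)) (at (x, t) within S)"
    by (simp only:)
  then show "(case_prod v has_derivative
     (\<lambda>w. - (pd S w (case_prod f) (x, t) / f x t) + real CARD('n) / (2 * (T - t)) * snd w)) (at (x, t) within S)"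
    by (simp add: v_def[abs_def] case_prod_unfold)
qed

lemma coord_deriv_f:
  assumes "x \<in> U" "t \<in> {0..<T}"
  shows "coord_deriv i (\<lambda>y. f y t) x = - (f x t * coord_deriv i (\<lambda>y. v y t) x)"
  using assms f_pos[OF assms] pd_v[of x t]
  by (simp add: coord_deriv_pd[OF sm_f assms] coord_deriv_pd[OF sm_v assms] S_def)

text \<open>The time derivative of the normalising term -(n/2) log(4 pi (T - t)) of
  \<open>v\<close>.\<close>

definition c :: "real^'n \<Rightarrow> real \<Rightarrow> real" where
  "c x t = real CARD('n) / (2 * (T - t))"

lemma sm_c: "sm c"
proof -
  have "smooth_on S (\<lambda>z. real CARD('n) / 2 * inverse (T - snd z))"
    by (intro smooth_mult smooth_const smooth_inverse smooth_time) (auto simp: S_def)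
  moreover have "case_prod c = (\<lambda>z. real CARD('n) / 2 * inverse (T - snd z))"
    by (rule ext) (simp add: c_def case_prod_unfold inverse_eq_divide)
  ultimately show ?thesis by (simp only:)
qed

end

locale heat_point = heat_domain U T G f + flow_point U T G z for U :: "(real^'n::finite) set" and T G f z
begin

definition "fj = jet z (case_prod f)"
definition "vj = jet z (case_prod v)"
definition "cj = jet z (case_prod c)"

lemma has_jet_f: "has_jet z f fj" unfolding fj_def by (rule has_jetI[OF sm_f z])
lemma has_jet_v: "has_jet z v vj" unfolding vj_def by (rule has_jetI[OF sm_v z])
lemma has_jet_c: "has_jet z c cj" unfolding cj_def by (rule has_jetI[OF sm_c z])

lemma d_fj: "jd (Some i) fj = - (fj * jd (Some i) vj)"
proof (rule has_jet_unique[OF has_jet_coord_deriv[OF has_jet_f]])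
  show "has_jet z (\<lambda>x t. coord_deriv i (\<lambda>y. f y t) x) (- (fj * jd (Some i) vj))"
    by (rule has_jet_cong[OF has_jet_minus[OF has_jet_mult[OF has_jet_f has_jet_coord_deriv[OF has_jet_v]]]])
       (simp add: coord_deriv_f S_def)
qed

lemma d_cj: "jd (Some i) cj = 0"
proof (rule has_jet_unique[OF has_jet_coord_deriv[OF has_jet_c]])
  show "has_jet z (\<lambda>x t. coord_deriv i (\<lambda>y. c y t) x) 0"
    by (rule has_jet_cong[OF has_jet_zero[OF z]]) (simp add: coord_deriv_def c_def)
qed

lemma lap_fj: "ring.lap fj = fj * (ring.sq vj - ring.lap vj)"
  by (rule ring.lap_log[OF d_fj])

lemma has_jet_P: "has_jet z P (2 * ring.lap vj - ring.sq vj + ring.tr ring.Rc)"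
  unfolding P_def[abs_def]
  by (intro has_jet_add has_jet_diff has_jet_mult has_jet_numeral has_jet_laplacian has_jet_gradient_norm
      has_jet_scalar has_jet_v z)

end

context heat_domain begin

lemma heat_pointI: "z \<in> S \<Longrightarrow> heat_point U T G f z"
  by unfold_locales

lemma laplacian_f:
  assumes "(x, t) \<in> S"
  shows "coord_laplacian (\<lambda>y. G y t) (\<lambda>y. f y t) x = f x t *
    ((metric_norm (G x t) (coord_gradient (\<lambda>y. G y t) (\<lambda>y. v y t) x))\<^sup>2 - coord_laplacian (\<lambda>y. G y t) (\<lambda>y. v y t) x)"
proof -
  interpret heat_point U T G f "(x, t)" by (rule heat_pointI[OF assms])
  show ?thesis
    using arg_cong[OF lap_fj, of ev] has_jet_ev[OF has_jet_f] has_jet_ev[OF has_jet_laplacian[OF has_jet_f]]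
      has_jet_ev[OF has_jet_laplacian[OF has_jet_v]] has_jet_ev[OF has_jet_gradient_norm[OF has_jet_v]]
    by simp
qed

text \<open>Divide the conjugate heat equation by \<open>-f\<close> and rewrite its Laplacian term
  by \<open>laplacian_f\<close>; the last summand comes from the normalisation of
  \<open>v\<close>.\<close>

lemma v_time:
  assumes "x \<in> U" "t \<in> {0..<T}"
  shows "((\<lambda>s. v x s) has_real_derivative
    (metric_norm (G x t) (coord_gradient (\<lambda>y. G y t) (\<lambda>y. v y t) x))\<^sup>2 - coord_laplacian (\<lambda>y. G y t) (\<lambda>y. v y t) x
     - coord_scalar (\<lambda>y. G y t) x + c x t) (at t within {0..<T})"
proof -
  have xt: "(x, t) \<in> S" using assms by (simp add: S_def)
  interpret heat_point U T G f "(x, t)" by (rule heat_pointI[OF xt])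
  have "pd S (0, 1) (case_prod f) (x, t)
      = - coord_laplacian (\<lambda>y. G y t) (\<lambda>y. f y t) x + coord_scalar (\<lambda>y. G y t) x * f x t"
    using has_jet_ev[OF has_jet_pd[OF has_jet_f, of None]] has_jet_ev[OF has_jet_time[OF has_jet_f heat]] by simp
  then have e: "pd S (0, 1) (case_prod f) (x, t) / f x t = coord_laplacian (\<lambda>y. G y t) (\<lambda>y. v y t) x
     - (metric_norm (G x t) (coord_gradient (\<lambda>y. G y t) (\<lambda>y. v y t) x))\<^sup>2 + coord_scalar (\<lambda>y. G y t) x"
    using f_pos[OF assms] unfolding laplacian_f[OF xt] by (simp add: field_simps)
  then show ?thesis
    using time_derivative_pd[OF sm_v assms] unfolding pd_v[OF xt] e by (simp add: c_def algebra_simps)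
qed

text \<open>Smoothness is extracted from a jet, and a jet needs a base point; the empty domain is
  therefore treated separately.\<close>

lemma sm_P: "sm P"
proof (cases "S = {}")
  case True
  have "Ck_on k {} F" for k and F :: "(real^'n) \<times> real \<Rightarrow> real"
    by (induction k arbitrary: F) (auto simp: Ck_on_Suc differentiable_on_def)
  with True show ?thesis by (simp add: smooth_on_def)
next
  case False
  then obtain z where "z \<in> S" by blast
  then interpret heat_point U T G f z by (rule heat_pointI)
  show ?thesis using has_jet_P by (simp add: has_jet_def)
qed

lemma P_time_derivative_nonneg:
  assumes x: "x \<in> U" and t: "t \<in> {0..<T}" and max: "\<And>y. y \<in> U \<Longrightarrow> P y t \<le> P x t"
  shows "\<exists>D\<ge>0. ((\<lambda>s. P x s) has_real_derivative D) (at t within {0..<T})"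
proof -
  have xt: "(x, t) \<in> S" using x t by (simp add: S_def)
  interpret heat_point U T G f "(x, t)" by (rule heat_pointI[OF xt])
  let ?P = "2 * ring.lap vj - ring.sq vj + ring.tr ring.Rc"
  let ?X = "\<lambda>i j. ring.Rc i j + ring.Hess vj i j"
  let ?G = "\<lambda>y. G y t"
  have "jd None vj = ring.sq vj - ring.lap vj - ring.tr ring.Rc + cj"
    by (rule has_jet_unique[OF has_jet_time[OF has_jet_v v_time]])
       (assumption | intro has_jet_add has_jet_diff has_jet_laplacian has_jet_gradient_norm has_jet_scalar
          has_jet_v has_jet_c)+
  from arg_cong[OF ring.evolution[OF this d_cj], of ev]
  have ev: "ev (jd None ?P) = 2 * ev (ring.ip ?X ?X) + 2 * (\<Uplus>i. ev (ring.grad vj i) * ev (jd (Some i) ?P)) - ev (ring.lap ?P)"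
    by simp
  have "ev (jd (Some i) ?P) = coord_deriv i (\<lambda>y. P y t) x" for i
    by (rule has_jet_ev[OF has_jet_coord_deriv[OF has_jet_P]])
  then have d0: "ev (jd (Some i) ?P) = 0" for i
    using local_max_derivatives(1)[OF sm_P t x max] by simp
  have "ev (ring.lap ?P) = coord_laplacian ?G (\<lambda>y. P y t) x"
    by (rule has_jet_ev[OF has_jet_laplacian[OF has_jet_P]])
  \<comment> \<open>At a critical point the Christoffel terms of the Hessian vanish.\<close>
  also have "\<dots> = (\<Uplus>i j. matrix_inv (G x t) $ i $ j * coord_deriv i (coord_deriv j (\<lambda>y. P y t)) x)"
    using local_max_derivatives(1)[OF sm_P t x max]
    by (simp add: coord_laplacian_def metric_trace_def coord_hessian_def)
  also have "\<dots> \<le> 0"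
    by (intro trace_nonpos pos_def_G x t local_max_derivatives(2)[OF sm_P t x max])
  finally have lap: "ev (ring.lap ?P) \<le> 0" .
  have "ev (hj i j) = matrix_inv (G x t) $ i $ j" for i j by (rule has_jet_ev[OF has_jet_h])
  then have "ev (ring.ip ?X ?X) \<ge> 0"
    using norm_square_nonneg[OF pos_def_G[OF x t], of "\<lambda>i j. ev (?X i j)"]
    by (simp add: ring.ip_def mm_def)
  then have "ev (jd None ?P) \<ge> 0" unfolding ev d0 using lap by simp
  moreover have "ev (jd None ?P) = pd S (0, 1) (case_prod P) (x, t)"
    using has_jet_ev[OF has_jet_pd[OF has_jet_P, of None]] by simp
  ultimately show ?thesis using time_derivative_pd[OF sm_P x t] by auto
qed

end

section \<open>Change of coordinates\<close>

text \<open>A vector in the kernel of \<open>J\<close> would be annihilated by the positive definite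
  \<open>B\<close>. The tensor law itself thus makes the Jacobian of a transition
  invertible.\<close>

lemma transform_invertible:
  fixes B B' J :: "real^'n^'n"
  assumes "pos_def B" "B = transpose J ** B' ** J"
  shows "invertible J" "invertible (transpose J)"
proof -
  have "w = 0" if "J *v w = 0" for w
  proof -
    have "B *v w = 0" unfolding assms(2) by (simp add: that flip: matrix_vector_mul_assoc)
    then show ?thesis using assms(1) unfolding pos_def_def by (metis inner_zero_right less_irrefl)
  qed
  then show "invertible J" using matrix_left_invertible_ker invertible_left_inverse by blast
  then show "invertible (transpose J)" by (simp add: invertible_det_nz)
qed

text \<open>The endomorphisms obtained from \<open>M\<close> and \<open>M'\<close> by raising an
  index are conjugate under \<open>J\<close>, so their traces agree.\<close>

lemma metric_trace_transform:
  fixes B B' J M :: "real^'n^'n"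
  assumes B: "pos_def B" "pos_def B'" and e: "B = transpose J ** B' ** J" "M = transpose J ** M' ** J"
  shows "metric_trace B M = metric_trace B' M'"
proof -
  have tr: "metric_trace C N = trace (matrix_inv C ** N)" if "pos_def C" for C N :: "real^'n^'n"
  proof -
    have "matrix_inv C $ i $ j = matrix_inv C $ j $ i" for i j
      using arg_cong[OF pos_def_inv_sym[OF that], of "\<lambda>M. M $ j $ i"] by (simp add: transpose_def)
    then have "metric_trace C N = (\<Sum>i\<in>UNIV. \<Sum>j\<in>UNIV. matrix_inv C $ j $ i * N $ i $ j)"
      by (simp add: metric_trace_def)
    also have "\<dots> = trace (matrix_inv C ** N)"
      by (subst sum.swap) (simp add: trace_def matrix_matrix_mult_def)
    finally show ?thesis .
  qed
  note J = transform_invertible[OF B(1) e(1)]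
  let ?K = "matrix_inv J" and ?Kt = "matrix_inv (transpose J)"
  have "(?K ** matrix_inv B' ** ?Kt) ** B = ?K ** (matrix_inv B' ** (?Kt ** transpose J) ** B') ** J"
    by (simp add: e(1) matrix_mul_assoc)
  also have "\<dots> = mat 1"
    by (simp add: matrix_inv_works J pos_def_invertible[OF B(2)])
  finally have "matrix_inv B = ?K ** matrix_inv B' ** ?Kt" by (rule matrix_inv_unique)
  then have "matrix_inv B ** M = ?K ** (matrix_inv B' ** (?Kt ** transpose J) ** M') ** J"
    by (simp add: e(2) matrix_mul_assoc)
  also have "\<dots> = ?K ** (matrix_inv B' ** M') ** J"
    by (simp add: matrix_inv_works J)
  finally have "matrix_inv B ** M = ?K ** (matrix_inv B' ** M') ** J" .
  then have "trace (matrix_inv B ** M) = trace (J ** (?K ** (matrix_inv B' ** M')))"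
    by (simp only: trace_mul_sym[of _ J])
  also have "\<dots> = trace (matrix_inv B' ** M')"
    by (simp add: matrix_mul_assoc matrix_inv_works J)
  finally show ?thesis by (simp add: tr B)
qed

section \<open>Invariance of gradient pairings and Hessians\<close>

lemma matrix_inv_cancel: "invertible M \<Longrightarrow> matrix_inv M *v (M *v y) = y"
  for M :: "real^'n^'n"
  by (simp only: matrix_vector_mul_assoc matrix_inv_works(2) matrix_vector_mul_lid)

text \<open>The inner product of the gradients of \<open>a\<close> and \<open>b\<close>, the
  coordinate counterpart of \<open>gip\<close>.\<close>

definition cpair :: "(real^'n::finite \<Rightarrow> real^'n^'n) \<Rightarrow> (real^'n \<Rightarrow> real) \<Rightarrow> (real^'n \<Rightarrow> real) \<Rightarrow> real^'n \<Rightarrow> real" where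
  "cpair B a b x = (\<Uplus>i. (\<Uplus>j. matrix_inv (B x) $ i $ j * coord_deriv j a x) * coord_deriv i b x)"

lemma cpair_inner:
  "cpair B a b x = (matrix_inv (B x) *v (\<chi> j. coord_deriv j a x)) \<bullet> (\<chi> i. coord_deriv i b x)"
  by (simp add: cpair_def inner_vec_def matrix_vector_mult_def)

lemma coord_deriv_cong:
  assumes "open V" "x \<in> V" "\<And>y. y \<in> V \<Longrightarrow> a y = b y"
  shows "coord_deriv i a x = coord_deriv i b x"
  using pd_cong[of V a b x "axis i 1"] assms
  by (simp add: pd_def coord_deriv_def at_within_open[OF assms(2,1)])

lemma coord_deriv_chain:
  fixes \<phi> :: "real^'n::finite \<Rightarrow> real^'n"
  assumes "\<phi> differentiable at x" "a differentiable at (\<phi> x)"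
  shows "(\<chi> i. coord_deriv i (\<lambda>y. a (\<phi> y)) x) = transpose (jacobian \<phi> (at x)) *v (\<chi> k. coord_deriv k a (\<phi> x))"
proof -
  let ?J = "jacobian \<phi> (at x)" and ?D = "frechet_derivative a (at (\<phi> x))"
  have a: "(a has_derivative ?D) (at (\<phi> x))" using assms(2) by (simp add: frechet_derivative_works)
  have "(\<phi> has_derivative (*v) ?J) (at x)" using assms(1) jacobian_works by blast
  from has_derivative_compose[OF this a]
  have "((\<lambda>y. a (\<phi> y)) has_derivative (\<lambda>w. ?D (?J *v w))) (at x)" .
  then have c: "coord_deriv i (\<lambda>y. a (\<phi> y)) x = ?D (?J *v axis i 1)" for i
    by (simp add: coord_deriv_def frechet_derivative_at[symmetric])
  have lin: "linear ?D" by (rule has_derivative_linear[OF a])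
  have D: "?D w = (\<Uplus>k. w $ k * ?D (axis k 1))" for w
  proof -
    have "?D w = ?D (\<Uplus>k. w $ k *\<^sub>R axis k 1)"
      using basis_expansion[of w] by (simp add: scalar_mult_eq_scaleR)
    also have "\<dots> = (\<Uplus>k. w $ k * ?D (axis k 1))"
      by (simp only: linear_sum[OF lin] linear_scale[OF lin] real_scaleR_def)
    finally show ?thesis .
  qed
  have "coord_deriv i (\<lambda>y. a (\<phi> y)) x = (\<Uplus>k. ?J $ k $ i * coord_deriv k a (\<phi> x))" for i
    unfolding c coord_deriv_def[of _ a] D[of "?J *v axis i 1"]
    by (simp add: matrix_vector_mult_basis column_def)
  then show ?thesis
    by (intro iffD2[OF vec_eq_iff] allI) (simp only: vec_lambda_beta matrix_vector_mult_def transpose_def)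
qed

text \<open>Differentials are pulled back by the transposed Jacobian and gradients are pushed
  forward by the Jacobian, so the pairing of one with the other is unchanged.\<close>

lemma cpair_transform:
  fixes \<phi> :: "real^'n::finite \<Rightarrow> real^'n"
  assumes B: "pos_def (B x)" "pos_def (B' (\<phi> x))"
    and e: "B x = transpose (jacobian \<phi> (at x)) ** B' (\<phi> x) ** jacobian \<phi> (at x)"
    and d: "\<phi> differentiable at x" "a differentiable at (\<phi> x)" "b differentiable at (\<phi> x)"
    and V: "open V" "x \<in> V" "\<And>y. y \<in> V \<Longrightarrow> a' y = a (\<phi> y)" "\<And>y. y \<in> V \<Longrightarrow> b' y = b (\<phi> y)"
  shows "cpair B a' b' x = cpair B' a b (\<phi> x)"
proof -
  let ?J = "jacobian \<phi> (at x)"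
  let ?p = "\<chi> k. coord_deriv k a (\<phi> x)" and ?q = "\<chi> k. coord_deriv k b (\<phi> x)"
  have p: "(\<chi> i. coord_deriv i a' x) = transpose ?J *v ?p" "(\<chi> i. coord_deriv i b' x) = transpose ?J *v ?q"
    using coord_deriv_chain[OF d(1,2)] coord_deriv_chain[OF d(1,3)] coord_deriv_cong[OF V(1,2,3)] coord_deriv_cong[OF V(1,2,4)]
    by simp_all
  note J = transform_invertible[OF B(1) e]
  define w where "w = matrix_inv (B x) *v (transpose ?J *v ?p)"
  have "B x *v w = transpose ?J *v ?p"
    using matrix_inv_works[OF pos_def_invertible[OF B(1)]] by (simp add: w_def matrix_vector_mul_assoc)
  then have "transpose ?J *v (B' (\<phi> x) *v (?J *v w)) = transpose ?J *v ?p"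
    unfolding e by (simp only: matrix_vector_mul_assoc matrix_mul_assoc)
  then have "B' (\<phi> x) *v (?J *v w) = ?p" by (metis matrix_inv_cancel J(2))
  then have Jw: "?J *v w = matrix_inv (B' (\<phi> x)) *v ?p" by (metis matrix_inv_cancel pos_def_invertible B(2))
  have "w \<bullet> (transpose ?J *v ?q) = (?J *v w) \<bullet> ?q"
    by (metis dot_lmul_matrix inner_commute transpose_matrix_vector)
  then show ?thesis
    unfolding cpair_inner p w_def[symmetric] Jw .
qed

lemma smooth_on_static:
  fixes V :: "(real^'n::finite) set"
  assumes "open V" "smooth_on V F"
  shows "smooth_on (V \<times> {0..<1::real}) (\<lambda>(x, t). F x :: real)"
proof -
  have "Ck_on k (V \<times> {0..<1::real}) (\<lambda>z. F (fst z + 0))" for k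
    by (rule Ck_on_affine_map[where L = fst and a = 0 and S' = V and F = F])
       (use assms thick_Times[OF thick_open[OF assms(1)] thick_interval[of 1]] in
          \<open>auto simp: smooth_on_def bounded_linear_fst\<close>)
  then show ?thesis by (simp add: smooth_on_def case_prod_unfold)
qed

lemma smooth_on_bounded_linear:
  assumes "thick V" "bounded_linear L" "smooth_on V F"
  shows "smooth_on V (\<lambda>x. L (F x))"
  using assms Ck_on_linear unfolding smooth_on_def by blast

lemma smooth_on_component:
  fixes F :: "'a::euclidean_space \<Rightarrow> real^'n::finite"
  assumes "thick V" "smooth_on V F"
  shows "smooth_on V (\<lambda>x. F x $ i)"
  by (rule smooth_on_bounded_linear[OF assms(1) bounded_linear_vec_nth assms(2)])

lemma smooth_on_entry:
  fixes F :: "'a::euclidean_space \<Rightarrow> real^'n::finite^'m::finite"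
  assumes "thick V" "smooth_on V F"
  shows "smooth_on V (\<lambda>x. F x $ i $ j)"
  using smooth_on_bounded_linear[OF assms(1) bounded_linear_compose[OF bounded_linear_vec_nth bounded_linear_vec_nth] assms(2)] .

lemma smooth_on_differentiable_at:
  fixes V :: "'a::euclidean_space set"
  assumes "open V" "smooth_on V F" "x \<in> V"
  shows "F differentiable at x"
proof -
  have "Ck_on (Suc 0) V F" using assms(2) by (simp add: smooth_on_def)
  then have "F differentiable (at x within V)"
    using assms(3) unfolding Ck_on_Suc differentiable_on_def by blast
  then show ?thesis unfolding at_within_open[OF assms(3,1)] .
qed

text \<open>A single metric is regarded as constant in time, which makes the space-time jets
  available for it. The end time 1 and the base time 0 are arbitrary choices.\<close>

lemma static_metric_point:
  assumes "open V" "smooth_on V B" "\<And>x. x \<in> V \<Longrightarrow> pos_def (B x)" "x \<in> V"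
  shows "metric_point V 1 (\<lambda>x t. B x) (x, 0)"
proof -
  interpret domain V 1 by unfold_locales (simp_all add: assms(1))
  show ?thesis
  proof
    show "smooth_on S (\<lambda>(x, t). B x $ i $ j)" for i j
      unfolding S_def by (rule smooth_on_static[OF assms(1) smooth_on_entry[OF thick_open[OF assms(1)] assms(2)]])
  qed (use assms in \<open>simp_all add: S_def\<close>)
qed

text \<open>Instead of transforming Christoffel symbols, \<open>Hess_gip\<close> is evaluated twice:
  in the source with components of \<open>\<phi>\<close> for \<open>a\<close> and \<open>b\<close>,
  in the target with the coordinate functions. Invariance of pairings equates the right sides, and
  the gradients inserted span all directions.\<close>

lemma coord_hessian_transform:
  fixes \<phi> :: "real^'n::finite \<Rightarrow> real^'n"
  assumes V: "open V" "open V'" "\<And>x. x \<in> V \<Longrightarrow> \<phi> x \<in> V'" and \<phi>: "smooth_on V \<phi>"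
    and sB: "smooth_on V B" "smooth_on V' B'"
    and pB: "\<And>x. x \<in> V \<Longrightarrow> pos_def (B x)" "\<And>x. x \<in> V' \<Longrightarrow> pos_def (B' x)"
    and tens: "\<And>x. x \<in> V \<Longrightarrow> B x = transpose (jacobian \<phi> (at x)) ** B' (\<phi> x) ** jacobian \<phi> (at x)"
    and u: "smooth_on V' u" "smooth_on V u'" "\<And>x. x \<in> V \<Longrightarrow> u' x = u (\<phi> x)"
    and x: "x \<in> V"
  shows "coord_hessian B u' x = transpose (jacobian \<phi> (at x)) ** coord_hessian B' u (\<phi> x) ** jacobian \<phi> (at x)"
proof -
  let ?J = "jacobian \<phi> (at x)" and ?y = "\<phi> x"
  let ?Hc = "coord_hessian B u' x" and ?Hd = "coord_hessian B' u ?y"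
  interpret c: metric_point V 1 "\<lambda>x t. B x" "(x, 0)"
    using V sB pB x by (intro static_metric_point) auto
  interpret d: metric_point V' 1 "\<lambda>x t. B' x" "(?y, 0)"
    using V sB pB x by (intro static_metric_point) auto
  let ?cj = "\<lambda>F. c.jet (x, 0) (\<lambda>(x, t). F x)" and ?dj = "\<lambda>F. d.jet (?y, 0) (\<lambda>(x, t). F x)"
  have cj: "c.has_jet (x, 0) (\<lambda>x t. F x) (?cj F)" if "smooth_on V F" for F
    using smooth_on_static[OF V(1) that] by (intro c.has_jetI c.z) (simp add: c.S_def)
  have dj: "d.has_jet (?y, 0) (\<lambda>x t. F x) (?dj F)" if "smooth_on V' F" for F
    using smooth_on_static[OF V(2) that] by (intro d.has_jetI d.z) (simp add: d.S_def)
  have cg: "c.has_jet (x, 0) (\<lambda>x t. cpair B a b x) (c.ring.gip \<alpha> \<beta>)"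
    if "c.has_jet (x, 0) (\<lambda>x t. a x) \<alpha>" "c.has_jet (x, 0) (\<lambda>x t. b x) \<beta>" for a b \<alpha> \<beta>
    using c.has_jet_gip[OF that] by (simp add: cpair_def)
  have dg: "d.has_jet (?y, 0) (\<lambda>x t. cpair B' a b x) (d.ring.gip \<alpha> \<beta>)"
    if "d.has_jet (?y, 0) (\<lambda>x t. a x) \<alpha>" "d.has_jet (?y, 0) (\<lambda>x t. b x) \<beta>" for a b \<alpha> \<beta>
    using d.has_jet_gip[OF that] by (simp add: cpair_def)
  let ?p = "\<lambda>k x. \<phi> x $ k" and ?q = "\<lambda>k x. x $ k"
  have sp: "smooth_on V (?p k)" for k by (rule smooth_on_component[OF thick_open[OF V(1)] \<phi>])
  have sq: "smooth_on V' (?q k)" for k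
    unfolding smooth_on_def
    by (intro allI Ck_on_bounded_linear thick_open V bounded_linear_vec_nth)
  have diffd: "F differentiable at (\<phi> x')" if "smooth_on V' F" "x' \<in> V" for F :: "real^'n \<Rightarrow> real" and x'
    by (rule smooth_on_differentiable_at[OF V(2) that(1) V(3)[OF that(2)]])
  have diff\<phi>: "\<phi> differentiable at x'" if "x' \<in> V" for x'
    by (rule smooth_on_differentiable_at[OF V(1) \<phi> that])
  have tr: "cpair B a' b' x' = cpair B' a b (\<phi> x')"
    if "a differentiable at (\<phi> x')" "b differentiable at (\<phi> x')" "x' \<in> V" "\<And>y. y \<in> V \<Longrightarrow> a' y = a (\<phi> y)"
      "\<And>y. y \<in> V \<Longrightarrow> b' y = b (\<phi> y)" for a b a' b' x'
    using that by (intro cpair_transform[where V = V] pB V tens diff\<phi>) auto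
  \<comment> \<open>A pairing is itself an argument of the outer pairing, so
    \<open>cpair_transform\<close> asks for its differentiability; this is recovered from its
    jet.\<close>
  have diffg: "(\<lambda>x. cpair B' a b x) differentiable at ?y" if "smooth_on V' a" "smooth_on V' b" for a b
  proof -
    have "smooth_on d.S (\<lambda>(x, t). cpair B' a b x)"
      using dg[OF dj[OF that(1)] dj[OF that(2)]] by (simp add: d.has_jet_def)
    note this[THEN d.smooth_differentiable]
    then have "(\<lambda>(x, t). cpair B' a b x) differentiable (at (?y, 0) within d.S)"
      using d.z by (simp add: differentiable_on_def)
    then obtain D where D: "((\<lambda>(x, t). cpair B' a b x) has_derivative D) (at (?y, 0) within d.S)"
      by (auto simp: differentiable_def)
    have "((\<lambda>x. (\<lambda>(x, t). cpair B' a b x) (x, 0::real)) has_derivative (\<lambda>w. D (w, 0))) (at ?y within V')"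
    proof (rule has_derivative_in_compose[where f = "\<lambda>x. (x, 0)" and g' = D])
      show "((\<lambda>x. (x, 0)) has_derivative (\<lambda>w. (w, 0))) (at ?y within V')" by (auto intro!: derivative_eq_intros)
      show "((\<lambda>(x, t). cpair B' a b x) has_derivative D) (at (?y, 0) within (\<lambda>x. (x, 0)) ` V')"
        by (rule has_derivative_subset[OF D]) (auto simp: d.S_def)
    qed
    then show ?thesis
      using at_within_open[OF V(3)[OF x] V(2)] by (auto simp: differentiable_def)
  qed
  have gg: "cpair B a' (cpair B b' b'') x = cpair B' a (cpair B' b c) ?y"
    if "smooth_on V' a" "smooth_on V' b" "smooth_on V' c" "\<And>y. y \<in> V \<Longrightarrow> a' y = a (\<phi> y)"
      "\<And>y. y \<in> V \<Longrightarrow> b' y = b (\<phi> y)" "\<And>y. y \<in> V \<Longrightarrow> b'' y = c (\<phi> y)" for a b c a' b' b''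
    using that x by (intro tr diffd diffg) auto
  have gg1: "cpair B (?p k) (cpair B u' (?p l)) x = cpair B' (?q k) (cpair B' u (?q l)) ?y" for k l
    by (rule gg[OF sq u(1) sq _ u(3)]) simp_all
  have gg2: "cpair B u' (cpair B (?p k) (?p l)) x = cpair B' u (cpair B' (?q k) (?q l)) ?y" for k l
    by (rule gg[OF u(1) sq sq u(3)]) simp_all
  have Jc: "coord_deriv j (?p k) x = ?J $ k $ j" for j k
  proof -
    have "(\<phi> has_derivative (*v) ?J) (at x)" using diff\<phi>[OF x] jacobian_works by blast
    then have "(?p k has_derivative (\<lambda>w. (?J *v w) $ k)) (at x)"
      by (rule bounded_linear.has_derivative[OF bounded_linear_vec_nth])
    then show ?thesis
      by (simp add: coord_deriv_def frechet_derivative_at[symmetric] matrix_vector_mult_basis column_def)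
  qed
  have Jd: "coord_deriv j (?q k) ?y = (if k = j then 1 else 0)" for j k
  proof -
    have "(?q k has_derivative (\<lambda>w. w $ k)) (at ?y)"
      by (rule bounded_linear_imp_has_derivative[OF bounded_linear_vec_nth])
    then show ?thesis
      by (simp add: coord_deriv_def frechet_derivative_at[symmetric] axis_def)
  qed
  let ?hc = "matrix_inv (B x)" and ?hd = "matrix_inv (B' ?y)"
  have symc: "transpose ?hc = ?hc" and symd: "transpose ?hd = ?hd"
    using pos_def_inv_sym pB x V(3) by auto
  \<comment> \<open>Row \<open>k\<close> of \<open>E\<close> is the gradient of the component
    \<open>k\<close> of \<open>\<phi>\<close> in the source metric.\<close>
  define E where "E = ?J ** ?hc"
  have gradc: "ev (c.ring.grad (?cj (?p k)) i) = E $ k $ i" for k i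
  proof -
    have "ev (c.ring.grad (?cj (?p k)) i) = (\<Uplus>j. ?hc $ i $ j * ?J $ k $ j)"
      using c.has_jet_ev[OF c.has_jet_h] c.has_jet_ev[OF c.has_jet_coord_deriv[OF cj[OF sp]]]
      by (simp add: c.ring.grad_def Jc)
    also have "\<dots> = (\<Uplus>j. ?J $ k $ j * transpose ?hc $ j $ i)"
      by (simp add: transpose_def mult.commute)
    finally show ?thesis unfolding symc by (simp add: E_def matrix_matrix_mult_def)
  qed
  have gradd: "ev (d.ring.grad (?dj (?q k)) i) = ?hd $ k $ i" for k i
  proof -
    have "ev (d.ring.grad (?dj (?q k)) i) = (\<Uplus>j. ?hd $ i $ j * (if j = k then 1 else 0))"
      using d.has_jet_ev[OF d.has_jet_h] d.has_jet_ev[OF d.has_jet_coord_deriv[OF dj[OF sq]]]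
      by (simp add: d.ring.grad_def Jd eq_commute)
    also have "\<dots> = transpose ?hd $ k $ i" by (simp add: sum_delta_right transpose_def)
    finally show ?thesis unfolding symd .
  qed
  have Hc: "ev (c.ring.Hess (?cj u') i j) = ?Hc $ i $ j" for i j
    by (rule c.has_jet_ev[OF c.has_jet_hessian[OF cj[OF u(2)]]])
  have Hd: "ev (d.ring.Hess (?dj u) i j) = ?Hd $ i $ j" for i j
    by (rule d.has_jet_ev[OF d.has_jet_hessian[OF dj[OF u(1)]]])
  have mul3: "(\<Uplus>i j. L $ k $ i * L $ l $ j * M $ i $ j) = (L ** M ** transpose L) $ k $ l" for L M :: "real^'n^'n" and k l
    by (subst sum.swap) (simp add: matrix_matrix_mult_def transpose_def sum_distrib_left sum_distrib_right mult_ac)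
  have "E ** ?Hc ** transpose E = ?hd ** ?Hd ** transpose ?hd"
  proof -
    have "(E ** ?Hc ** transpose E) $ k $ l = (?hd ** ?Hd ** transpose ?hd) $ k $ l" for k l
    proof -
      have "2 * (E ** ?Hc ** transpose E) $ k $ l
          = cpair B (?p k) (cpair B u' (?p l)) x + cpair B (?p l) (cpair B u' (?p k)) x - cpair B u' (cpair B (?p k) (?p l)) x"
        using arg_cong[OF c.ring.Hess_gip[where a = "?cj (?p k)" and b = "?cj (?p l)" and u = "?cj u'"], of ev]
        unfolding mul3[symmetric]
        by (simp add: gradc Hc c.has_jet_ev[OF cg[OF cj[OF sp] cg[OF cj[OF u(2)] cj[OF sp]]]]
            c.has_jet_ev[OF cg[OF cj[OF u(2)] cg[OF cj[OF sp] cj[OF sp]]]])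
      also have "\<dots> = cpair B' (?q k) (cpair B' u (?q l)) ?y + cpair B' (?q l) (cpair B' u (?q k)) ?y
          - cpair B' u (cpair B' (?q k) (?q l)) ?y"
        by (simp only: gg1 gg2)
      also have "\<dots> = 2 * (?hd ** ?Hd ** transpose ?hd) $ k $ l"
        using arg_cong[OF d.ring.Hess_gip[where a = "?dj (?q k)" and b = "?dj (?q l)" and u = "?dj u"], of ev]
        unfolding mul3[symmetric]
        by (simp add: gradd Hd d.has_jet_ev[OF dg[OF dj[OF sq] dg[OF dj[OF u(1)] dj[OF sq]]]]
            d.has_jet_ev[OF dg[OF dj[OF u(1)] dg[OF dj[OF sq] dj[OF sq]]]])
      finally show ?thesis by simp
    qed
    then show ?thesis by (simp add: vec_eq_iff)
  qed
  note J = transform_invertible[OF pB(1)[OF x] tens[OF x]]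
  \<comment> \<open>The transformation law of the inverse metric. It rewrites both sides of the
    previous equation with the outer factors \<open>E\<close> and \<open>transpose E\<close>, which
    can be cancelled.\<close>
  have "(E ** transpose ?J) ** B' ?y = E ** (transpose ?J ** B' ?y ** ?J) ** matrix_inv ?J"
    by (simp add: matrix_inv_works J flip: matrix_mul_assoc)
  also have "\<dots> = ?J ** (?hc ** B x) ** matrix_inv ?J"
    unfolding tens[OF x, symmetric] by (simp add: E_def matrix_mul_assoc)
  also have "\<dots> = mat 1"
    by (simp add: matrix_inv_works J pos_def_invertible[OF pB(1)[OF x]])
  finally have hd: "?hd = E ** transpose ?J" by (rule matrix_inv_unique)
  have E: "invertible E" "invertible (transpose E)"
  proof -
    have "invertible ?hc"
      using matrix_inv_works[OF pos_def_invertible[OF pB(1)[OF x]]] unfolding invertible_def by blast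
    then show "invertible E" unfolding E_def using J(1) by (simp add: invertible_mult)
    then show "invertible (transpose E)" by (simp add: invertible_det_nz)
  qed
  have cancel: "matrix_inv E ** (E ** M ** transpose E) ** matrix_inv (transpose E) = M" for M
    by (metis E matrix_inv_works matrix_mul_assoc matrix_mul_lid matrix_mul_rid)
  have "E ** ?Hc ** transpose E = E ** (transpose ?J ** ?Hd ** ?J) ** transpose E"
    using \<open>E ** ?Hc ** transpose E = _\<close> unfolding hd
    by (simp add: matrix_transpose_mul matrix_mul_assoc)
  then show ?thesis by (metis cancel)
qed

section \<open>Charts of the manifold\<close>

lemma is_chart_facts:
  assumes "is_chart X c"
  shows "fst c \<subseteq> topspace X" "inj_on (snd c) (fst c)" "open (chart_image c)" "openin X (fst c)"
    and "\<And>p. p \<in> fst c \<Longrightarrow> chart_inv c (snd c p) = p"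
    and "\<And>p. p \<in> fst c \<Longrightarrow> snd c p \<in> chart_image c"
    and "\<And>x. x \<in> chart_image c \<Longrightarrow> chart_inv c x \<in> fst c"
    and "\<And>x. x \<in> chart_image c \<Longrightarrow> snd c (chart_inv c x) = x"
proof -
  show "openin X (fst c)" "open (chart_image c)" using assms by (auto simp: is_chart_def)
  then show s: "fst c \<subseteq> topspace X" using openin_subset by blast
  show i: "inj_on (snd c) (fst c)"
    using assms homeomorphic_imp_injective_map[of "subtopology X (fst c)" _ "snd c"] s
    by (fastforce simp: is_chart_def Int_absorb1)
  show "\<And>p. p \<in> fst c \<Longrightarrow> chart_inv c (snd c p) = p"
    using i by (simp add: chart_inv_def)
  show "\<And>p. p \<in> fst c \<Longrightarrow> snd c p \<in> chart_image c" by (simp add: chart_image_def)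
  show "\<And>x. x \<in> chart_image c \<Longrightarrow> chart_inv c x \<in> fst c"
    by (simp add: chart_inv_def chart_image_def inv_into_into)
  show "\<And>x. x \<in> chart_image c \<Longrightarrow> snd c (chart_inv c x) = x"
    by (simp add: chart_inv_def chart_image_def f_inv_into_f)
qed

lemma open_chart_overlap:
  fixes c :: "('m, 'n::finite) chart"
  assumes "is_chart X c" "openin X W"
  shows "open (snd c ` (fst c \<inter> W))"
proof -
  have "open_map (subtopology X (fst c)) (top_of_set (chart_image c)) (snd c)"
    using assms(1) homeomorphic_imp_open_map by (auto simp: is_chart_def)
  moreover have "openin (subtopology X (fst c)) (fst c \<inter> W)"
    using assms(2) by (simp add: openin_subtopology_Int2)
  ultimately have "openin (top_of_set (chart_image c)) (snd c ` (fst c \<inter> W))"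
    by (simp add: open_map_def)
  then show ?thesis
    using is_chart_facts(3)[OF assms(1)] by (metis openin_open_trans)
qed

lemma openin_chart_preimage:
  fixes c :: "('m, 'n::finite) chart"
  assumes "is_chart X c" "open B"
  shows "openin X {q \<in> fst c. snd c q \<in> B}"
proof -
  have "continuous_map (subtopology X (fst c)) (top_of_set (chart_image c)) (snd c)"
    using assms(1) homeomorphic_imp_continuous_map by (auto simp: is_chart_def)
  then have "openin (subtopology X (fst c)) {q \<in> topspace (subtopology X (fst c)). snd c q \<in> chart_image c \<inter> B}"
    using assms(2) by (intro openin_continuous_map_preimage) auto
  moreover have "{q \<in> topspace (subtopology X (fst c)). snd c q \<in> chart_image c \<inter> B} = {q \<in> fst c. snd c q \<in> B}"
    using is_chart_facts[OF assms(1)] by auto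
  ultimately show ?thesis
    using is_chart_facts(4)[OF assms(1)] by (simp add: openin_open_subtopology)
qed

lemma smooth_on_subset:
  fixes F :: "'a::euclidean_space \<Rightarrow> 'b::real_normed_vector"
  shows "smooth_on S F \<Longrightarrow> thick S' \<Longrightarrow> S' \<subseteq> S \<Longrightarrow> smooth_on S' F"
  unfolding smooth_on_def using Ck_on_subset by blast

lemma smooth_on_slice:
  fixes V :: "(real^'n::finite) set" and t :: real
  assumes "open V" "t \<in> I" "smooth_on (V \<times> I) F"
  shows "smooth_on V (\<lambda>x. F (x, t))"
proof -
  have "Ck_on k V (\<lambda>x. F ((x, 0) + (0, t)))" for k
  proof (rule Ck_on_affine_map[where L = "\<lambda>x. (x, 0)" and a = "(0, t)" and S' = "V \<times> I" and F = F])
    show "bounded_linear (\<lambda>x. (x :: real^'n, 0 :: real))"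
      by (intro bounded_linear_Pair bounded_linear_ident bounded_linear_zero)
  qed (use assms in \<open>auto simp: smooth_on_def thick_open\<close>)
  then show ?thesis by (simp add: smooth_on_def)
qed

lemma coord_hessian_cong:
  assumes "open V" "x \<in> V" "\<And>y. y \<in> V \<Longrightarrow> a y = b y"
  shows "coord_hessian B a x = coord_hessian B b x"
proof -
  have 1: "coord_deriv j a y = coord_deriv j b y" if "y \<in> V" for j y
    by (rule coord_deriv_cong[OF assms(1) that assms(3)])
  have "coord_deriv i (coord_deriv j a) x = coord_deriv i (coord_deriv j b) x" for i j
    by (rule coord_deriv_cong[OF assms(1,2) 1])
  then show ?thesis using 1[OF assms(2)] by (simp add: coord_hessian_def)
qed

lemma coord_laplacian_cong:
  assumes "open V" "x \<in> V" "\<And>y. y \<in> V \<Longrightarrow> a y = b y"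
  shows "coord_laplacian B a x = coord_laplacian B b x"
  using coord_hessian_cong[OF assms, where B = B] by (simp add: coord_laplacian_def)

lemma coord_gradient_cong:
  assumes "open V" "x \<in> V" "\<And>y. y \<in> V \<Longrightarrow> a y = b y"
  shows "coord_gradient B a x = coord_gradient B b x"
proof -
  have "coord_deriv i a x = coord_deriv i b x" for i by (rule coord_deriv_cong[OF assms])
  then show ?thesis by (simp add: coord_gradient_def)
qed

section \<open>Chart independence of the differential operators\<close>

locale manifold =
  fixes X :: "'m topology" and A :: "('m, 'n::finite) chart set"
  assumes atlas: "smooth_atlas X A"
begin

lemma chart: "c \<in> A \<Longrightarrow> is_chart X c"
  using atlas by (simp add: smooth_atlas_def)

lemmas chart_facts = is_chart_facts[OF chart]

lemma chart_at:
  assumes "p \<in> topspace X"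
  shows "chart_at A p \<in> A" "p \<in> fst (chart_at A p)"
proof -
  have "\<exists>c. c \<in> A \<and> p \<in> fst c" using assms atlas unfolding smooth_atlas_def by blast
  from someI_ex[OF this] show "chart_at A p \<in> A" "p \<in> fst (chart_at A p)" by (auto simp: chart_at_def)
qed

lemma topspace_chart: "c \<in> A \<Longrightarrow> p \<in> fst c \<Longrightarrow> p \<in> topspace X"
  using chart_facts(1) by blast

lemma local_metric_chart: "c \<in> A \<Longrightarrow> p \<in> fst c \<Longrightarrow> local_metric c h (snd c p) = h c p"
  by (simp add: local_metric_def chart_facts)

lemma metric_pos_def: "riemannian_metric A h \<Longrightarrow> c \<in> A \<Longrightarrow> p \<in> fst c \<Longrightarrow> pos_def (h c p)"
  by (simp add: riemannian_metric_def pos_def_def)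

abbreviation jac :: "('m, 'n) chart \<Rightarrow> ('m, 'n) chart \<Rightarrow> 'm \<Rightarrow> real^'n^'n" where
  "jac c d p \<equiv> jacobian (transition c d) (at (snd c p))"

lemma tensorD:
  "riemannian_metric A h \<Longrightarrow> c \<in> A \<Longrightarrow> d \<in> A \<Longrightarrow> p \<in> fst c \<Longrightarrow> p \<in> fst d \<Longrightarrow>
    h c p = transpose (jac c d p) ** h d p ** jac c d p"
  unfolding riemannian_metric_def is_tensor2_def Let_def by blast

definition ov :: "('m, 'n) chart \<Rightarrow> ('m, 'n) chart \<Rightarrow> (real^'n) set" where
  "ov c d = snd c ` (fst c \<inter> fst d)"

context
  fixes c d h
  assumes c: "c \<in> A" and d: "d \<in> A" and h: "riemannian_metric A h"
begin

lemma overlap: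
  "open (ov c d)" "open (ov d c)" "ov c d \<subseteq> chart_image c" "ov d c \<subseteq> chart_image d"
  "x \<in> ov c d \<Longrightarrow> transition c d x \<in> ov d c"
  "x \<in> ov c d \<Longrightarrow> \<exists>p. p \<in> fst c \<and> p \<in> fst d \<and> x = snd c p \<and> transition c d x = snd d p"
  "smooth_on (ov c d) (transition c d)"
proof -
  show "open (ov c d)" "open (ov d c)"
    unfolding ov_def by (intro open_chart_overlap[OF chart] c d chart_facts)+
  show "ov c d \<subseteq> chart_image c" "ov d c \<subseteq> chart_image d" by (auto simp: ov_def chart_image_def)
  show *: "x \<in> ov c d \<Longrightarrow> \<exists>p. p \<in> fst c \<and> p \<in> fst d \<and> x = snd c p \<and> transition c d x = snd d p"
    by (auto simp: ov_def transition_def chart_facts c)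
  show "x \<in> ov c d \<Longrightarrow> transition c d x \<in> ov d c"
    using * by (auto simp: ov_def)
  show "smooth_on (ov c d) (transition c d)"
    using atlas c d by (simp add: smooth_atlas_def ov_def)
qed

lemma metric_smooth: "smooth_on (ov c d) (local_metric c h)" "smooth_on (ov d c) (local_metric d h)"
proof -
  have "smooth_on (chart_image c) (local_metric c h)" "smooth_on (chart_image d) (local_metric d h)"
    using h c d by (simp_all add: riemannian_metric_def local_metric_def[abs_def])
  note this[THEN smooth_on_subset]
  from this(1)[OF thick_open overlap(3)] this(2)[OF thick_open overlap(4)] overlap(1,2)
  show "smooth_on (ov c d) (local_metric c h)" "smooth_on (ov d c) (local_metric d h)" by blast+
qed

lemma metric_tensor:
  assumes "x \<in> ov c d"
  shows "local_metric c h x = transpose (jacobian (transition c d) (at x)) ** local_metric d h (transition c d x)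
     ** jacobian (transition c d) (at x)"
    and "pos_def (local_metric c h x)" "pos_def (local_metric d h (transition c d x))"
proof -
  obtain p where p: "p \<in> fst c" "p \<in> fst d" "x = snd c p" "transition c d x = snd d p"
    using overlap(6)[OF assms] by blast
  show "local_metric c h x = transpose (jacobian (transition c d) (at x)) ** local_metric d h (transition c d x)
     ** jacobian (transition c d) (at x)"
    using tensorD[OF h c d p(1,2)] p local_metric_chart c d by simp
  show "pos_def (local_metric c h x)" "pos_def (local_metric d h (transition c d x))"
    using p metric_pos_def[OF h] local_metric_chart c d by simp_all
qed

text \<open>The Hessian transforms as a tensor and its metric trace is invariant; the squared
  gradient norm is the pairing \<open>cpair\<close> of the function with itself.\<close>

lemma chart_change:
  assumes u: "smooth_on (chart_image c) (u \<circ> chart_inv c)" "smooth_on (chart_image d) (u \<circ> chart_inv d)"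
    and p: "p \<in> fst c" "p \<in> fst d"
  shows "coord_laplacian (local_metric c h) (u \<circ> chart_inv c) (snd c p)
       = coord_laplacian (local_metric d h) (u \<circ> chart_inv d) (snd d p)"
    and "(metric_norm (h c p) (coord_gradient (local_metric c h) (u \<circ> chart_inv c) (snd c p)))\<^sup>2
       = (metric_norm (h d p) (coord_gradient (local_metric d h) (u \<circ> chart_inv d) (snd d p)))\<^sup>2"
proof -
  let ?x = "snd c p"
  have x: "?x \<in> ov c d" using p by (auto simp: ov_def)
  have tx: "transition c d ?x = snd d p" using p by (simp add: transition_def chart_facts c)
  have us: "smooth_on (ov c d) (u \<circ> chart_inv c)" "smooth_on (ov d c) (u \<circ> chart_inv d)"
    by (rule smooth_on_subset[OF u(1) thick_open[OF overlap(1)] overlap(3)])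
       (rule smooth_on_subset[OF u(2) thick_open[OF overlap(2)] overlap(4)])
  have ut: "(u \<circ> chart_inv c) y = (u \<circ> chart_inv d) (transition c d y)" if "y \<in> ov c d" for y
    using overlap(6)[OF that] chart_facts(5)[OF c] chart_facts(5)[OF d] by force
  have pd': "pos_def (local_metric d h y)" if "y \<in> ov d c" for y
    using that metric_pos_def[OF h d] local_metric_chart[OF d] by (auto simp: ov_def)
  have H: "coord_hessian (local_metric c h) (u \<circ> chart_inv c) ?x
    = transpose (jac c d p) ** coord_hessian (local_metric d h) (u \<circ> chart_inv d) (transition c d ?x) ** jac c d p"
    by (rule coord_hessian_transform[OF overlap(1,2,5,7) metric_smooth metric_tensor(2) pd' metric_tensor(1) us(2,1) ut x])
  show "coord_laplacian (local_metric c h) (u \<circ> chart_inv c) (snd c p)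
       = coord_laplacian (local_metric d h) (u \<circ> chart_inv d) (snd d p)"
    using metric_trace_transform[OF metric_tensor(2,3,1)[OF x] H] by (simp add: coord_laplacian_def tx)
  have n: "(metric_norm (h e p) (coord_gradient (local_metric e h) w (snd e p)))\<^sup>2
      = cpair (local_metric e h) w w (snd e p)" if "e \<in> A" "p \<in> fst e" for e w
    using metric_norm_raise[OF metric_pos_def[OF h that]] that
    by (simp add: coord_gradient_def cpair_def local_metric_chart)
  have "cpair (local_metric c h) (u \<circ> chart_inv c) (u \<circ> chart_inv c) ?x
      = cpair (local_metric d h) (u \<circ> chart_inv d) (u \<circ> chart_inv d) (transition c d ?x)"
    by (intro cpair_transform[where V = "ov c d"] metric_tensor x overlap ut
        smooth_on_differentiable_at[OF overlap(1,7)] smooth_on_differentiable_at[OF overlap(2) us(2)])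
  then show "(metric_norm (h c p) (coord_gradient (local_metric c h) (u \<circ> chart_inv c) (snd c p)))\<^sup>2
       = (metric_norm (h d p) (coord_gradient (local_metric d h) (u \<circ> chart_inv d) (snd d p)))\<^sup>2"
    unfolding n[OF c p(1)] n[OF d p(2)] tx .
qed

end

lemma laplacian_chart:
  assumes "riemannian_metric A h" "\<And>c. c \<in> A \<Longrightarrow> smooth_on (chart_image c) (u \<circ> chart_inv c)" "c \<in> A" "p \<in> fst c"
  shows "laplacian A h u p = coord_laplacian (local_metric c h) (u \<circ> chart_inv c) (snd c p)"
proof -
  have p: "p \<in> topspace X" using topspace_chart assms(3,4) by blast
  show ?thesis
    unfolding laplacian_def Let_def
    by (rule chart_change(1)[OF chart_at(1)[OF p] assms(3,1)]) (intro assms chart_at[OF p])+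
qed

lemma gradient_norm_chart:
  assumes "riemannian_metric A h" "\<And>c. c \<in> A \<Longrightarrow> smooth_on (chart_image c) (u \<circ> chart_inv c)" "c \<in> A" "p \<in> fst c"
  shows "(gradient_norm A h u p)\<^sup>2
    = (metric_norm (h c p) (coord_gradient (local_metric c h) (u \<circ> chart_inv c) (snd c p)))\<^sup>2"
proof -
  have p: "p \<in> topspace X" using topspace_chart assms(3,4) by blast
  show ?thesis
    unfolding gradient_norm_def Let_def
    by (rule chart_change(2)[OF chart_at(1)[OF p] assms(3,1)]) (intro assms chart_at[OF p])+
qed

end

locale manifold_flow = manifold X A for X :: "'m topology" and A :: "('m, 'n::finite) chart set" +
  fixes g :: "real \<Rightarrow> ('m, 'n) tensor2" and T :: real
  assumes flow: "ricci_flow A T g"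
begin

lemma T: "0 < T" using flow by (simp add: ricci_flow_def)

lemma metric: "t \<in> {0..T} \<Longrightarrow> riemannian_metric A (g t)"
  using flow by (simp add: ricci_flow_def)

lemma flow_eq:
  "c \<in> A \<Longrightarrow> p \<in> fst c \<Longrightarrow> t \<in> {0..T} \<Longrightarrow>
    ((\<lambda>s. g s c p) has_vector_derivative (- 2) *\<^sub>R ricci (g t) c p) (at t within {0..T})"
  using flow by (simp add: ricci_flow_def)

lemma ricci_tensor:
  assumes "c \<in> A" "d \<in> A" "p \<in> fst c" "p \<in> fst d" "t \<in> {0..T}"
  shows "ricci (g t) c p = transpose (jac c d p) ** ricci (g t) d p ** jac c d p"
proof -
  let ?J = "jac c d p"
  let ?L = "\<lambda>M. transpose ?J ** M ** ?J"
  have lin: "linear ?L"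
    by (rule linearI) (simp_all add: vec_eq_iff matrix_matrix_mult_def algebra_simps sum.distrib
        sum_distrib_left sum_distrib_right)
  then have bl: "bounded_linear ?L" by (simp add: linear_conv_bounded_linear)
  \<comment> \<open>The Jacobian of the transition does not depend on time, so the tensor law of the
    metric can be differentiated in time.\<close>
  have "((\<lambda>s. ?L (g s d p)) has_vector_derivative ?L ((- 2) *\<^sub>R ricci (g t) d p)) (at t within {0..T})"
    by (rule bounded_linear.has_vector_derivative[OF bl flow_eq[OF assms(2,4,5)]])
  then have "((\<lambda>s. g s c p) has_vector_derivative ?L ((- 2) *\<^sub>R ricci (g t) d p)) (at t within {0..T})"
    by (rule has_vector_derivative_transform[OF assms(5), rotated]) (use tensorD[OF metric assms(1-4)] in auto)
  then have "(- 2) *\<^sub>R ricci (g t) c p = ?L ((- 2) *\<^sub>R ricci (g t) d p)"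
    using vector_derivative_unique_within_closed_interval[of 0 T t] flow_eq[OF assms(1,3,5)] T assms(5) by simp
  also have "\<dots> = (- 2) *\<^sub>R ?L (ricci (g t) d p)" by (rule linear_scale[OF lin])
  finally show ?thesis by simp
qed

lemma scalar_curvature_chart:
  assumes "c \<in> A" "p \<in> fst c" "t \<in> {0..T}"
  shows "scalar_curvature A (g t) p = coord_scalar (local_metric c (g t)) (snd c p)"
proof -
  have p: "p \<in> topspace X" using topspace_chart assms by blast
  let ?c = "chart_at A p"
  note c = chart_at[OF p]
  have "metric_trace (g t ?c p) (ricci (g t) ?c p) = metric_trace (g t c p) (ricci (g t) c p)"
    by (rule metric_trace_transform[OF _ _ tensorD[OF metric c(1) assms(1) c(2) assms(2)]
        ricci_tensor[OF c(1) assms(1) c(2) assms(2)]])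
       (intro metric_pos_def[OF metric] c assms)+
  then show ?thesis
    using c assms by (simp add: scalar_curvature_def Let_def coord_scalar_def ricci_def local_metric_chart)
qed

lemma flow_domain_chart:
  assumes c: "c \<in> A"
  shows "flow_domain (chart_image c) T (\<lambda>x t. local_metric c (g t) x)"
proof -
  interpret domain "chart_image c" T by unfold_locales (auto simp: chart_facts c T)
  show ?thesis
  proof
    fix i j
    have "smooth_on (chart_image c \<times> {0..T}) (\<lambda>(x, t). g t c (chart_inv c x))"
      using flow c by (simp add: ricci_flow_def)
    then have "smooth_on S (\<lambda>(x, t). g t c (chart_inv c x))"
      by (rule smooth_on_subset[OF _ thick_S]) (auto simp: S_def)
    from smooth_on_entry[OF thick_S this, of i j]
    show "sm (\<lambda>x t. local_metric c (g t) x $ i $ j)"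
      by (simp add: local_metric_def case_prod_unfold)
  next
    fix x t assume x: "x \<in> chart_image c" and t: "t \<in> {0..<T}"
    show "pos_def (local_metric c (g t) x)"
      using t by (simp add: local_metric_def metric_pos_def[OF metric c] chart_facts[OF c] x)
    fix i j
    have "((\<lambda>s. g s c (chart_inv c x)) has_vector_derivative (- 2) *\<^sub>R ricci (g t) c (chart_inv c x)) (at t within {0..T})"
      using t by (intro flow_eq c chart_facts x) auto
    then have "((\<lambda>s. g s c (chart_inv c x) $ i $ j) has_vector_derivative ((- 2) *\<^sub>R ricci (g t) c (chart_inv c x)) $ i $ j) (at t within {0..T})"
      by (rule bounded_linear.has_vector_derivative[OF bounded_linear_compose[OF bounded_linear_vec_nth bounded_linear_vec_nth]])
    moreover have "ricci (g t) c (chart_inv c x) = coord_ricci (\<lambda>y. local_metric c (g t) y) x"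
      using chart_facts(8)[OF c x] by (simp add: ricci_def)
    moreover have "g s c (chart_inv c x) = local_metric c (g s) x" for s by (simp add: local_metric_def)
    ultimately have "((\<lambda>s. local_metric c (g s) x $ i $ j) has_vector_derivative
        ((- 2) *\<^sub>R coord_ricci (\<lambda>y. local_metric c (g t) y) x) $ i $ j) (at t within {0..T})" by (simp only:)
    then have "((\<lambda>s. local_metric c (g s) x $ i $ j) has_real_derivative
        ((- 2) *\<^sub>R coord_ricci (\<lambda>y. local_metric c (g t) y) x) $ i $ j) (at t within {0..T})"
      by (simp only: has_real_derivative_iff_has_vector_derivative)
    then have "((\<lambda>s. local_metric c (g s) x $ i $ j) has_real_derivative
        ((- 2) *\<^sub>R coord_ricci (\<lambda>y. local_metric c (g t) y) x) $ i $ j) (at t within {0..<T})"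
      by (rule DERIV_subset) auto
    then show "((\<lambda>s. local_metric c (g s) x $ i $ j) has_real_derivative
         - (2 * coord_ricci (\<lambda>y. local_metric c (g t) y) x $ i $ j)) (at t within {0..<T})"
      by simp
  qed
qed

end

section \<open>The maximum principle\<close>

locale manifold_heat = manifold_flow X A g T
  for X :: "'m topology" and A :: "('m, 'n::finite) chart set" and g T +
  fixes f v P :: "real \<Rightarrow> 'm \<Rightarrow> real"
  assumes heat: "positive_conjugate_heat_solution X A T g f"
    and v: "t \<in> {0..<T} \<Longrightarrow> p \<in> topspace X \<Longrightarrow>
           v t p = - ln (f t p) - real CARD('n) / 2 * ln (4 * pi * (T - t))"
    and P: "t \<in> {0..<T} \<Longrightarrow> p \<in> topspace X \<Longrightarrow>
           P t p = 2 * laplacian A (g t) (v t) p - (gradient_norm A (g t) (v t) p)\<^sup>2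
                   + scalar_curvature A (g t) p"
begin

lemma f_smooth: "c \<in> A \<Longrightarrow> smooth_on (chart_image c \<times> {0..<T}) (\<lambda>(x, t). f t (chart_inv c x))"
  using heat by (simp add: positive_conjugate_heat_solution_def)

lemma f_slice: "c \<in> A \<Longrightarrow> t \<in> {0..<T} \<Longrightarrow> smooth_on (chart_image c) (f t \<circ> chart_inv c)"
  using smooth_on_slice[OF chart_facts(3) _ f_smooth, of c t] by (simp add: comp_def)

lemma heat_domain_chart:
  assumes c: "c \<in> A"
  shows "heat_domain (chart_image c) T (\<lambda>x t. local_metric c (g t) x) (\<lambda>x t. f t (chart_inv c x))"
proof -
  interpret flow_domain "chart_image c" T "\<lambda>x t. local_metric c (g t) x" by (rule flow_domain_chart[OF c])
  show ?thesis
  proof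
    show "sm (\<lambda>x t. f t (chart_inv c x))" using f_smooth[OF c] by (simp add: S_def)
    fix x t assume x: "x \<in> chart_image c" and t: "t \<in> {0..<T}"
    have t': "t \<in> {0..T}" using t by simp
    let ?p = "chart_inv c x"
    have p: "?p \<in> fst c" "snd c ?p = x" "?p \<in> topspace X"
      using chart_facts[OF c] x by auto
    have h: "f t ?p > 0" "((\<lambda>s. f s ?p) has_real_derivative
           - laplacian A (g t) (f t) ?p + scalar_curvature A (g t) ?p * f t ?p) (at t within {0..<T})"
      using heat p(3) t by (auto simp: positive_conjugate_heat_solution_def)
    show "f t ?p > 0" by (rule h(1))
    have l: "laplacian A (g t) (f t) ?p = coord_laplacian (\<lambda>y. local_metric c (g t) y) (\<lambda>y. f t (chart_inv c y)) x"
      using laplacian_chart[OF metric[OF t'] f_slice[OF _ t] c p(1)] p(2) by (simp add: comp_def)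
    have s: "scalar_curvature A (g t) ?p = coord_scalar (\<lambda>y. local_metric c (g t) y) x"
      using scalar_curvature_chart[OF c p(1) t'] p(2) by simp
    show "((\<lambda>s. f s ?p) has_real_derivative
        - coord_laplacian (\<lambda>y. local_metric c (g t) y) (\<lambda>y. f t (chart_inv c y)) x
        + coord_scalar (\<lambda>y. local_metric c (g t) y) x * f t ?p) (at t within {0..<T})"
      using h(2) unfolding l s .
  qed
qed

abbreviation Pc :: "('m, 'n) chart \<Rightarrow> real^'n \<Rightarrow> real \<Rightarrow> real" where
  "Pc c \<equiv> heat_domain.P T (\<lambda>x t. local_metric c (g t) x) (\<lambda>x t. f t (chart_inv c x))"

abbreviation vc :: "('m, 'n) chart \<Rightarrow> real^'n \<Rightarrow> real \<Rightarrow> real" where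
  "vc c \<equiv> heat_domain.v T (\<lambda>x t. f t (chart_inv c x))"

lemma v_chart:
  assumes "c \<in> A" "t \<in> {0..<T}" "x \<in> chart_image c"
  shows "vc c x t = (v t \<circ> chart_inv c) x"
  using v[OF assms(2)] topspace_chart[OF assms(1)] chart_facts(7)[OF assms(1,3)]
  by (simp add: heat_domain.v_def[OF heat_domain_chart[OF assms(1)]])

lemma v_slice:
  assumes c: "c \<in> A" and t: "t \<in> {0..<T}"
  shows "smooth_on (chart_image c) (v t \<circ> chart_inv c)"
proof -
  interpret c: heat_domain "chart_image c" T "\<lambda>x t. local_metric c (g t) x" "\<lambda>x t. f t (chart_inv c x)"
    by (rule heat_domain_chart[OF c])
  have "smooth_on (chart_image c \<times> {0..<T}) (case_prod c.v)"
    using c.sm_v by (simp add: c.S_def)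
  from smooth_on_slice[OF c.U t this]
  have "Ck_on k (chart_image c) (\<lambda>x. c.v x t)" for k by (simp add: smooth_on_def)
  then have "Ck_on k (chart_image c) (v t \<circ> chart_inv c)" for k
    by (rule Ck_on_cong[rotated]) (rule v_chart[OF c t])
  then show ?thesis by (simp add: smooth_on_def)
qed

text \<open>Replaces the chart selected separately at each point by one fixed chart, in which
  \<open>P\<close> is jointly smooth in space and time.\<close>

lemma P_chart:
  assumes c: "c \<in> A" and t: "t \<in> {0..<T}" and p: "p \<in> fst c"
  shows "P t p = Pc c (snd c p) t"
proof -
  interpret c: heat_domain "chart_image c" T "\<lambda>x t. local_metric c (g t) x" "\<lambda>x t. f t (chart_inv c x)"
    by (rule heat_domain_chart[OF c])
  let ?x = "snd c p" and ?G = "\<lambda>x. local_metric c (g t) x"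
  have t': "t \<in> {0..T}" using t by simp
  have x: "?x \<in> chart_image c" using chart_facts c p by blast
  have vv: "(v t \<circ> chart_inv c) y = c.v y t" if "y \<in> chart_image c" for y
    using v_chart[OF c t that] by simp
  have "laplacian A (g t) (v t) p = coord_laplacian ?G (\<lambda>y. c.v y t) ?x"
    using laplacian_chart[OF metric[OF t'] v_slice[OF _ t] c p] coord_laplacian_cong[OF c.U x vv] by simp
  moreover have "(gradient_norm A (g t) (v t) p)\<^sup>2
      = (metric_norm (local_metric c (g t) ?x) (coord_gradient ?G (\<lambda>y. c.v y t) ?x))\<^sup>2"
    using gradient_norm_chart[OF metric[OF t'] v_slice[OF _ t] c p] coord_gradient_cong[OF c.U x vv]
      local_metric_chart[OF c p] by simp
  moreover have "scalar_curvature A (g t) p = coord_scalar ?G ?x"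
    by (rule scalar_curvature_chart[OF c p t'])
  ultimately show ?thesis
    using P[OF t topspace_chart[OF c p]] by (simp add: c.P_def)
qed

text \<open>Continuity in a chart, reduced to its upper half and phrased with a product
  neighbourhood; compactness passes this form on to the maximum.\<close>

lemma P_upper_semicontinuous:
  assumes p: "p \<in> topspace X" and t: "t \<in> {0..<T}" and a: "P t p < a"
  shows "\<exists>W \<delta>. openin X W \<and> p \<in> W \<and> 0 < \<delta> \<and> (\<forall>q\<in>W. \<forall>s\<in>{0..<T}. \<bar>s - t\<bar> < \<delta> \<longrightarrow> P s q < a)"
proof -
  define c where "c = chart_at A p"
  have c: "c \<in> A" "p \<in> fst c" unfolding c_def using chart_at[OF p] by auto
  interpret c: heat_domain "chart_image c" T "\<lambda>x t. local_metric c (g t) x" "\<lambda>x t. f t (chart_inv c x)"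
    by (rule heat_domain_chart[OF c(1)])
  have "continuous_on c.S (case_prod c.P)"
    using c.sm_P Ck_on.simps(1) unfolding smooth_on_def by blast
  moreover have z: "(snd c p, t) \<in> c.S" using chart_facts(6)[OF c] t by (simp add: c.S_def)
  moreover have "0 < a - P t p" using a by simp
  ultimately obtain r where r: "r > 0"
    "\<And>z. z \<in> c.S \<Longrightarrow> dist z (snd c p, t) < r \<Longrightarrow> dist (case_prod c.P z) (case_prod c.P (snd c p, t)) < a - P t p"
    unfolding continuous_on_iff by blast
  \<comment> \<open>Half the radius for space and half for time keep the distance in space-time
    below \<open>r\<close>.\<close>
  let ?W = "{q \<in> fst c. snd c q \<in> ball (snd c p) (r/2)}"
  have "P s q < a" if "q \<in> ?W" "s \<in> {0..<T}" "\<bar>s - t\<bar> < r/2" for q s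
  proof -
    have "dist (snd c q, s) (snd c p, t) \<le> dist (snd c q) (snd c p) + dist s t"
      by (simp add: dist_prod_def sqrt_sum_squares_le_sum)
    also have "\<dots> < r" using that by (simp add: dist_real_def dist_commute)
    finally have "dist (c.P (snd c q) s) (c.P (snd c p) t) < a - P t p"
      using r(2)[of "(snd c q, s)"] that chart_facts(6)[OF c(1), of q] by (simp add: c.S_def)
    then show ?thesis
      using P_chart[OF c(1) that(2), of q] P_chart[OF c(1) t c(2)] that(1) by (simp add: dist_real_def)
  qed
  moreover have "openin X ?W" by (rule openin_chart_preimage[OF chart[OF c(1)] open_ball])
  ultimately show ?thesis using r(1) c(2) by (intro exI[of _ ?W] exI[of _ "r/2"]) auto
qed

lemma P_derivative_at_max:
  assumes p: "p \<in> topspace X" and t: "t \<in> {0..<T}" and max: "\<And>q. q \<in> topspace X \<Longrightarrow> P t q \<le> P t p"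
  shows "\<exists>D\<ge>0. ((\<lambda>s. P s p) has_real_derivative D) (at t within {0..<T})"
proof -
  define c where "c = chart_at A p"
  have c: "c \<in> A" "p \<in> fst c" unfolding c_def using chart_at[OF p] by auto
  interpret c: heat_domain "chart_image c" T "\<lambda>x t. local_metric c (g t) x" "\<lambda>x t. f t (chart_inv c x)"
    by (rule heat_domain_chart[OF c(1)])
  have "c.P y t \<le> c.P (snd c p) t" if "y \<in> chart_image c" for y
    using max[of "chart_inv c y"] P_chart[OF c(1) t, of "chart_inv c y"] P_chart[OF c(1) t c(2)]
      chart_facts[OF c(1)] that topspace_chart[OF c(1)] by simp
  from c.P_time_derivative_nonneg[OF chart_facts(6)[OF c] t this]
  obtain D where D: "D \<ge> 0" "((\<lambda>s. c.P (snd c p) s) has_real_derivative D) (at t within {0..<T})" by blast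
  have "((\<lambda>s. P s p) has_real_derivative D) (at t within {0..<T})"
    by (rule has_field_derivative_transform_within[OF D(2) zero_less_one t])
       (use P_chart[OF c(1) _ c(2)] in auto)
  with D(1) show ?thesis by blast
qed

end

section \<open>Compactness and monotonicity of the maximum\<close>

lemma compact_space_finite_cover:
  assumes "compact_space X" "\<And>p. p \<in> topspace X \<Longrightarrow> openin X (W p) \<and> p \<in> W p"
  obtains F where "finite F" "F \<subseteq> topspace X" "topspace X \<subseteq> (\<Union>p\<in>F. W p)"
proof -
  have "compactin X (topspace X)" using assms(1) by (simp add: compact_space_def)
  moreover have "\<forall>U \<in> W ` topspace X. openin X U" "topspace X \<subseteq> \<Union> (W ` topspace X)"
    using assms(2) by auto
  ultimately obtain \<F> where "finite \<F>" "\<F> \<subseteq> W ` topspace X" "topspace X \<subseteq> \<Union> \<F>"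
    unfolding compactin_def by meson
  then show ?thesis using that finite_subset_image[of \<F> W "topspace X"] by blast
qed

text \<open>Continuous induction for each slope e > 0: consider the last time up to which M s + e (s
  - a) is known to reach \<open>M a\<close>. Upper semicontinuity includes that time, and the Dini
  condition pushes beyond it unless it is \<open>b\<close>.\<close>

lemma dini_mono_on:
  fixes M :: "real \<Rightarrow> real"
  assumes usc: "\<And>t a. t \<in> {0..<T} \<Longrightarrow> M t < a \<Longrightarrow> \<exists>\<delta>>0. \<forall>s\<in>{0..<T}. \<bar>s - t\<bar> < \<delta> \<longrightarrow> M s < a"
    and dini: "\<And>t e. t \<in> {0..<T} \<Longrightarrow> 0 < e \<Longrightarrow> \<exists>\<delta>>0. \<forall>s\<in>{0..<T}. t < s \<and> s < t + \<delta> \<longrightarrow> M t - e * (s - t) \<le> M s"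
  shows "mono_on {0..<T} M"
proof (rule mono_onI)
  fix a b assume ab: "a \<in> {0..<T}" "b \<in> {0..<T}" "a \<le> b"
  have eps: "M a \<le> M b + e * (b - a)" if e: "e > 0" for e
  proof -
    define Z where "Z = {s \<in> {a..b}. M a \<le> M s + e * (s - a)}"
    define \<sigma> where "\<sigma> = Sup Z"
    have aZ: "a \<in> Z" using ab by (simp add: Z_def)
    have bdd: "bdd_above Z" by (rule bdd_aboveI[of _ b]) (simp add: Z_def)
    have \<sigma>: "a \<le> \<sigma>" "\<sigma> \<le> b"
      unfolding \<sigma>_def using aZ bdd by (auto intro!: cSup_upper cSup_least simp: Z_def)
    then have \<sigma>T: "\<sigma> \<in> {0..<T}" using ab by auto
    \<comment> \<open>Otherwise \<open>M\<close> stays below the bound on a whole neighbourhood of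
      \<open>\<sigma>\<close>, which contains members of \<open>Z\<close> at or to the left of
      \<open>\<sigma>\<close>.\<close>
    have in_Z: "M a \<le> M \<sigma> + e * (\<sigma> - a)"
    proof (rule ccontr)
      assume "\<not> ?thesis"
      then have "M \<sigma> < M a - e * (\<sigma> - a)" by simp
      from usc[OF \<sigma>T this] obtain \<delta> where \<delta>: "\<delta> > 0"
        "\<And>s. s \<in> {0..<T} \<Longrightarrow> \<bar>s - \<sigma>\<bar> < \<delta> \<Longrightarrow> M s < M a - e * (\<sigma> - a)" by blast
      have "\<sigma> - \<delta> < Sup Z" using \<delta>(1) by (simp add: \<sigma>_def)
      then obtain s where s: "s \<in> Z" "\<sigma> - \<delta> < s" using less_cSup_iff[of Z] aZ bdd by blast
      have "s \<le> \<sigma>" unfolding \<sigma>_def by (rule cSup_upper[OF s(1) bdd])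
      moreover have "M a \<le> M s + e * (s - a)" "s \<in> {0..<T}" using s(1) ab by (auto simp: Z_def)
      ultimately have "M s < M a - e * (\<sigma> - a)" "e * (s - a) \<le> e * (\<sigma> - a)"
        using \<delta>(2)[of s] s(2) e by auto
      with \<open>M a \<le> M s + e * (s - a)\<close> show False by simp
    qed
    have "\<sigma> = b"
    proof (rule ccontr)
      assume "\<sigma> \<noteq> b"
      with \<sigma> have lt: "\<sigma> < b" by simp
      obtain \<delta> where \<delta>: "\<delta> > 0" "\<And>s. s \<in> {0..<T} \<Longrightarrow> \<sigma> < s \<Longrightarrow> s < \<sigma> + \<delta> \<Longrightarrow> M \<sigma> - e * (s - \<sigma>) \<le> M s"
        using dini[OF \<sigma>T e] by blast
      define s where "s = min b (\<sigma> + \<delta> / 2)"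
      have s: "\<sigma> < s" "s < \<sigma> + \<delta>" "s \<le> b" using lt \<delta>(1) by (auto simp: s_def min_def)
      have "M \<sigma> - e * (s - \<sigma>) \<le> M s" by (rule \<delta>(2)) (use s \<sigma> ab in auto)
      then have "M a \<le> M s + e * (s - a)" using in_Z by (simp add: algebra_simps)
      then have "s \<in> Z" using s \<sigma> by (simp add: Z_def)
      then have "s \<le> \<sigma>" unfolding \<sigma>_def by (rule cSup_upper[OF _ bdd])
      with s(1) show False by simp
    qed
    then show ?thesis using in_Z by simp
  qed
  show "M a \<le> M b"
  proof (rule field_le_epsilon)
    fix e :: real assume "e > 0"
    \<comment> \<open>The added 1 keeps the divisor positive when a = b.\<close>
    have "e / (b - a + 1) * (b - a) \<le> e" using \<open>e > 0\<close> ab(3) by (simp add: field_simps)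
    with eps[of "e / (b - a + 1)"] \<open>e > 0\<close> ab(3) show "M a \<le> M b + e" by (simp add: add_nonneg_pos)
  qed
qed

theorem theorem4p1:
  fixes X :: "'m topology"
    and A :: "('m, 'n::finite) chart set"
    and g :: "real \<Rightarrow> ('m, 'n) tensor2"
    and f v P :: "real \<Rightarrow> 'm \<Rightarrow> real"
    and T :: real
  assumes "closed_manifold X A"
    and "ricci_flow A T g"
    and "positive_conjugate_heat_solution X A T g f"
    and "\<And>t p. t \<in> {0..<T} \<Longrightarrow> p \<in> topspace X \<Longrightarrow>
           v t p = - ln (f t p) - real CARD('n) / 2 * ln (4 * pi * (T - t))"
    and "\<And>t p. t \<in> {0..<T} \<Longrightarrow> p \<in> topspace X \<Longrightarrow>
           P t p = 2 * laplacian A (g t) (v t) p - (gradient_norm A (g t) (v t) p)\<^sup>2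
                   + scalar_curvature A (g t) p"
  shows "(\<forall>t\<in>{0..<T}. \<exists>p\<in>topspace X. \<forall>q\<in>topspace X. P t q \<le> P t p) \<and>
         mono_on {0..<T} (\<lambda>t. SUP p\<in>topspace X. P t p)"
proof
  have cpt: "compact_space X" and ne: "topspace X \<noteq> {}" and at: "smooth_atlas X A"
    using assms(1) by (simp_all add: closed_manifold_def)
  interpret manifold_heat X A g T f v P
    by unfold_locales (use assms at in auto)
  let ?M = "\<lambda>t. SUP p\<in>topspace X. P t p"
  show max: "\<forall>t\<in>{0..<T}. \<exists>p\<in>topspace X. \<forall>q\<in>topspace X. P t q \<le> P t p"
  proof (intro ballI, rule ccontr)
    fix t assume t: "t \<in> {0..<T}" and "\<not> (\<exists>p\<in>topspace X. \<forall>q\<in>topspace X. P t q \<le> P t p)"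
    then have "\<forall>p\<in>topspace X. \<exists>q\<in>topspace X. P t p < P t q" by (meson not_le)
    \<comment> \<open>If there were no maximum, every point would be exceeded by some
      \<open>up p\<close>, and by semicontinuity so would a whole neighbourhood of it.\<close>
    then obtain up where up: "\<And>p. p \<in> topspace X \<Longrightarrow> up p \<in> topspace X \<and> P t p < P t (up p)" by metis
    have "\<exists>W. openin X W \<and> p \<in> W \<and> (\<forall>q\<in>W. P t q < P t (up p))" if "p \<in> topspace X" for p
      using P_upper_semicontinuous[OF that t] up[OF that] t by fastforce
    then obtain W where W: "\<And>p. p \<in> topspace X \<Longrightarrow> openin X (W p) \<and> p \<in> W p \<and> (\<forall>q\<in>W p. P t q < P t (up p))"
      by metis
    obtain F where F: "finite F" "F \<subseteq> topspace X" "topspace X \<subseteq> (\<Union>p\<in>F. W p)"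
      using compact_space_finite_cover[OF cpt, of W] W by blast
    have "F \<noteq> {}" using F(3) ne by auto
    \<comment> \<open>The best of the finitely many values P t (up p). The point \<open>up r\<close>
      lies in some \<open>W p\<close>, which makes its value smaller than that of
      \<open>up p\<close>, against the choice of \<open>r\<close>.\<close>
    then obtain r where r: "r \<in> F" "\<And>p. p \<in> F \<Longrightarrow> P t (up p) \<le> P t (up r)"
      using F(1) obtains_MAX[of F "\<lambda>p. P t (up p)"] by (metis Max_ge finite_imageI image_eqI)
    obtain p where "p \<in> F" "up r \<in> W p" using F r(1) up by blast
    then show False using W[of p] r(2)[of p] F(2) by fastforce
  qed
  then obtain pm where pm: "\<And>t. t \<in> {0..<T} \<Longrightarrow> pm t \<in> topspace X"
    "\<And>t q. t \<in> {0..<T} \<Longrightarrow> q \<in> topspace X \<Longrightarrow> P t q \<le> P t (pm t)" by metis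
  \<comment> \<open>The supremum is attained, so \<open>SUP\<close> is the true maximum and no
    default value of an unbounded set intervenes.\<close>
  have M: "?M t = P t (pm t)" if "t \<in> {0..<T}" for t
    by (rule cSup_eq_maximum) (use pm that in auto)
  show "mono_on {0..<T} ?M"
  proof (rule dini_mono_on)
    fix t a assume t: "t \<in> {0..<T}" and a: "?M t < a"
    have "\<exists>W \<delta>. openin X W \<and> p \<in> W \<and> 0 < \<delta> \<and> (\<forall>q\<in>W. \<forall>s\<in>{0..<T}. \<bar>s - t\<bar> < \<delta> \<longrightarrow> P s q < a)" if p: "p \<in> topspace X" for p
      using pm(2)[OF t p] M[OF t] a by (intro P_upper_semicontinuous p t) simp
    then obtain W \<delta> where W: "\<And>p. p \<in> topspace X \<Longrightarrow> openin X (W p) \<and> p \<in> W p"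
      "\<And>p. p \<in> topspace X \<Longrightarrow> 0 < \<delta> p"
      "\<And>p q s. p \<in> topspace X \<Longrightarrow> q \<in> W p \<Longrightarrow> s \<in> {0..<T} \<Longrightarrow> \<bar>s - t\<bar> < \<delta> p \<Longrightarrow> P s q < a"
      by metis
    obtain F where F: "finite F" "F \<subseteq> topspace X" "topspace X \<subseteq> (\<Union>p\<in>F. W p)"
      using compact_space_finite_cover[OF cpt, of W] W(1) by blast
    have "F \<noteq> {}" using F(3) ne by auto
    \<comment> \<open>The time radii of a finite subcover have a positive minimum, which works for
      the maximiser at time \<open>s\<close> wherever it lies.\<close>
    show "\<exists>\<delta>>0. \<forall>s\<in>{0..<T}. \<bar>s - t\<bar> < \<delta> \<longrightarrow> ?M s < a"
    proof (intro exI[of _ "Min (\<delta> ` F)"] conjI ballI impI)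
      show "0 < Min (\<delta> ` F)" using F W(2) \<open>F \<noteq> {}\<close> by (subst Min_gr_iff) auto
      fix s assume s: "s \<in> {0..<T}" "\<bar>s - t\<bar> < Min (\<delta> ` F)"
      obtain p where p: "p \<in> F" "pm s \<in> W p" using F(3) pm(1)[OF s(1)] by blast
      have "Min (\<delta> ` F) \<le> \<delta> p" using F(1) p(1) by (intro Min_le) auto
      with s(2) have "\<bar>s - t\<bar> < \<delta> p" by linarith
      then show "?M s < a" unfolding M[OF s(1)] using W(3)[of p "pm s" s] p F(2) s(1) by blast
    qed
  next
    fix t e :: real assume t: "t \<in> {0..<T}" and e: "0 < e"
    obtain D where D: "D \<ge> 0" "((\<lambda>s. P s (pm t)) has_real_derivative D) (at t within {0..<T})"
      using P_derivative_at_max[OF pm(1)[OF t] t pm(2)[OF t]] by blast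
    have "((\<lambda>s. (P s (pm t) - P t (pm t)) / (s - t)) \<longlongrightarrow> D) (at t within {0..<T})"
      using D(2) by (simp add: has_field_derivative_iff)
    then have "\<forall>\<^sub>F s in at t within {0..<T}. - e < (P s (pm t) - P t (pm t)) / (s - t)"
      by (rule order_tendstoD) (use D(1) e in simp)
    then obtain \<delta> where \<delta>: "\<delta> > 0" "\<And>s. s \<in> {0..<T} \<Longrightarrow> s \<noteq> t \<Longrightarrow> dist s t < \<delta> \<Longrightarrow> - e < (P s (pm t) - P t (pm t)) / (s - t)"
      unfolding eventually_at by blast
    show "\<exists>\<delta>>0. \<forall>s\<in>{0..<T}. t < s \<and> s < t + \<delta> \<longrightarrow> ?M t - e * (s - t) \<le> ?M s"
    proof (intro exI[of _ \<delta>] conjI ballI impI \<delta>(1))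
      fix s assume s: "s \<in> {0..<T}" "t < s \<and> s < t + \<delta>"
      then have "- e < (P s (pm t) - P t (pm t)) / (s - t)" by (intro \<delta>(2)) (auto simp: dist_real_def)
      then have "- e * (s - t) < P s (pm t) - P t (pm t)" using s by (simp add: pos_less_divide_eq)
      \<comment> \<open>The maximiser of time \<open>t\<close> is a competitor at time
        \<open>s\<close>, so a lower bound for its value bounds the maximum from below.\<close>
      moreover have "P s (pm t) \<le> P s (pm s)" by (intro pm s t)
      ultimately show "?M t - e * (s - t) \<le> ?M s" unfolding M[OF t] M[OF s(1)] by simp
    qed
  qed
qed

end
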